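(* Assume $\mathrm{curl}\,H_{0,\mathrm{ex}}\not\equiv0$ in $\Omega$. Then $$\liminf_{\varepsilon\to0^+}\mathrm R_\varepsilon>0.$$
   Context: $\Omega\subset\mathbb R^3$ is a bounded simply connected domain without holes ($\partial\Omega$ connected), with $C^2$ boundary and unit normal $\nu$. $b\in(0,1)$ is independent of $\varepsilon$; for each $\varepsilon>0$, $a_\varepsilon\in L^\infty(\Omega)$ takes values in $[b,1]$. $H_{0,\mathrm{ex}}\in L^2_{\mathrm{loc}}(\mathbb R^3,\mathbb R^3)$ is a fixed divergence-free vector field with $H_{0,\mathrm{ex}}\in L^3(\Omega,\mathbb R^3)$ (its curl is understood in the sense of distributions). $A_{0,\mathrm{ex}}\in H^1_{\mathrm{loc}}(\mathbb R^3,\mathbb R^3)$ is a fixed vector potential with $\mathrm{curl}\,A_{0,\mathrm{ex}}=H_{0,\mathrm{ex}}$, $\mathrm{div}\,A_{0,\mathrm{ex}}=0$ in $\mathbb R^3$. $\rho_\varepsilon$ is the unique positive minimizer in $H^1(\Omega)$ of $E_\varepsilon(u)=\frac12\int_\Omega|\nabla u|^2+\frac1{2\varepsilon^2}(a_\varepsilon-|u|^2)^2$; it satisfies $b\le\rho_\varepsilon^2\le1$. $\dot H^1_\sigma(\mathbb R^3,\mathbb R^3)$ is the space of divergence-free fields in the homogeneous Sobolev space $\dot H^1(\mathbb R^3,\mathbb R^3)$ (completion of $C_0^\infty$ in the norm $\|\nabla\cdot\|_{L^2}$). For a field $A$, $\phi_{A,\rho_\varepsilon^2}\in H^1(\Omega)$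 is the unique zero-average solution of $\mathrm{div}(\rho_\varepsilon^2(A-\nabla\phi))=0$ in $\Omega$, $\rho_\varepsilon^2(A-\nabla\phi)\cdot\nu=0$ on $\partial\Omega$. $A_\varepsilon^0$ is the unique minimizer in $A_{0,\mathrm{ex}}+\dot H^1_\sigma(\mathbb R^3,\mathbb R^3)$ of $$J_\varepsilon(A)=\frac12\int_\Omega\rho_\varepsilon^2|A-\nabla\phi_{A,\rho_\varepsilon^2}|^2+\frac12\int_{\mathbb R^3}|\mathrm{curl}(A-A_{0,\mathrm{ex}})|^2,$$ and $\phi_\varepsilon^0:=\phi_{A_\varepsilon^0,\rho_\varepsilon^2}$. $B_\varepsilon^0\in H^1(\Omega,\mathbb R^3)$ is the unique field with $\mathrm{curl}\,B_\varepsilon^0=\rho_\varepsilon^2(A_\varepsilon^0-\nabla\phi_\varepsilon^0)$, $\mathrm{div}\,B_\varepsilon^0=0$ in $\Omega$ and $B_\varepsilon^0\times\nu=0$ on $\partial\Omega$. $X$ is the class of normal $1$-currents supported in $\overline\Omega$, with boundary supported on $\partial\Omega$, that are simple oriented Lipschitz curves (so each is either a loop contained in $\overline\Omega$ or has its two endpoints on $\partial\Omega$). For $\Gamma\in X$, $\langle\Gamma,B\rangle$ is the circulation of $B$ along $\Gamma$, $\rho_\varepsilon^2\Gamma$ is the current $\omega\mapsto\langle\Gamma,\rho_\varepsilon^2\omega\rangle$, and $|\cdot|$ denotes mass. Finally $$\mathrm R_\varepsilon=\sup_{\Gamma\in X}\frac{\langle\Gamma,B_\varepsilon^0\rangle}{|\rho_\varepsilon^2\Gamma|}.$$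 *)

theory Defs
  imports "HOL-Analysis.Analysis"
begin

definition partial :: "3 \<Rightarrow> (real^3 \<Rightarrow> real) \<Rightarrow> real^3 \<Rightarrow> real" where
  "partial i f x = frechet_derivative f (at x) (axis i 1)"

definition grad :: "(real^3 \<Rightarrow> real) \<Rightarrow> real^3 \<Rightarrow> real^3" where
  "grad f x = (\<chi> i. partial i f x)"

definition curl_op :: "(real^3 \<Rightarrow> real^3) \<Rightarrow> real^3 \<Rightarrow> real^3" where
  "curl_op F x = vector
     [partial 2 (\<lambda>y. F y $ 3) x - partial 3 (\<lambda>y. F y $ 2) x,
      partial 3 (\<lambda>y. F y $ 1) x - partial 1 (\<lambda>y. F y $ 3) x,
      partial 1 (\<lambda>y. F y $ 2) x - partial 2 (\<lambda>y. F y $ 1) x]"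

text \<open>Meant for open \<open>S\<close>, where it is the usual class $C^k(S)$.\<close>

primrec Ck_on :: "nat \<Rightarrow> (real^3) set \<Rightarrow> (real^3 \<Rightarrow> real) \<Rightarrow> bool" where
  "Ck_on 0 S f \<longleftrightarrow> continuous_on S f"
| "Ck_on (Suc k) S f \<longleftrightarrow> (\<forall>x\<in>S. f differentiable (at x)) \<and> (\<forall>i. Ck_on k S (partial i f))"

definition test_fun :: "(real^3) set \<Rightarrow> (real^3 \<Rightarrow> real) \<Rightarrow> bool" where
  "test_fun U f \<longleftrightarrow> (\<forall>k. Ck_on k UNIV f) \<and> (\<exists>K. compact K \<and> K \<subseteq> U \<and> (\<forall>x. x \<notin> K \<longrightarrow> f x = 0))"

definition test_field :: "(real^3) set \<Rightarrow> (real^3 \<Rightarrow> real^3) \<Rightarrow> bool" where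
  "test_field U F \<longleftrightarrow> (\<forall>i. test_fun U (\<lambda>x. F x $ i))"

text \<open>
  Near \<open>p\<close> the domain is a sublevel set of a $C^2$ function without critical points. By the
  implicit function theorem this says that \<open>\<Omega>\<close> is locally the region on one side of a $C^2$
  graph, and the gradient points out of \<open>\<Omega>\<close>.
\<close>

definition C2_defining_fun :: "(real^3) set \<Rightarrow> real^3 \<Rightarrow> (real^3) set \<Rightarrow> (real^3 \<Rightarrow> real) \<Rightarrow> bool" where
  "C2_defining_fun \<Omega> p U g \<longleftrightarrow>
     open U \<and> p \<in> U \<and> Ck_on 2 U g \<and> (\<forall>x\<in>U. grad g x \<noteq> 0) \<and> \<Omega> \<inter> U = {x\<in>U. g x < 0}"

definition C2_boundary :: "(real^3) set \<Rightarrow> bool" where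
  "C2_boundary \<Omega> \<longleftrightarrow> (\<forall>p\<in>frontier \<Omega>. \<exists>U g. C2_defining_fun \<Omega> p U g)"

definition outer_unit_normal :: "(real^3) set \<Rightarrow> real^3 \<Rightarrow> real^3 \<Rightarrow> bool" where
  "outer_unit_normal \<Omega> p n \<longleftrightarrow>
     (\<exists>U g. C2_defining_fun \<Omega> p U g \<and> n = grad g p /\<^sub>R norm (grad g p))"

definition Lp_on :: "real \<Rightarrow> (real^3) set \<Rightarrow> (real^3 \<Rightarrow> 'b::euclidean_space) \<Rightarrow> bool" where
  "Lp_on p U f \<longleftrightarrow> set_borel_measurable lebesgue U f \<and>
     set_integrable lebesgue U (\<lambda>x. norm (f x) powr p)"

definition Lp_loc :: "real \<Rightarrow> (real^3) set \<Rightarrow> (real^3 \<Rightarrow> 'b::euclidean_space) \<Rightarrow> bool" where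
  "Lp_loc p U f \<longleftrightarrow> (\<forall>K. compact K \<and> K \<subseteq> U \<longrightarrow> Lp_on p K f)"

definition weak_grad :: "(real^3) set \<Rightarrow> (real^3 \<Rightarrow> real) \<Rightarrow> (real^3 \<Rightarrow> real^3) \<Rightarrow> bool" where
  "weak_grad U u G \<longleftrightarrow> Lp_loc 1 U u \<and> Lp_loc 1 U G \<and>
     (\<forall>\<psi> i. test_fun U \<psi> \<longrightarrow>
        (LINT x:U|lebesgue. u x * partial i \<psi> x) = - (LINT x:U|lebesgue. (G x $ i) * \<psi> x))"

definition weak_div :: "(real^3) set \<Rightarrow> (real^3 \<Rightarrow> real^3) \<Rightarrow> (real^3 \<Rightarrow> real) \<Rightarrow> bool" where
  "weak_div U F d \<longleftrightarrow> Lp_loc 1 U F \<and> Lp_loc 1 U d \<and>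
     (\<forall>\<psi>. test_fun U \<psi> \<longrightarrow>
        (LINT x:U|lebesgue. F x \<bullet> grad \<psi> x) = - (LINT x:U|lebesgue. d x * \<psi> x))"

definition weak_curl :: "(real^3) set \<Rightarrow> (real^3 \<Rightarrow> real^3) \<Rightarrow> (real^3 \<Rightarrow> real^3) \<Rightarrow> bool" where
  "weak_curl U F C \<longleftrightarrow> Lp_loc 1 U F \<and> Lp_loc 1 U C \<and>
     (\<forall>\<psi>. test_field U \<psi> \<longrightarrow>
        (LINT x:U|lebesgue. F x \<bullet> curl_op \<psi> x) = (LINT x:U|lebesgue. C x \<bullet> \<psi> x))"

text \<open>Weak derivatives are unique up to null sets; these operators select a representative.\<close>

definition wgrad :: "(real^3) set \<Rightarrow> (real^3 \<Rightarrow> real) \<Rightarrow> real^3 \<Rightarrow> real^3" where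
  "wgrad U u = (SOME G. weak_grad U u G)"

definition wcurl :: "(real^3) set \<Rightarrow> (real^3 \<Rightarrow> real^3) \<Rightarrow> real^3 \<Rightarrow> real^3" where
  "wcurl U F = (SOME C. weak_curl U F C)"

definition H1 :: "(real^3) set \<Rightarrow> (real^3 \<Rightarrow> real) \<Rightarrow> bool" where
  "H1 U u \<longleftrightarrow> Lp_on 2 U u \<and> (\<exists>G. weak_grad U u G \<and> Lp_on 2 U G)"

definition H1_field :: "(real^3) set \<Rightarrow> (real^3 \<Rightarrow> real^3) \<Rightarrow> bool" where
  "H1_field U F \<longleftrightarrow> (\<forall>i. H1 U (\<lambda>x. F x $ i))"

definition H1_loc_field :: "(real^3 \<Rightarrow> real^3) \<Rightarrow> bool" where
  "H1_loc_field F \<longleftrightarrow> (\<forall>i. Lp_loc 2 UNIV (\<lambda>x. F x $ i) \<and>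
     (\<exists>G. weak_grad UNIV (\<lambda>x. F x $ i) G \<and> Lp_loc 2 UNIV G))"

text \<open>
  The completion of $C_0^\infty(R^3,R^3)$ in $\|\nabla\cdot\|_{L^2}$, realised as usual as a space of
  functions: by the Sobolev inequality a sequence that is Cauchy in this norm converges in $L^6$,
  hence in $L^2_{loc}$, and the completion is identified with the set of these limits. The local
  convergence fixes the additive constant that the gradient does not see.
\<close>

definition dotH1_field :: "(real^3 \<Rightarrow> real^3) \<Rightarrow> bool" where
  "dotH1_field V \<longleftrightarrow>
     (\<exists>W G. (\<forall>n. test_field UNIV (W n)) \<and> Lp_loc 2 UNIV V \<and>
        (\<forall>i. weak_grad UNIV (\<lambda>x. V x $ i) (G i) \<and> Lp_on 2 UNIV (G i) \<and>
             (\<lambda>n::nat. LINT x|lebesgue. (norm (grad (\<lambda>y. W n y $ i) x - G i x))\<^sup>2) \<longlonglongrightarrow> 0) \<and>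
        (\<forall>K. compact K \<longrightarrow> (\<lambda>n. LINT x:K|lebesgue. (norm (W n x - V x))\<^sup>2) \<longlonglongrightarrow> 0))"

definition dotH1_sigma :: "(real^3 \<Rightarrow> real^3) set" where
  "dotH1_sigma = {V. dotH1_field V \<and> weak_div UNIV V (\<lambda>_. 0)}"

text \<open>
  Limits of averages over $B(x,r)\cap\Omega$. For $x\in\Omega$ this is the precise representative; for
  $x\in\partial\Omega$ it is the pointwise description of the trace of an $H^1$ function, valid at
  almost every boundary point for the surface measure. If $f$ has a representative that is
  continuous on the closure of $\Omega$, then \<open>precise_rep \<Omega> f\<close> is this representative there.
\<close>

definition avg :: "(real^3) set \<Rightarrow> (real^3 \<Rightarrow> 'b::euclidean_space) \<Rightarrow> real^3 \<Rightarrow> real \<Rightarrow> 'b" where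
  "avg \<Omega> f x r = (LINT y|lebesgue. indicator (ball x r \<inter> \<Omega>) y *\<^sub>R f y) /\<^sub>R measure lebesgue (ball x r \<inter> \<Omega>)"

definition precise_rep :: "(real^3) set \<Rightarrow> (real^3 \<Rightarrow> 'b::euclidean_space) \<Rightarrow> real^3 \<Rightarrow> 'b" where
  "precise_rep \<Omega> f x =
     (if \<exists>l. (avg \<Omega> f x \<longlongrightarrow> l) (at_right 0) then Lim (at_right 0) (avg \<Omega> f x) else 0)"

text \<open>
  Null sets of the two-dimensional Hausdorff measure. No bound on the diameters of the covering
  sets is needed: if the sum of their squares is below $e$, each of them is below $\sqrt e$.
\<close>

definition H2_null :: "(real^3) set \<Rightarrow> bool" where
  "H2_null N \<longleftrightarrow> (\<forall>e>0. \<exists>C :: nat \<Rightarrow> (real^3) set. N \<subseteq> (\<Union>n. C n) \<and> (\<forall>n. bounded (C n)) \<and>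
     summable (\<lambda>n. (diameter (C n))\<^sup>2) \<and> (\<Sum>n. (diameter (C n))\<^sup>2) < e)"

text \<open>$F\times\nu=0$ on $\partial\Omega$ in the sense of traces.\<close>

definition tangential_trace_zero ::
  "(real^3) set \<Rightarrow> (real^3 \<Rightarrow> real^3) \<Rightarrow> (real^3 \<Rightarrow> real^3) \<Rightarrow> bool" where
  "tangential_trace_zero \<Omega> \<nu> F \<longleftrightarrow>
     (\<exists>N. H2_null N \<and> (\<forall>p\<in>frontier \<Omega> - N. \<exists>v. (avg \<Omega> F p \<longlongrightarrow> v) (at_right 0) \<and> cross3 v (\<nu> p) = 0))"

definition E_energy :: "(real^3) set \<Rightarrow> (real^3 \<Rightarrow> real) \<Rightarrow> real \<Rightarrow> (real^3 \<Rightarrow> real) \<Rightarrow> ennreal" where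
  "E_energy \<Omega> a \<epsilon> u =
     (\<integral>\<^sup>+x\<in>\<Omega>. ennreal (1/2 * ((norm (wgrad \<Omega> u x))\<^sup>2 + 1 / (2 * \<epsilon>\<^sup>2) * (a x - \<bar>u x\<bar>\<^sup>2)\<^sup>2)) \<partial>lebesgue)"

definition positive_minimizer ::
  "(real^3) set \<Rightarrow> (real^3 \<Rightarrow> real) \<Rightarrow> real \<Rightarrow> (real^3 \<Rightarrow> real) \<Rightarrow> bool" where
  "positive_minimizer \<Omega> a \<epsilon> \<rho> \<longleftrightarrow> H1 \<Omega> \<rho> \<and> (AE x in lebesgue. x \<in> \<Omega> \<longrightarrow> \<rho> x > 0) \<and>
     (\<forall>u. H1 \<Omega> u \<longrightarrow> E_energy \<Omega> a \<epsilon> \<rho> \<le> E_energy \<Omega> a \<epsilon> u)"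

text \<open>
  Zero-average weak solution of $\mathrm{div}(\rho^2(A-\nabla\phi))=0$ in $\Omega$ with
  $\rho^2(A-\nabla\phi)\cdot\nu=0$ on $\partial\Omega$; testing against all of $H^1(\Omega)$ encodes both the
  equation and the natural boundary condition.
\<close>

definition neumann_solution ::
  "(real^3) set \<Rightarrow> (real^3 \<Rightarrow> real) \<Rightarrow> (real^3 \<Rightarrow> real^3) \<Rightarrow> (real^3 \<Rightarrow> real) \<Rightarrow> bool" where
  "neumann_solution \<Omega> \<rho> A \<phi> \<longleftrightarrow> H1 \<Omega> \<phi> \<and> (LINT x:\<Omega>|lebesgue. \<phi> x) = 0 \<and>
     (\<forall>\<psi>. H1 \<Omega> \<psi> \<longrightarrow>
        (LINT x:\<Omega>|lebesgue. ((\<rho> x)\<^sup>2 *\<^sub>R (A x - wgrad \<Omega> \<phi> x)) \<bullet> wgrad \<Omega> \<psi> x) = 0)"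

definition admissible :: "(real^3 \<Rightarrow> real^3) \<Rightarrow> (real^3 \<Rightarrow> real^3) set" where
  "admissible Aex = {A. (\<lambda>x. A x - Aex x) \<in> dotH1_sigma}"

text \<open>Here \<open>\<Phi> A\<close> is the potential $\phi_{A,\rho^2}$.\<close>

definition J_energy :: "(real^3) set \<Rightarrow> (real^3 \<Rightarrow> real) \<Rightarrow> ((real^3 \<Rightarrow> real^3) \<Rightarrow> real^3 \<Rightarrow> real) \<Rightarrow>
    (real^3 \<Rightarrow> real^3) \<Rightarrow> (real^3 \<Rightarrow> real^3) \<Rightarrow> ennreal" where
  "J_energy \<Omega> \<rho> \<Phi> Aex A =
     (\<integral>\<^sup>+x\<in>\<Omega>. ennreal (1/2 * (\<rho> x)\<^sup>2 * (norm (A x - wgrad \<Omega> (\<Phi> A) x))\<^sup>2) \<partial>lebesgue) +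
     (\<integral>\<^sup>+x. ennreal (1/2 * (norm (wcurl UNIV (\<lambda>y. A y - Aex y) x))\<^sup>2) \<partial>lebesgue)"

definition J_minimizer :: "(real^3) set \<Rightarrow> (real^3 \<Rightarrow> real) \<Rightarrow> ((real^3 \<Rightarrow> real^3) \<Rightarrow> real^3 \<Rightarrow> real) \<Rightarrow>
    (real^3 \<Rightarrow> real^3) \<Rightarrow> (real^3 \<Rightarrow> real^3) \<Rightarrow> bool" where
  "J_minimizer \<Omega> \<rho> \<Phi> Aex A0 \<longleftrightarrow> A0 \<in> admissible Aex \<and>
     (\<forall>A\<in>admissible Aex. J_energy \<Omega> \<rho> \<Phi> Aex A0 \<le> J_energy \<Omega> \<rho> \<Phi> Aex A)"

definition B_field_of :: "(real^3) set \<Rightarrow> (real^3 \<Rightarrow> real^3) \<Rightarrow> (real^3 \<Rightarrow> real) \<Rightarrow> (real^3 \<Rightarrow> real^3) \<Rightarrow>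
    (real^3 \<Rightarrow> real) \<Rightarrow> (real^3 \<Rightarrow> real^3) \<Rightarrow> bool" where
  "B_field_of \<Omega> \<nu> \<rho> A \<phi> B \<longleftrightarrow> H1_field \<Omega> B \<and>
     weak_curl \<Omega> B (\<lambda>x. (\<rho> x)\<^sup>2 *\<^sub>R (A x - wgrad \<Omega> \<phi> x)) \<and>
     weak_div \<Omega> B (\<lambda>_. 0) \<and> tangential_trace_zero \<Omega> \<nu> B"

text \<open>
  A one-dimensional current acts on 1-forms, identified with vector fields; the comass of a
  1-form is the Euclidean norm. Zero-dimensional currents act on functions.
\<close>

type_synonym current1 = "(real^3 \<Rightarrow> real^3) \<Rightarrow> real"
type_synonym current0 = "(real^3 \<Rightarrow> real) \<Rightarrow> real"

definition mass :: "current1 \<Rightarrow> ereal" where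
  "mass T = (SUP \<omega>\<in>{\<omega>. test_field UNIV \<omega> \<and> (\<forall>x. norm (\<omega> x) \<le> 1)}. ereal (T \<omega>))"

definition mass0 :: "current0 \<Rightarrow> ereal" where
  "mass0 S = (SUP f\<in>{f. test_fun UNIV f \<and> (\<forall>x. \<bar>f x\<bar> \<le> 1)}. ereal (S f))"

definition boundary :: "current1 \<Rightarrow> current0" where
  "boundary T f = T (grad f)"

definition normal_current :: "current1 \<Rightarrow> bool" where
  "normal_current T \<longleftrightarrow> mass T < \<infinity> \<and> mass0 (boundary T) < \<infinity>"

definition supported_in :: "current1 \<Rightarrow> (real^3) set \<Rightarrow> bool" where
  "supported_in T S \<longleftrightarrow> (\<forall>\<omega>. test_field (- S) \<omega> \<longrightarrow> T \<omega> = 0)"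

definition supported_in0 :: "current0 \<Rightarrow> (real^3) set \<Rightarrow> bool" where
  "supported_in0 T S \<longleftrightarrow> (\<forall>f. test_fun (- S) f \<longrightarrow> T f = 0)"

definition weighted :: "(real^3 \<Rightarrow> real) \<Rightarrow> current1 \<Rightarrow> current1" where
  "weighted w T \<omega> = T (\<lambda>x. w x *\<^sub>R \<omega> x)"

definition curve_current :: "(real \<Rightarrow> real^3) \<Rightarrow> current1" where
  "curve_current \<gamma> \<omega> = (LINT t:{0..1}|lebesgue. \<omega> (\<gamma> t) \<bullet> vector_derivative \<gamma> (at t))"

text \<open>
  Elements of the class are represented by parametrisations on $[0,1]$; all quantities below
  depend on \<open>\<gamma>\<close> only through the oriented curve. \<open>simple_path\<close> allows both injective arcs and
  simple closed loops and excludes constant paths.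
\<close>

definition curves :: "(real^3) set \<Rightarrow> (real \<Rightarrow> real^3) set" where
  "curves \<Omega> = {\<gamma>. simple_path \<gamma> \<and> (\<exists>L. L-lipschitz_on {0..1} \<gamma>) \<and>
     normal_current (curve_current \<gamma>) \<and>
     supported_in (curve_current \<gamma>) (closure \<Omega>) \<and>
     supported_in0 (boundary (curve_current \<gamma>)) (frontier \<Omega>)}"

text \<open>
  Line integrals need pointwise values of \<open>B\<close> and \<open>\<rho>\<close> on curves, whence the precise representatives.
\<close>

definition isoflux_ratio ::
  "(real^3) set \<Rightarrow> (real^3 \<Rightarrow> real) \<Rightarrow> (real^3 \<Rightarrow> real^3) \<Rightarrow> ereal" where
  "isoflux_ratio \<Omega> \<rho> B = (SUP \<gamma>\<in>curves \<Omega>.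
     ereal (curve_current \<gamma> (precise_rep \<Omega> B)) /
     mass (weighted (\<lambda>x. (precise_rep \<Omega> \<rho> x)\<^sup>2) (curve_current \<gamma>)))"

end

theory Submission
  imports Defs
begin

text \<open>
  Write $j = \rho^2(A - \nabla\phi)$ and $V = A - A_{ex}$ for the minimizer $A$ of $J$. Comparing
  $A$ with $A_{ex} + (1-t)V$ and using the equation of $\phi$ gives
  $\int_\Omega \rho^2|A - \nabla\phi|^2 + \int |curl\,V|^2 \le \int_\Omega j \cdot A_{ex}$.
  Since $j = curl\,B$, circulations of $B$ along small squares are fluxes of $j$, so a small
  isoflux ratio makes the averages of $j$ over squares small. As $j$ is bounded in $L^2$ uniformly
  in $\varepsilon$, the right-hand side then becomes small. But $A - \nabla\phi$ has
  curl $H_{ex} + curl\,V$ in $\Omega$, so the left-hand side is bounded below when $H_{ex}$ does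
  not vanish in $\Omega$. The bounds $b \le \rho^2 \le 1$ come from comparing $\rho$ with a $C^1$
  function of itself.
\<close>

subsection \<open>Smooth functions and bumps\<close>

text \<open>The threshold for the isoflux ratio must not depend on \<epsilon>, which dictates the
  order of choices: a smooth approximation of \<open>Aex\<close>, after it the side h of the
  squares, and only at the end the threshold \<delta>. A square of side h has length of order h and
  area h^2, so a ratio below \<delta> bounds averages of j only by a multiple of \<delta> / h; this
  is harmless because h is already fixed. The approximation error is paired with j, whose L2 norm is
  at most that of \<open>Aex\<close> by the energy inequality and Young's inequality. The field B is
  merely H1, so its values on one given curve are out of control. Almost every translate of a
  square, however, meets the exceptional null set only in a null set of parameters, and integrating
  circulations over all translates sees only almost every square. The supremum is one-sided;
  traversing squares in both senses yields the absolute value. The weight enters through \<rho>^2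
  \<le> 1, which bounds masses from above, and \<rho>^2 \<ge> b, which controls A - grad \<phi> by
  the weighted energy.\<close>

definition smooth :: "(real^3 \<Rightarrow> real) \<Rightarrow> bool" where
  "smooth f \<longleftrightarrow> (\<forall>k. Ck_on k UNIV f)"

text \<open>A coinductive principle: closure of \<open>S\<close> under \<open>partial\<close>
  replaces an induction on the order of differentiability in the smoothness proofs below.
  Differentiability of each member supplies the continuity that \<open>Ck_on 0\<close> asks
  for.\<close>

lemma smoothI:
  assumes "f \<in> S"
    and S: "\<And>g x. g \<in> S \<Longrightarrow> g differentiable (at x)" "\<And>g i. g \<in> S \<Longrightarrow> partial i g \<in> S"
  shows "smooth f"
proof -
  have "\<forall>g\<in>S. Ck_on k UNIV g" for k
  proof (induction k)
    case 0
    then show ?case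
      using S(1) by (auto intro: differentiable_imp_continuous_on simp: differentiable_on_def)
  next
    case (Suc k)
    then show ?case using S by auto
  qed
  then show ?thesis using assms(1) by (auto simp: smooth_def)
qed

lemma smooth_differentiable: "smooth f \<Longrightarrow> f differentiable (at x)"
  unfolding smooth_def by (drule spec[of _ "Suc 0"]) simp

lemma smooth_partial: "smooth f \<Longrightarrow> smooth (partial i f)"
  unfolding smooth_def by (metis Ck_on.simps(2))

lemma smooth_continuous: "smooth f \<Longrightarrow> continuous_on A f"
  unfolding smooth_def using Ck_on.simps(1) continuous_on_subset by (metis subset_UNIV)

lemma partial_eqI: "(f has_derivative f') (at x) \<Longrightarrow> partial i f x = f' (axis i 1)"
  unfolding partial_def by (metis frechet_derivative_at)

lemma has_derivative_grad:
  assumes "f differentiable (at x)"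
  shows "(f has_derivative (\<lambda>v. grad f x \<bullet> v)) (at x)"
proof -
  let ?D = "frechet_derivative f (at x)"
  have D: "(f has_derivative ?D) (at x)"
    using assms by (simp add: frechet_derivative_works)
  then have lin: "linear ?D" by (rule has_derivative_linear)
  have "?D v = grad f x \<bullet> v" for v
  proof -
    have "?D v = ?D (\<Sum>i\<in>UNIV. (v $ i) *\<^sub>R axis i 1)"
      using basis_expansion[of v] by (simp add: scalar_mult_eq_scaleR)
    also have "\<dots> = (\<Sum>i\<in>UNIV. (v $ i) * ?D (axis i 1))"
      by (simp add: linear_sum[OF lin] linear_scale[OF lin])
    also have "\<dots> = grad f x \<bullet> v"
      by (simp add: inner_vec_def grad_def partial_def mult.commute)
    finally show ?thesis .
  qed
  then have "?D = (\<lambda>v. grad f x \<bullet> v)" by auto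
  then show ?thesis using D by simp
qed

lemma grad_component: "grad f x $ i = partial i f x"
  by (simp add: grad_def)

lemma grad_axis: "grad f x \<bullet> axis i c = c * partial i f x"
  by (simp add: inner_axis grad_def mult.commute)

inductive_set alg :: "(real^3 \<Rightarrow> real) set \<Rightarrow> (real^3 \<Rightarrow> real) set" for S where
  base: "f \<in> S \<Longrightarrow> f \<in> alg S"
| const: "(\<lambda>x. c) \<in> alg S"
| add: "f \<in> alg S \<Longrightarrow> g \<in> alg S \<Longrightarrow> (\<lambda>x. f x + g x) \<in> alg S"
| mult: "f \<in> alg S \<Longrightarrow> g \<in> alg S \<Longrightarrow> (\<lambda>x. f x * g x) \<in> alg S"

lemma partial_add:
  assumes "f differentiable (at x)" "g differentiable (at x)"
  shows "partial i (\<lambda>x. f x + g x) x = partial i f x + partial i g x"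
  by (rule trans[OF partial_eqI[OF has_derivative_add[OF has_derivative_grad has_derivative_grad]]])
     (use assms in \<open>auto simp: grad_axis\<close>)

lemma partial_mult:
  assumes "f differentiable (at x)" "g differentiable (at x)"
  shows "partial i (\<lambda>x. f x * g x) x = f x * partial i g x + partial i f x * g x"
  by (rule trans[OF partial_eqI[OF has_derivative_mult[OF has_derivative_grad has_derivative_grad]]])
     (use assms in \<open>auto simp: grad_axis\<close>)

lemma partial_const [simp]: "partial i (\<lambda>x. c) = (\<lambda>x. 0)"
  by (rule ext, rule partial_eqI) (rule has_derivative_const)

lemma partial_cmult:
  assumes "f differentiable (at x)"
  shows "partial i (\<lambda>x. c * f x) x = c * partial i f x"
  using partial_mult[of "\<lambda>x. c" x f i] assms by simp

text \<open>The sum and product rules keep \<open>alg S\<close> closed under \<open>partial\<close>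
  as soon as the generators have their partial derivatives in \<open>alg S\<close>, so
  \<open>smoothI\<close> applies to \<open>alg S\<close> itself. The derivatives may leave
  \<open>S\<close>, which is what makes a single linear map or a family such as \<open>flat\<close>
  usable as generators.\<close>

lemma alg_smooth:
  assumes S: "\<And>g x. g \<in> S \<Longrightarrow> g differentiable (at x)" "\<And>g i. g \<in> S \<Longrightarrow> partial i g \<in> alg S"
    and "f \<in> alg S"
  shows "smooth f"
proof (rule smoothI[OF \<open>f \<in> alg S\<close>])
  show d: "g differentiable (at x)" if "g \<in> alg S" for g x
    using that by induction (auto intro: S)
  show "partial i g \<in> alg S" if "g \<in> alg S" for g i
    using that
  proof induction
    case (add f g)
    then have "partial i (\<lambda>x. f x + g x) = (\<lambda>x. partial i f x + partial i g x)"
      by (auto simp: partial_add d)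
    then show ?case using add by (auto intro: alg.add)
  next
    case (mult f g)
    then have "partial i (\<lambda>x. f x * g x) = (\<lambda>x. f x * partial i g x + partial i f x * g x)"
      by (auto simp: partial_mult d)
    then show ?case using mult by (auto intro: alg.add alg.mult)
  qed (auto intro: S alg.intros)
qed

lemma smooth_const: "smooth (\<lambda>x. c)"
  and smooth_add: "smooth f \<Longrightarrow> smooth g \<Longrightarrow> smooth (\<lambda>x. f x + g x)"
  and smooth_mult: "smooth f \<Longrightarrow> smooth g \<Longrightarrow> smooth (\<lambda>x. f x * g x)"
proof -
  have *: "smooth h" if "h \<in> alg {f. smooth f}" for h
    by (rule alg_smooth[OF _ _ that])
       (auto intro: smooth_differentiable alg.base smooth_partial)
  show "smooth (\<lambda>x. c)"
    by (rule *) (auto intro: alg.intros)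
  show "smooth (\<lambda>x. f x + g x)" if "smooth f" "smooth g"
    by (rule *) (use that in \<open>auto intro: alg.intros\<close>)
  show "smooth (\<lambda>x. f x * g x)" if "smooth f" "smooth g"
    by (rule *) (use that in \<open>auto intro: alg.intros\<close>)
qed

lemma smooth_cmult: "smooth f \<Longrightarrow> smooth (\<lambda>x. c * f x)"
  by (intro smooth_mult smooth_const)

lemma smooth_prod:
  assumes "\<And>i. i \<in> I \<Longrightarrow> smooth (f i)"
  shows "smooth (\<lambda>x. \<Prod>i\<in>I. f i x)"
  using assms by (induction I rule: infinite_finite_induct) (auto intro: smooth_const smooth_mult)

lemma smooth_linear:
  assumes "bounded_linear f"
  shows "smooth f"
proof (rule alg_smooth[of "{f}"])
  have der: "(f has_derivative f) (at x)" for x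
    using assms by (rule bounded_linear_imp_has_derivative)
  show "g differentiable (at x)" if "g \<in> {f}" for g x
    using that der by (auto simp: differentiable_def)
  have "partial i f = (\<lambda>x. f (axis i 1))" for i
    by (rule ext, rule partial_eqI[OF der])
  then show "partial i g \<in> alg {f}" if "g \<in> {f}" for g i
    using that by (auto intro: alg.const)
qed (auto intro: alg.base)

lemma smooth_real_polynomial_function:
  assumes "real_polynomial_function f"
  shows "smooth f"
  using assms by induction (auto intro: smooth_linear smooth_const smooth_add smooth_mult)

lemma smooth_translate:
  assumes "smooth f"
  shows "smooth (\<lambda>x. f (x - v))"
    and partial_translate: "partial i (\<lambda>x. f (x - v)) x = partial i f (x - v)"
proof -
  have der: "((\<lambda>x. f (x - v)) has_derivative (\<lambda>w. grad f (x - v) \<bullet> w)) (at x)" if "smooth f" for f x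
    by (rule has_derivative_compose[of "\<lambda>x. x - v" "\<lambda>w. w", simplified])
       (auto intro!: derivative_eq_intros has_derivative_grad smooth_differentiable that)
  have p: "partial i (\<lambda>x. f (x - v)) x = partial i f (x - v)" if "smooth f" for f x i
    using partial_eqI[OF der[OF that]] by (simp add: grad_axis)
  then show "partial i (\<lambda>x. f (x - v)) x = partial i f (x - v)" using assms .
  show "smooth (\<lambda>x. f (x - v))"
  proof (rule smoothI[of _ "{\<lambda>x. g (x - v) | g. smooth g}"])
    show "partial i g \<in> {\<lambda>x. g (x - v) |g. smooth g}"
      if "g \<in> {\<lambda>x. g (x - v) |g. smooth g}" for g i
    proof -
      from that obtain h where h: "smooth h" "g = (\<lambda>x. h (x - v))" by auto
      have "partial i g = (\<lambda>x. partial i h (x - v))"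
        unfolding h(2) using p[OF h(1)] by blast
      then show ?thesis using smooth_partial[OF h(1)] by auto
    qed
    show "g differentiable (at x)" if "g \<in> {\<lambda>x. g (x - v) |g. smooth g}" for g x
    proof -
      from that obtain h where h: "smooth h" "g = (\<lambda>x. h (x - v))" by auto
      show ?thesis unfolding h(2) differentiable_def using der[OF h(1)] by blast
    qed
  qed (use assms in auto)
qed

text \<open>The classical flat function exp (-1/t), divided by powers of t so that the family is
  closed under differentiation: the derivative of \<open>flat m\<close> combines
  \<open>flat (m + 2)\<close> and \<open>flat (m + 1)\<close>.\<close>

definition flat :: "nat \<Rightarrow> real \<Rightarrow> real" where
  "flat m t = (if t \<le> 0 then 0 else exp (- (1 / t)) / t ^ m)"

lemma flat_tendsto_0: "(flat m \<longlongrightarrow> 0) (at 0)"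
proof (rule filterlim_split_at)
  show "(flat m \<longlongrightarrow> 0) (at_left 0)"
    by (rule tendsto_eventually) (auto simp: flat_def eventually_at_filter)
  have "((\<lambda>t. inverse t ^ m / exp (inverse t)) \<longlongrightarrow> (0::real)) (at_right 0)"
    by (rule filterlim_compose[OF tendsto_power_div_exp_0 filterlim_inverse_at_top_right])
  then show "(flat m \<longlongrightarrow> 0) (at_right 0)"
    by (rule Lim_transform_eventually)
       (auto simp: eventually_at_filter flat_def exp_minus field_simps)
qed

lemma flat_has_derivative:
  "(flat m has_real_derivative (flat (m + 2) t - m * flat (m + 1) t)) (at t)"
proof -
  consider "t < 0" | "t = 0" | "t > 0" by linarith
  then show ?thesis
  proof cases
    case 1
    have "((\<lambda>t. 0) has_real_derivative 0) (at t)" by simp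
    then have "(flat m has_real_derivative 0) (at t)"
      by (rule has_field_derivative_transform_within_open[where S = "{..<0}"])
         (use 1 in \<open>auto simp: flat_def\<close>)
    then show ?thesis using 1 by (simp add: flat_def)
  next
    case 2
    \<comment> \<open>The difference quotient at 0 is again a member of the family, so its limit is
      already known.\<close>
    have "flat m h / h = flat (Suc m) h" for h
      by (simp add: flat_def field_simps)
    then have "(flat m has_real_derivative 0) (at 0)"
      using flat_tendsto_0[of "Suc m"] by (simp add: DERIV_def flat_def[of m 0])
    then show ?thesis using 2 by (simp add: flat_def)
  next
    case 3
    have e: "((\<lambda>t. exp (- (1 / t))) has_real_derivative (exp (- (1 / t)) / t ^ 2)) (at t)"
      by (rule derivative_eq_intros refl | use 3 in \<open>simp add: power2_eq_square\<close>)+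
    have p: "((\<lambda>t. t ^ m) has_real_derivative (m * t ^ (m - 1))) (at t)"
      using DERIV_pow[of m t] by simp
    have "((\<lambda>t. exp (- (1 / t)) / t ^ m) has_real_derivative
        (exp (- (1 / t)) / t ^ 2 * t ^ m - exp (- (1 / t)) * (m * t ^ (m - 1))) / (t ^ m * t ^ m)) (at t)"
      using DERIV_divide[OF e p] 3 by simp
    moreover have "(exp (- (1 / t)) / t ^ 2 * t ^ m - exp (- (1 / t)) * (m * t ^ (m - 1))) / (t ^ m * t ^ m)
        = flat (m + 2) t - m * flat (m + 1) t"
    proof (cases m)
      case (Suc k)
      then show ?thesis using 3 by (simp add: flat_def power2_eq_square diff_divide_distrib)
    qed (use 3 in \<open>simp add: flat_def power2_eq_square\<close>)
    ultimately have "((\<lambda>t. exp (- (1 / t)) / t ^ m) has_real_derivative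
        (flat (m + 2) t - m * flat (m + 1) t)) (at t)" by simp
    then show ?thesis
      by (rule has_field_derivative_transform_within_open[where S = "{0<..}"])
         (use 3 in \<open>auto simp: flat_def\<close>)
  qed
qed

lemma smooth_flat: "smooth (\<lambda>x. flat m (c * x $ i + d))"
proof (rule alg_smooth[of "range (\<lambda>m x. flat m (c * x $ i + d))"])
  have der: "((\<lambda>x. flat m (c * x $ i + d)) has_derivative
      (\<lambda>w. (c * w $ i) * (flat (m + 2) (c * x $ i + d) - m * flat (m + 1) (c * x $ i + d)))) (at x)" for m x
    by (rule has_derivative_compose[OF _ flat_has_derivative[unfolded has_field_derivative_def], THEN has_derivative_eq_rhs])
       (auto intro!: derivative_eq_intros bounded_linear_imp_has_derivative[OF bounded_linear_vec_nth] simp: ac_simps)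
  show "g differentiable (at x)" if "g \<in> range (\<lambda>m x. flat m (c * x $ i + d))" for g x
    using that der by (auto simp: differentiable_def)
  show "partial j g \<in> alg (range (\<lambda>m x. flat m (c * x $ i + d)))"
    if "g \<in> range (\<lambda>m x. flat m (c * x $ i + d))" for g j
  proof -
    from that obtain m where g: "g = (\<lambda>x. flat m (c * x $ i + d))" by auto
    have "partial j g = (\<lambda>x. (c * axis j 1 $ i) * (flat (m + 2) (c * x $ i + d) + (- real m) * flat (m + 1) (c * x $ i + d)))"
      unfolding g by (rule ext, subst partial_eqI[OF der]) simp
    then show ?thesis
      by (simp only:) (intro alg.intros rangeI)
  qed
qed (auto intro: alg.base)

text \<open>Sharpening by the factor n inside \<open>flat 0\<close> pushes each factor to 1 at
  interior points and leaves the product 0 outside, so these smooth functions converge boundedly to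
  the indicator of the open box.\<close>

definition box_bump :: "real^3 \<Rightarrow> real^3 \<Rightarrow> nat \<Rightarrow> real^3 \<Rightarrow> real" where
  "box_bump a b n x = (\<Prod>i\<in>UNIV. flat 0 (real n * (x $ i - a $ i)) * flat 0 (real n * (b $ i - x $ i)))"

lemma flat_0_bounds: "0 \<le> flat 0 t" "flat 0 t \<le> 1"
  by (auto simp: flat_def)

lemma box_bump_bounds: "0 \<le> box_bump a b n x" "box_bump a b n x \<le> 1"
  unfolding box_bump_def by (auto intro!: prod_nonneg prod_le_1 mult_nonneg_nonneg mult_le_one simp: flat_0_bounds)

lemma smooth_box_bump: "smooth (box_bump a b n)"
proof -
  have "smooth (\<lambda>x. flat 0 (real n * (x $ i - a $ i)))" for i
    using smooth_flat[of 0 "real n" i "- real n * a $ i"] by (simp add: algebra_simps)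
  moreover have "smooth (\<lambda>x. flat 0 (real n * (b $ i - x $ i)))" for i
    using smooth_flat[of 0 "- real n" i "real n * b $ i"] by (simp add: algebra_simps)
  ultimately have "smooth (\<lambda>x. \<Prod>i\<in>UNIV. flat 0 (real n * (x $ i - a $ i)) * flat 0 (real n * (b $ i - x $ i)))"
    by (intro smooth_prod smooth_mult)
  then show ?thesis
    unfolding box_bump_def[abs_def] .
qed

lemma box_bump_outside:
  assumes "x \<notin> box a b"
  shows "box_bump a b n x = 0"
proof -
  from assms obtain i where "\<not> (a $ i < x $ i \<and> x $ i < b $ i)"
    by (auto simp: mem_box_cart)
  then have "flat 0 (real n * (x $ i - a $ i)) * flat 0 (real n * (b $ i - x $ i)) = 0"
    by (auto simp: flat_def mult_le_0_iff)
  then show ?thesis unfolding box_bump_def by (subst prod_zero_iff) auto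
qed

lemma box_bump_tendsto: "(\<lambda>n. box_bump a b n x) \<longlonglongrightarrow> indicator (box a b) x"
proof (cases "x \<in> box a b")
  case True
  have fl: "(\<lambda>n. flat 0 (real n * t)) \<longlonglongrightarrow> 1" if "t > 0" for t :: real
  proof -
    have "(\<lambda>n. exp (- (inverse (real n) / t))) \<longlonglongrightarrow> exp (- (0 / t))"
      by (intro tendsto_intros lim_inverse_n) (use that in simp)
    then have "(\<lambda>n. exp (- (inverse (real n) / t))) \<longlonglongrightarrow> 1" by simp
    then show ?thesis
      by (rule Lim_transform_eventually)
         (use that in \<open>auto simp: eventually_sequentially flat_def field_simps mult_le_0_iff intro!: exI[of _ 1]\<close>)
  qed
  have "(\<lambda>n. box_bump a b n x) \<longlonglongrightarrow> (\<Prod>i\<in>(UNIV::3 set). 1 * 1)"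
    unfolding box_bump_def
    by (intro tendsto_prod tendsto_mult fl) (use True in \<open>auto simp: mem_box_cart\<close>)
  then show ?thesis using True by simp
next
  case False
  then show ?thesis by (simp add: box_bump_outside)
qed

section \<open>Test functions and their closure properties\<close>

lemma test_fun_iff: "test_fun U f \<longleftrightarrow> smooth f \<and> (\<exists>K. compact K \<and> K \<subseteq> U \<and> (\<forall>x. x \<notin> K \<longrightarrow> f x = 0))"
  by (simp add: test_fun_def smooth_def)

lemma test_fun_smooth: "test_fun U f \<Longrightarrow> smooth f"
  by (simp add: test_fun_iff)

lemma test_fun_box_bump:
  assumes "cbox a b \<subseteq> U"
  shows "test_fun U (box_bump a b n)"
  unfolding test_fun_iff using assms box_subset_cbox[of a b]
  by (auto intro!: smooth_box_bump exI[of _ "cbox a b"] box_bump_outside)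

lemma test_fun_mono: "test_fun U f \<Longrightarrow> U \<subseteq> V \<Longrightarrow> test_fun V f"
  unfolding test_fun_def by blast

lemma test_fun_mult: "test_fun U f \<Longrightarrow> smooth g \<Longrightarrow> test_fun U (\<lambda>x. f x * g x)"
  unfolding test_fun_iff by (auto intro: smooth_mult)

lemma test_fun_cmult: "test_fun U f \<Longrightarrow> test_fun U (\<lambda>x. c * f x)"
  using test_fun_mult[of U f "\<lambda>x. c"] by (simp add: smooth_const mult.commute)

lemma test_fun_0: "test_fun U (\<lambda>x. 0)"
  unfolding test_fun_iff by (auto intro!: smooth_const exI[of _ "{}"])

lemma test_fun_add:
  assumes "test_fun U f" "test_fun U g"
  shows "test_fun U (\<lambda>x. f x + g x)"
proof -
  obtain K L where "compact K" "K \<subseteq> U" "\<forall>x. x \<notin> K \<longrightarrow> f x = 0"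
    "compact L" "L \<subseteq> U" "\<forall>x. x \<notin> L \<longrightarrow> g x = 0"
    using assms unfolding test_fun_iff by auto
  then show ?thesis
    using assms unfolding test_fun_iff
    by (auto intro!: smooth_add exI[of _ "K \<union> L"])
qed

lemma test_fun_diff:
  assumes "test_fun U f" "test_fun U g"
  shows "test_fun U (\<lambda>x. f x - g x)"
  using test_fun_add[OF assms(1) test_fun_cmult[OF assms(2), of "-1"]] by simp

lemma partial_outside:
  assumes "closed K" "\<And>x. x \<notin> K \<Longrightarrow> f x = 0" "x \<notin> K"
  shows "partial i f x = 0"
proof -
  have "((\<lambda>x. 0::real) has_derivative (\<lambda>v. 0)) (at x)" by simp
  then have "(f has_derivative (\<lambda>v. 0)) (at x)"
    by (rule has_derivative_transform_within_open[where s = "- K"]) (use assms in auto)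
  from partial_eqI[OF this] show ?thesis .
qed

lemma test_fun_partial:
  assumes "test_fun U f"
  shows "test_fun U (partial i f)"
  using assms partial_outside[of _ f _ i] unfolding test_fun_iff
  by (metis compact_imp_closed smooth_partial)

subsection \<open>Sliding averages of test functions\<close>

text \<open>Convolution with Lebesgue measure on the segment from 0 to h in direction i. Its
  derivative in direction i is a plain difference (\<open>slide_partial\<close>), and two slides in
  directions i and j integrate over a square; symmetry of second derivatives, the chain rule and the
  flux estimate all rest on this.\<close>

definition slide :: "3 \<Rightarrow> real \<Rightarrow> (real^3 \<Rightarrow> real) \<Rightarrow> real^3 \<Rightarrow> real" where
  "slide i h f x = integral {0..h} (\<lambda>s. f (x - s *\<^sub>R axis i 1))"

lemma slide_integrable:
  fixes f :: "real^3 \<Rightarrow> real"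
  assumes "continuous_on UNIV f"
  shows "(\<lambda>s. f (x - s *\<^sub>R axis i 1)) integrable_on {0..h}"
  by (rule integrable_continuous_real, rule continuous_on_compose2[OF assms])
     (auto intro!: continuous_intros)

lemma slide_has_derivative:
  assumes f: "smooth f"
  shows "(slide i h f has_derivative (\<lambda>v. (\<chi> k. slide i h (partial k f) x) \<bullet> v)) (at x)"
proof -
  let ?F = "\<lambda>x s. blinfun_inner_right (grad f (x - s *\<^sub>R axis i 1))"
  have cg: "continuous_on UNIV (grad f)"
    unfolding grad_def[abs_def]
    by (intro continuous_on_vec_lambda smooth_continuous smooth_partial f)
  have "((\<lambda>x. integral (cbox 0 h) (\<lambda>s. f (x - s *\<^sub>R axis i 1))) has_derivative
      integral (cbox 0 h) (\<lambda>s. ?F x s)) (at x within UNIV)"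
  proof (rule leibniz_rule)
    show "((\<lambda>x. f (x - t *\<^sub>R axis i 1)) has_derivative ?F x t) (at x within UNIV)" for x t
      by (rule has_derivative_compose[of "\<lambda>x. x - t *\<^sub>R axis i 1" "\<lambda>w. w", simplified])
       (auto intro!: derivative_eq_intros has_derivative_grad smooth_differentiable f)
    show "(\<lambda>s. f (x - s *\<^sub>R axis i 1)) integrable_on cbox 0 h" for x
      using slide_integrable[OF smooth_continuous[OF f]] by simp
    show "continuous_on (UNIV \<times> cbox 0 h) (\<lambda>(x, t). ?F x t)"
      unfolding case_prod_unfold
      by (rule bounded_linear.continuous_on[OF bounded_linear_blinfun_inner_right],
          rule continuous_on_compose2[OF cg]) (auto intro!: continuous_intros)
  qed auto
  moreover have "blinfun_apply (integral (cbox 0 h) (\<lambda>s. ?F x s)) = (\<lambda>v. (\<chi> k. slide i h (partial k f) x) \<bullet> v)"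
  proof
    fix v
    have "(\<lambda>s. ?F x s) integrable_on cbox 0 h"
      by (rule integrable_continuous, rule bounded_linear.continuous_on[OF bounded_linear_blinfun_inner_right],
          rule continuous_on_compose2[OF cg]) (auto intro!: continuous_intros)
    then have "integral (cbox 0 h) (\<lambda>s. ?F x s) v = integral (cbox 0 h) (\<lambda>s. ?F x s v)"
      by (rule blinfun_apply_integral)
    also have "\<dots> = integral (cbox 0 h) (\<lambda>s. \<Sum>k\<in>UNIV. partial k f (x - s *\<^sub>R axis i 1) * v $ k)"
      by (simp add: inner_vec_def grad_def)
    also have "\<dots> = (\<Sum>k\<in>UNIV. integral (cbox 0 h) (\<lambda>s. partial k f (x - s *\<^sub>R axis i 1) * v $ k))"
      by (rule integral_sum)
        (use slide_integrable[OF smooth_continuous[OF smooth_partial[OF f]]] in \<open>auto intro: integrable_on_mult_left\<close>)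
    also have "\<dots> = (\<chi> k. slide i h (partial k f) x) \<bullet> v"
      by (simp add: inner_vec_def slide_def)
    finally show "integral (cbox 0 h) (\<lambda>s. ?F x s) v = (\<chi> k. slide i h (partial k f) x) \<bullet> v" .
  qed
  ultimately show ?thesis by (simp add: slide_def[abs_def])
qed

lemma partial_slide: "smooth f \<Longrightarrow> partial k (slide i h f) = slide i h (partial k f)"
  by (rule ext) (simp add: partial_eqI[OF slide_has_derivative] inner_axis)

lemma smooth_slide:
  assumes "smooth f"
  shows "smooth (slide i h f)"
proof (rule smoothI[of _ "slide i h ` Collect smooth"])
  show "g differentiable (at x)" if "g \<in> slide i h ` Collect smooth" for g x
    using that slide_has_derivative unfolding differentiable_def by blast
  show "partial k g \<in> slide i h ` Collect smooth" if "g \<in> slide i h ` Collect smooth" for g k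
    using that by (auto simp: partial_slide smooth_partial)
qed (use assms in auto)

lemma slide_partial:
  assumes f: "smooth f" and "0 \<le> h"
  shows "slide i h (partial i f) x = f x - f (x - h *\<^sub>R axis i 1)"
proof -
  have "((\<lambda>s. - partial i f (x - s *\<^sub>R axis i 1)) has_integral
      (f (x - h *\<^sub>R axis i 1) - f (x - 0 *\<^sub>R axis i 1))) {0..h}"
  proof (rule fundamental_theorem_of_calculus[OF \<open>0 \<le> h\<close>])
    fix s assume "s \<in> {0..h}"
    have "((\<lambda>s. x - s *\<^sub>R axis i 1) has_derivative (\<lambda>d. - (d *\<^sub>R axis i 1))) (at s)"
      by (auto intro!: derivative_eq_intros)
    from has_derivative_compose[OF this has_derivative_grad[OF smooth_differentiable[OF f]]]
    have "((\<lambda>s. f (x - s *\<^sub>R axis i 1)) has_derivative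
        (\<lambda>d. grad f (x - s *\<^sub>R axis i 1) \<bullet> (- (d *\<^sub>R axis i 1)))) (at s)" .
    moreover have "grad f (x - s *\<^sub>R axis i 1) \<bullet> (- (d *\<^sub>R axis i 1)) = d * (- partial i f (x - s *\<^sub>R axis i 1))" for d
      by (simp add: grad_axis[of _ _ _ 1, simplified])
    ultimately have "((\<lambda>s. f (x - s *\<^sub>R axis i 1)) has_vector_derivative - partial i f (x - s *\<^sub>R axis i 1)) (at s)"
      unfolding has_vector_derivative_def real_scaleR_def by (simp only:)
    then show "((\<lambda>s. f (x - s *\<^sub>R axis i 1)) has_vector_derivative - partial i f (x - s *\<^sub>R axis i 1)) (at s within {0..h})"
      by (rule has_vector_derivative_at_within)
  qed
  then have "integral {0..h} (\<lambda>s. - partial i f (x - s *\<^sub>R axis i 1)) = f (x - h *\<^sub>R axis i 1) - f x"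
    using integral_unique[where f = "\<lambda>s. - partial i f (x - s *\<^sub>R axis i 1)"] by auto
  then show ?thesis by (simp add: slide_def)
qed

text \<open>The support is swept along the segment. The compact set \<open>K\<close> is given
  explicitly so that only its sweep, and not that of all of \<open>U\<close>, has to stay in
  \<open>V\<close>.\<close>

lemma test_fun_slide:
  assumes f: "test_fun U f" and K: "compact K" "\<And>x. x \<notin> K \<Longrightarrow> f x = 0"
    and sub: "\<And>x s. x \<in> K \<Longrightarrow> 0 \<le> s \<Longrightarrow> s \<le> h \<Longrightarrow> x + s *\<^sub>R axis i 1 \<in> V"
  shows "test_fun V (slide i h f)"
proof -
  let ?K = "(\<lambda>(x, s). x + s *\<^sub>R axis i 1) ` (K \<times> {0..h})"
  have "compact ?K"
    by (intro compact_continuous_image compact_Times K compact_Icc)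
       (auto simp: case_prod_unfold intro!: continuous_intros)
  moreover have "?K \<subseteq> V" using sub by auto
  moreover have "slide i h f x = 0" if x: "x \<notin> ?K" for x
  proof -
    have "f (x - s *\<^sub>R axis i 1) = 0" if "s \<in> {0..h}" for s
    proof (rule K(2))
      show "x - s *\<^sub>R axis i 1 \<notin> K"
        using x that by (force simp: image_iff)
    qed
    then have "integral {0..h} (\<lambda>s. f (x - s *\<^sub>R axis i 1)) = integral {0..h} (\<lambda>s. 0)"
      by (intro integral_cong) auto
    then show ?thesis by (simp add: slide_def)
  qed
  ultimately show ?thesis
    unfolding test_fun_iff using smooth_slide[OF test_fun_smooth[OF f]] by blast
qed

text \<open>\<open>Ck_on\<close> speaks of iterated partial derivatives without any symmetry. The
  increment of f over h in direction j is \<open>slide j h (partial j f)\<close>. Differentiating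
  this identity by i and afterwards by j shows that both mixed derivatives have the same increments,
  so their difference is invariant under translation in direction j. Having compact support, it
  vanishes.\<close>

lemma partial_commute:
  assumes f: "test_fun U f"
  shows "partial i (partial j f) = partial j (partial i f)"
proof
  fix x
  have sm: "smooth f" using f by (rule test_fun_smooth)
  let ?g = "\<lambda>x. partial i (partial j f) x - partial j (partial i f) x"
  have tr: "?g x = ?g (x - h *\<^sub>R axis j 1)" if "0 \<le> h" for h
  proof -
    let ?t = "\<lambda>g x. g (x - h *\<^sub>R axis j 1)"
    have pd: "partial k (\<lambda>x. g x - ?t g x) = (\<lambda>x. partial k g x - ?t (partial k g) x)" if "smooth g" for g k
    proof
      fix x
      show "partial k (\<lambda>x. g x - ?t g x) x = partial k g x - ?t (partial k g) x"
        using partial_add[of g x "\<lambda>x. (-1) * ?t g x" k] that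
          partial_cmult[of "?t g" x k "-1"] partial_translate[OF that, of k "h *\<^sub>R axis j 1" x]
        by (simp add: smooth_differentiable smooth_cmult smooth_translate)
    qed
    have "(\<lambda>x. f x - ?t f x) = slide j h (partial j f)"
      using slide_partial[OF sm that] by auto
    then have "(\<lambda>x. partial i f x - ?t (partial i f) x) = slide j h (partial i (partial j f))"
      using pd[OF sm, of i] partial_slide[OF smooth_partial[OF sm, of j], of i j h] by simp
    then have "(\<lambda>x. partial j (partial i f) x - ?t (partial j (partial i f)) x)
        = slide j h (partial j (partial i (partial j f)))"
      using pd[OF smooth_partial[OF sm, of i], of j]
        partial_slide[OF smooth_partial[OF smooth_partial[OF sm]], of j j h i j] by simp
    also have "\<dots> = (\<lambda>x. partial i (partial j f) x - ?t (partial i (partial j f)) x)"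
      using slide_partial[OF smooth_partial[OF smooth_partial[OF sm]] that] by auto
    finally have "partial j (partial i f) x - ?t (partial j (partial i f)) x
        = partial i (partial j f) x - ?t (partial i (partial j f)) x"
      by (rule fun_cong)
    then show ?thesis by linarith
  qed
  have "test_fun U (partial i (partial j f))" "test_fun U (partial j (partial i f))"
    using f by (auto intro: test_fun_partial)
  then have "test_fun U ?g" by (rule test_fun_diff)
  then obtain K where K: "compact K" "\<And>x. x \<notin> K \<Longrightarrow> ?g x = 0"
    unfolding test_fun_iff by blast
  then obtain B where B: "B > 0" "\<And>y. y \<in> K \<Longrightarrow> norm y \<le> B"
    using compact_imp_bounded[OF K(1)] unfolding bounded_pos by auto
  \<comment> \<open>A translation this long carries x out of the support.\<close>
  define h where "h = norm x + B + 1"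
  have "norm (x - h *\<^sub>R axis j 1) > B"
    using norm_triangle_ineq2[of "h *\<^sub>R axis j (1::real)" x] B(1)
    by (simp add: h_def norm_minus_commute)
  then have "x - h *\<^sub>R axis j 1 \<notin> K" using B(2)[of "x - h *\<^sub>R axis j 1"] by linarith
  then have "?g (x - h *\<^sub>R axis j 1) = 0" by (rule K(2))
  moreover have "0 \<le> h" using B(1) by (simp add: h_def)
  ultimately have "?g x = 0" using tr by simp
  then show "partial i (partial j f) x = partial j (partial i f) x" by simp
qed

section \<open>The curl of a test field\<close>

lemma test_field_test_fun: "test_field U F \<Longrightarrow> test_fun U (\<lambda>x. F x $ i)"
  by (simp add: test_field_def)

lemma curl_op_nth:
  "curl_op F x $ 1 = partial 2 (\<lambda>y. F y $ 3) x - partial 3 (\<lambda>y. F y $ 2) x"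
  "curl_op F x $ 2 = partial 3 (\<lambda>y. F y $ 1) x - partial 1 (\<lambda>y. F y $ 3) x"
  "curl_op F x $ 3 = partial 1 (\<lambda>y. F y $ 2) x - partial 2 (\<lambda>y. F y $ 1) x"
  by (simp_all add: curl_op_def)

lemma test_field_curl_op:
  assumes "test_field U F"
  shows "test_field U (curl_op F)"
proof -
  have "test_fun U (\<lambda>x. curl_op F x $ i)" for i
    using exhaust_3[of i] assms
    by (elim disjE; simp only: curl_op_nth; intro test_fun_diff test_fun_partial test_field_test_fun)
  then show ?thesis by (simp add: test_field_def)
qed

lemma div_curl_op:
  assumes "test_field U F"
  shows "(\<Sum>i\<in>UNIV. partial i (\<lambda>y. curl_op F y $ i) x) = 0"
proof -
  have d: "partial i (\<lambda>y. g y - h y) x = partial i g x - partial i h x"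
    if "test_fun U g" "test_fun U h" for g h i
    using partial_add[of g x "\<lambda>x. (-1) * h x" i] partial_cmult[of h x i "-1"] that
      test_fun_cmult[OF that(2), of "-1"]
    by (simp add: smooth_differentiable test_fun_smooth)
  note t = test_field_test_fun[OF assms]
  show ?thesis
    using partial_commute[OF t[of 3], of 1 2] partial_commute[OF t[of 2], of 1 3] partial_commute[OF t[of 1], of 2 3]
    by (simp add: sum_3 curl_op_nth d test_fun_partial t)
qed

subsection \<open>Square integrable functions and the fundamental lemma\<close>

text \<open>Formulated for a measure instead of a set, so that \<open>lebesgue_on U\<close> and all
  of space share the same lemmas; \<open>Lp_on_2_iff\<close> links it to
  \<open>Lp_on 2\<close>.\<close>

definition L2 :: "'a measure \<Rightarrow> ('a \<Rightarrow> 'b::euclidean_space) \<Rightarrow> bool" where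
  "L2 M f \<longleftrightarrow> f \<in> borel_measurable M \<and> integrable M (\<lambda>x. (norm (f x))\<^sup>2)"

lemma L2_measurable [measurable_dest]: "L2 M f \<Longrightarrow> f \<in> borel_measurable M"
  by (simp add: L2_def)

lemma L2_integrable: "L2 M f \<Longrightarrow> integrable M (\<lambda>x. (norm (f x))\<^sup>2)"
  by (simp add: L2_def)

lemma L2_bound:
  assumes f: "L2 M f" and g [measurable]: "g \<in> borel_measurable M"
    and le: "AE x in M. norm (g x) \<le> c * norm (f x)"
  shows "L2 M g"
proof -
  have "integrable M (\<lambda>x. (norm (g x))\<^sup>2)"
  proof (rule Bochner_Integration.integrable_bound)
    show "integrable M (\<lambda>x. c\<^sup>2 * (norm (f x))\<^sup>2)"
      using L2_integrable[OF f] by simp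
    show "AE x in M. norm ((norm (g x))\<^sup>2) \<le> norm (c\<^sup>2 * (norm (f x))\<^sup>2)"
      using le by eventually_elim (auto simp: power_mult_distrib[symmetric] intro!: power_mono)
  qed simp
  then show ?thesis by (simp add: L2_def)
qed

lemma L2_inner_integrable:
  assumes f: "L2 M f" and g: "L2 M g"
  shows "integrable M (\<lambda>x. f x \<bullet> g x)"
proof (rule Bochner_Integration.integrable_bound)
  note [measurable] = L2_measurable[OF f] L2_measurable[OF g]
  show "integrable M (\<lambda>x. (norm (f x))\<^sup>2 + (norm (g x))\<^sup>2)"
    using f g by (auto dest: L2_integrable)
  show "(\<lambda>x. f x \<bullet> g x) \<in> borel_measurable M" by measurable
  have "\<bar>f x \<bullet> g x\<bar> \<le> (norm (f x))\<^sup>2 + (norm (g x))\<^sup>2" for x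
  proof -
    have "\<bar>f x \<bullet> g x\<bar> \<le> norm (f x) * norm (g x)" by (rule Cauchy_Schwarz_ineq2)
    also have "2 * (norm (f x) * norm (g x)) \<le> (norm (f x))\<^sup>2 + (norm (g x))\<^sup>2"
      using sum_squares_bound[of "norm (f x)" "norm (g x)"] by (simp add: mult.assoc)
    finally show ?thesis
      by (smt (verit, best) mult_nonneg_nonneg norm_ge_zero)
  qed
  then show "AE x in M. norm (f x \<bullet> g x) \<le> norm ((norm (f x))\<^sup>2 + (norm (g x))\<^sup>2)"
    by (auto intro!: AE_I2)
qed

lemma L2_mult_integrable:
  fixes f g :: "'a \<Rightarrow> real"
  shows "L2 M f \<Longrightarrow> L2 M g \<Longrightarrow> integrable M (\<lambda>x. f x * g x)"
  using L2_inner_integrable[of M f g] by (simp add: inner_real_def)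

text \<open>The weighted Young inequality stands in for Cauchy-Schwarz: integrals of squares appear
  without roots, and the free parameter c is chosen later to balance the two terms.\<close>

lemma L2_young:
  assumes f: "L2 M f" and g: "L2 M g" and c: "0 < c"
  shows "\<bar>\<integral>x. f x \<bullet> g x \<partial>M\<bar> \<le> c / 2 * (\<integral>x. (norm (f x))\<^sup>2 \<partial>M) + 1 / (2 * c) * (\<integral>x. (norm (g x))\<^sup>2 \<partial>M)"
proof -
  have "\<bar>f x \<bullet> g x\<bar> \<le> c / 2 * (norm (f x))\<^sup>2 + 1 / (2 * c) * (norm (g x))\<^sup>2" for x
  proof -
    have "\<bar>f x \<bullet> g x\<bar> \<le> norm (f x) * norm (g x)" by (rule Cauchy_Schwarz_ineq2)
    moreover have "0 \<le> (c * norm (f x) - norm (g x))\<^sup>2 / (2 * c)" using c by simp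
    moreover have "(c * norm (f x) - norm (g x))\<^sup>2 / (2 * c)
        = c / 2 * (norm (f x))\<^sup>2 + 1 / (2 * c) * (norm (g x))\<^sup>2 - norm (f x) * norm (g x)"
      using c by (simp add: field_simps power2_eq_square)
    ultimately show ?thesis by linarith
  qed
  then have "(\<integral>x. \<bar>f x \<bullet> g x\<bar> \<partial>M) \<le> (\<integral>x. c / 2 * (norm (f x))\<^sup>2 + 1 / (2 * c) * (norm (g x))\<^sup>2 \<partial>M)"
    using L2_inner_integrable[OF f g] L2_integrable[OF f] L2_integrable[OF g]
    by (intro integral_mono) auto
  also have "\<dots> = c / 2 * (\<integral>x. (norm (f x))\<^sup>2 \<partial>M) + 1 / (2 * c) * (\<integral>x. (norm (g x))\<^sup>2 \<partial>M)"
    using L2_integrable[OF f] L2_integrable[OF g] by simp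
  finally show ?thesis
    using integral_abs_bound[of M "\<lambda>x. f x \<bullet> g x"] by linarith
qed

lemma L2_scaleR:
  assumes "L2 M f"
  shows "L2 M (\<lambda>x. c *\<^sub>R f x)"
  using L2_measurable[OF assms] by (intro L2_bound[OF assms, of _ "\<bar>c\<bar>"]) auto

lemma L2_add:
  assumes f: "L2 M f" and g: "L2 M g"
  shows "L2 M (\<lambda>x. f x + g x)"
proof -
  note [measurable] = L2_measurable[OF f] L2_measurable[OF g]
  have "(norm (f x + g x))\<^sup>2 = (norm (f x))\<^sup>2 + (norm (g x))\<^sup>2 + 2 * (f x \<bullet> g x)" for x
    by (simp add: power2_norm_eq_inner inner_add inner_commute)
  then show ?thesis
    using L2_integrable[OF f] L2_integrable[OF g] L2_inner_integrable[OF f g]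
    by (simp add: L2_def)
qed

lemma L2_diff: "L2 M f \<Longrightarrow> L2 M g \<Longrightarrow> L2 M (\<lambda>x. f x - g x)"
  using L2_add[of M f "\<lambda>x. (-1) *\<^sub>R g x"] L2_scaleR[of M g "-1"] by simp

lemma borel_measurable_vec_nth [measurable]:
  fixes f :: "'a \<Rightarrow> real^3"
  assumes [measurable]: "f \<in> borel_measurable M"
  shows "(\<lambda>x. f x $ i) \<in> borel_measurable M"
  unfolding cart_eq_inner_axis by measurable

lemma L2_nth:
  fixes f :: "'a \<Rightarrow> real^3"
  assumes f: "L2 M f"
  shows "L2 M (\<lambda>x. f x $ i)"
proof -
  note [measurable] = L2_measurable[OF f]
  show ?thesis
    by (rule L2_bound[OF f, of _ 1])
       (auto simp: component_le_norm_cart)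
qed

lemma borel_measurable_vec_iff:
  fixes f :: "'a \<Rightarrow> real^3"
  shows "f \<in> borel_measurable M \<longleftrightarrow> (\<forall>i. (\<lambda>x. f x $ i) \<in> borel_measurable M)"
  by (subst borel_measurable_euclidean_space) (auto simp: Basis_vec_def inner_axis)

lemma L2_vec:
  fixes f :: "'a \<Rightarrow> real^3"
  assumes f: "\<And>i. L2 M (\<lambda>x. f x $ i)"
  shows "L2 M f"
proof -
  have "(norm (f x))\<^sup>2 = (\<Sum>i\<in>UNIV. (norm (f x $ i))\<^sup>2)" for x
    by (simp only: power2_norm_eq_inner inner_vec_def)
  then show ?thesis
    using assms L2_integrable[OF f] by (auto simp: L2_def borel_measurable_vec_iff)
qed

lemma L2_integrable_finite:
  assumes f: "L2 M f" and fin: "finite_measure M"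
  shows "integrable M f"
proof (rule Bochner_Integration.integrable_bound)
  show "integrable M (\<lambda>x. 1 + (norm (f x))\<^sup>2)"
    by (rule Bochner_Integration.integrable_add[OF finite_measure.integrable_const[OF fin] L2_integrable[OF f]])
  have "norm v \<le> 1 + (norm v)\<^sup>2" for v :: 'b
    using sum_squares_bound[of 1 "norm v"] by simp (smt (verit) norm_ge_zero)
  then show "AE x in M. norm (f x) \<le> norm (1 + (norm (f x))\<^sup>2)"
    by auto
qed (rule L2_measurable[OF f])

lemma L2_bounded:
  fixes g :: "'a \<Rightarrow> 'b::euclidean_space"
  assumes fin: "finite_measure M" and [measurable]: "g \<in> borel_measurable M"
    and le: "AE x in M. norm (g x) \<le> c"
  shows "L2 M g"
proof -
  have "L2 M (\<lambda>x. 1::real)"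
    using finite_measure.integrable_const[OF fin, of "1::real"] by (simp add: L2_def)
  then show ?thesis by (rule L2_bound[of _ _ _ c]) (use le in auto)
qed

section \<open>Set integrals as integrals over restricted measures\<close>

lemma measurable_lebesgue_on_iff:
  fixes f :: "real^3 \<Rightarrow> 'b::euclidean_space"
  assumes "U \<in> sets lebesgue"
  shows "set_borel_measurable lebesgue U f \<longleftrightarrow> f \<in> borel_measurable (lebesgue_on U)"
  using assms by (simp add: set_borel_measurable_def borel_measurable_restrict_space_iff)

lemma integrable_lebesgue_on_iff:
  fixes f :: "real^3 \<Rightarrow> 'b::euclidean_space"
  assumes "U \<in> sets lebesgue"
  shows "set_integrable lebesgue U f \<longleftrightarrow> integrable (lebesgue_on U) f"
  using assms by (simp add: set_integrable_def integrable_restrict_space)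

lemma integral_lebesgue_on:
  fixes f :: "real^3 \<Rightarrow> 'b::euclidean_space"
  assumes "U \<in> sets lebesgue"
  shows "(LINT x:U|lebesgue. f x) = (\<integral>x. f x \<partial>(lebesgue_on U))"
  using assms by (simp add: set_lebesgue_integral_def integral_restrict_space)

lemma AE_lebesgue_on_iff:
  assumes "U \<in> sets lebesgue"
  shows "(AE x in lebesgue_on U. P x) \<longleftrightarrow> (AE x in lebesgue. x \<in> U \<longrightarrow> P x)"
  using assms by (simp add: AE_restrict_space_iff)

lemma norm_powr_2: "norm v powr 2 = (norm v)\<^sup>2"
  by (cases "norm v = 0") (auto simp: powr_numeral)

lemma Lp_on_2_iff:
  fixes f :: "real^3 \<Rightarrow> 'b::euclidean_space"
  assumes "U \<in> sets lebesgue"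
  shows "Lp_on 2 U f \<longleftrightarrow> L2 (lebesgue_on U) f"
  using assms by (simp add: Lp_on_def L2_def norm_powr_2 measurable_lebesgue_on_iff integrable_lebesgue_on_iff)

lemma Lp_on_1_iff:
  fixes f :: "real^3 \<Rightarrow> 'b::euclidean_space"
  assumes "U \<in> sets lebesgue"
  shows "Lp_on 1 U f \<longleftrightarrow> integrable (lebesgue_on U) f"
  using assms integrable_iff_bounded integrable_norm_iff
  by (auto simp: Lp_on_def measurable_lebesgue_on_iff integrable_lebesgue_on_iff
      intro: integrable_norm_cancel)

lemma compact_lebesgue: "compact K \<Longrightarrow> K \<in> sets lebesgue"
  and open_lebesgue: "open U \<Longrightarrow> U \<in> sets lebesgue"
  by (auto simp: compact_imp_closed)

lemma finite_measure_lebesgue_on: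
  fixes U :: "(real^3) set"
  assumes "U \<in> sets lebesgue" "bounded U"
  shows "finite_measure (lebesgue_on U)"
proof -
  have "U \<in> lmeasurable" using assms by (simp add: bounded_set_imp_lmeasurable)
  then show ?thesis by (intro finite_measureI) (auto simp: emeasure_restrict_space fmeasurable_def)
qed

lemma Lp_loc_1_iff:
  fixes f :: "real^3 \<Rightarrow> 'b::euclidean_space"
  shows "Lp_loc 1 U f \<longleftrightarrow> (\<forall>K. compact K \<and> K \<subseteq> U \<longrightarrow> set_integrable lebesgue K f)"
  by (auto simp: Lp_loc_def Lp_on_1_iff compact_lebesgue integrable_lebesgue_on_iff)

lemma L2_subset:
  fixes f :: "real^3 \<Rightarrow> 'b::euclidean_space"
  assumes "L2 (lebesgue_on U) f" "U \<in> sets lebesgue" "K \<in> sets lebesgue" "K \<subseteq> U"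
  shows "L2 (lebesgue_on K) f"
proof -
  have "set_integrable lebesgue U (\<lambda>x. (norm (f x))\<^sup>2)"
    using assms by (simp add: L2_def integrable_lebesgue_on_iff)
  then have "set_integrable lebesgue K (\<lambda>x. (norm (f x))\<^sup>2)"
    by (rule set_integrable_subset) (use assms in auto)
  then have "integrable (lebesgue_on K) (\<lambda>x. (norm (f x))\<^sup>2)"
    using assms(3) by (simp add: integrable_lebesgue_on_iff)
  moreover have "f \<in> borel_measurable (lebesgue_on K)"
    by (rule measurable_restrict_mono[OF L2_measurable[OF assms(1)] assms(4)])
  ultimately show ?thesis unfolding L2_def by blast
qed

lemma Lp_loc_1_of_L2:
  fixes f :: "real^3 \<Rightarrow> 'b::euclidean_space"
  assumes "U \<in> sets lebesgue" "L2 (lebesgue_on U) f"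
  shows "Lp_loc 1 U f"
  unfolding Lp_loc_1_iff
proof (intro allI impI)
  fix K assume K: "compact K \<and> K \<subseteq> U"
  then have "L2 (lebesgue_on K) f"
    using L2_subset[OF assms(2,1), of K] by (simp add: compact_lebesgue)
  moreover have "finite_measure (lebesgue_on K)"
    using K by (simp add: finite_measure_lebesgue_on compact_lebesgue compact_imp_bounded)
  ultimately show "set_integrable lebesgue K f"
    using K L2_integrable_finite by (simp add: integrable_lebesgue_on_iff compact_lebesgue)
qed

lemma Lp_loc_1_of_Lp_loc_2:
  fixes f :: "real^3 \<Rightarrow> 'b::euclidean_space"
  assumes "Lp_loc 2 U f"
  shows "Lp_loc 1 U f"
  unfolding Lp_loc_1_iff
proof (intro allI impI)
  fix K assume K: "compact K \<and> K \<subseteq> U"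
  then have "L2 (lebesgue_on K) f"
    using assms by (simp add: Lp_loc_def Lp_on_2_iff compact_lebesgue)
  then show "set_integrable lebesgue K f"
    using K L2_integrable_finite[OF _ finite_measure_lebesgue_on, of K f]
    by (simp add: integrable_lebesgue_on_iff compact_lebesgue compact_imp_bounded)
qed

section \<open>Pairing locally integrable functions with test functions\<close>

lemma test_fun_bounded:
  assumes "test_fun U \<psi>"
  obtains B where "0 < B" "\<And>x. \<bar>\<psi> x\<bar> \<le> B"
proof -
  obtain K where K: "compact K" "\<And>x. x \<notin> K \<Longrightarrow> \<psi> x = 0"
    using assms unfolding test_fun_iff by blast
  have "bounded (\<psi> ` K)"
    by (intro compact_imp_bounded compact_continuous_image K smooth_continuous test_fun_smooth[OF assms])
  then obtain B where "0 < B" "\<forall>y\<in>\<psi> ` K. norm y \<le> B" unfolding bounded_pos by blast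
  then have "\<bar>\<psi> x\<bar> \<le> B" for x using K(2)[of x] by (cases "x \<in> K") auto
  then show ?thesis using that \<open>0 < B\<close> by blast
qed

lemma smooth_measurable [measurable_dest]: "smooth f \<Longrightarrow> f \<in> borel_measurable borel"
  by (intro borel_measurable_continuous_onI smooth_continuous)

lemma smooth_measurable_lebesgue: "smooth f \<Longrightarrow> f \<in> borel_measurable lebesgue"
  using smooth_measurable by (simp add: measurable_completion)

lemma test_integrable:
  fixes f :: "real^3 \<Rightarrow> real"
  assumes f: "Lp_loc 1 U f" and \<psi>: "test_fun U \<psi>"
  shows "integrable lebesgue (\<lambda>x. f x * \<psi> x)"
proof -
  obtain K where K: "compact K" "K \<subseteq> U" "\<And>x. x \<notin> K \<Longrightarrow> \<psi> x = 0"
    using \<psi> unfolding test_fun_iff by blast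
  obtain B where B: "\<And>x. \<bar>\<psi> x\<bar> \<le> B" using test_fun_bounded[OF \<psi>] by metis
  have i: "integrable lebesgue (\<lambda>x. indicator K x *\<^sub>R f x)"
    using f[unfolded Lp_loc_1_iff, rule_format, of K] K by (simp add: set_integrable_def)
  have m: "\<psi> \<in> borel_measurable lebesgue"
    using \<psi> by (intro smooth_measurable_lebesgue test_fun_smooth)
  have "integrable lebesgue (\<lambda>x. (indicator K x *\<^sub>R f x) * \<psi> x)"
  proof (rule Bochner_Integration.integrable_bound)
    show "integrable lebesgue (\<lambda>x. B * (indicator K x *\<^sub>R f x))" using i by simp
    show "(\<lambda>x. (indicator K x *\<^sub>R f x) * \<psi> x) \<in> borel_measurable lebesgue"
      using i m by (intro borel_measurable_times) auto
    have "norm ((indicator K x *\<^sub>R f x) * \<psi> x) \<le> norm (B * (indicator K x *\<^sub>R f x))" for x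
      using mult_left_mono[OF order_trans[OF B[of x] abs_ge_self] abs_ge_zero[of "f x"]]
      by (cases "x \<in> K") (auto simp: abs_mult mult.commute)
    then show "AE x in lebesgue. norm ((indicator K x *\<^sub>R f x) * \<psi> x) \<le> norm (B * (indicator K x *\<^sub>R f x))"
      by auto
  qed
  moreover have "(indicator K x *\<^sub>R f x) * \<psi> x = f x * \<psi> x" for x
    using K(3)[of x] by (auto simp: indicator_def)
  ultimately show ?thesis by (simp only:)
qed

lemma test_set_integral:
  assumes "test_fun U \<psi>"
  shows "(LINT x:U|lebesgue. f x * \<psi> x) = (\<integral>x. f x * \<psi> x \<partial>lebesgue)"
    "(LINT x:U|lebesgue. \<psi> x * f x) = (\<integral>x. \<psi> x * f x \<partial>lebesgue)"
proof -
  have "indicator U x *\<^sub>R (f x * \<psi> x) = f x * \<psi> x" "indicator U x *\<^sub>R (\<psi> x * f x) = \<psi> x * f x" for x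
    using assms unfolding test_fun_iff by (auto simp: indicator_def)
  then show "(LINT x:U|lebesgue. f x * \<psi> x) = (\<integral>x. f x * \<psi> x \<partial>lebesgue)"
    "(LINT x:U|lebesgue. \<psi> x * f x) = (\<integral>x. \<psi> x * f x \<partial>lebesgue)"
    unfolding set_lebesgue_integral_def by (simp_all only:)
qed

text \<open>Box bumps converge to box indicators, so f has integral 0 over every box inside U.
  Cutting f off outside one closed box makes all cubes admissible, and differentiation of integrals
  over small cubes gives f = 0 almost everywhere there. Countably many boxes cover U.\<close>

lemma fundamental_lemma:
  fixes f :: "real^3 \<Rightarrow> real"
  assumes U: "open U" and f: "Lp_loc 1 U f"
    and 0: "\<And>\<psi>. test_fun U \<psi> \<Longrightarrow> (\<integral>x. f x * \<psi> x \<partial>lebesgue) = 0"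
  shows "AE x in lebesgue. x \<in> U \<longrightarrow> f x = 0"
proof -
  have box: "AE x in lebesgue. x \<in> cbox a b \<longrightarrow> f x = 0" if ab: "cbox a b \<subseteq> U" for a b
  proof -
    define g where "g x = indicator (cbox a b) x *\<^sub>R f x" for x
    have g: "integrable lebesgue g"
      using f[unfolded Lp_loc_1_iff, rule_format, of "cbox a b"] ab
      by (simp add: set_integrable_def g_def[abs_def])
    have gm: "(\<lambda>x. indicator S x * g x) \<in> borel_measurable lebesgue" if "S \<in> sets lebesgue" for S
      using that by (intro borel_measurable_times borel_measurable_indicator borel_measurable_integrable[OF g])
    have int0: "integral (cbox c d) g = 0" for c d
    proof -
      \<comment> \<open>Boxes are closed under intersection, so a bump on the intersection is a
        legitimate test function although \<open>cbox c d\<close> may leave U.\<close>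
      obtain c' d' where cd: "cbox a b \<inter> cbox c d = cbox c' d'"
        by (rule that[OF Int_interval])
      have "(\<lambda>n. \<integral>x. f x * box_bump c' d' n x \<partial>lebesgue) \<longlonglongrightarrow> (\<integral>x. indicator (box c' d') x * g x \<partial>lebesgue)"
      proof (rule integral_dominated_convergence[where w = "\<lambda>x. norm (g x)"])
        have sub: "box c' d' \<subseteq> cbox a b" using box_subset_cbox[of c' d'] cd by auto
        show "AE x in lebesgue. (\<lambda>n. f x * box_bump c' d' n x) \<longlonglongrightarrow> indicator (box c' d') x * g x"
        proof (rule AE_I2)
          fix x
          have "f x * indicator (box c' d') x = indicator (box c' d') x * g x"
            using sub by (auto simp: g_def indicator_def)
          then show "(\<lambda>n. f x * box_bump c' d' n x) \<longlonglongrightarrow> indicator (box c' d') x * g x"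
            using tendsto_mult[OF tendsto_const box_bump_tendsto, of "f x" c' d' x] by (simp only:)
        qed
        show "AE x in lebesgue. norm (f x * box_bump c' d' n x) \<le> norm (g x)" for n
        proof (rule AE_I2)
          fix x
          show "norm (f x * box_bump c' d' n x) \<le> norm (g x)"
          proof (cases "x \<in> box c' d'")
            case True
            then have "g x = f x" using sub by (auto simp: g_def)
            then show ?thesis using box_bump_bounds[of c' d' n x]
              by (simp add: abs_mult mult_left_le)
          qed (simp add: box_bump_outside)
        qed
        show "(\<lambda>x. f x * box_bump c' d' n x) \<in> borel_measurable lebesgue" for n
          by (rule borel_measurable_integrable, rule test_integrable[OF f test_fun_box_bump])
             (use cd ab in auto)
      qed (use g gm[of "box c' d'"] in \<open>auto simp: open_lebesgue\<close>)
      moreover have "(\<integral>x. f x * box_bump c' d' n x \<partial>lebesgue) = 0" for n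
        by (rule 0[OF test_fun_box_bump]) (use cd ab in auto)
      ultimately have z: "(\<integral>x. indicator (box c' d') x * g x \<partial>lebesgue) = 0"
        using LIMSEQ_unique[of "\<lambda>n. 0" 0] by (simp add: tendsto_const_iff)
      have "integral (cbox c d) g = (\<integral>x. indicator (cbox c d) x *\<^sub>R g x \<partial>lebesgue)"
        using set_lebesgue_integral_eq_integral(2)[of "cbox c d" g] integrable_mult_indicator[OF _ g, of "cbox c d"]
        by (simp add: set_integrable_def set_lebesgue_integral_def)
      also have "\<dots> = (\<integral>x. indicator (box c' d') x * g x \<partial>lebesgue)"
      proof (rule integral_cong_AE)
        \<comment> \<open>The bumps detect the open box only; its frontier is a null set.\<close>
        have "cbox c' d' - box c' d' \<in> null_sets lebesgue"
          using negligible_frontier_interval[of c' d'] by (simp add: negligible_iff_null_sets)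
        then have "AE x in lebesgue. x \<notin> cbox c' d' - box c' d'"
          by (rule AE_not_in)
        then show "AE x in lebesgue. indicator (cbox c d) x *\<^sub>R g x = indicator (box c' d') x * g x"
        proof eventually_elim
          case (elim x)
          then show ?case using cd box_subset_cbox[of c' d'] by (auto simp: g_def indicator_def)
        qed
      qed (use gm[of "box c' d'"] gm[of "cbox c d"] in \<open>auto simp: open_lebesgue\<close>)
      finally show ?thesis using z by simp
    qed
    have "g integrable_on cbox c d" for c d
      using integrable_on_lebesgue[OF g] integrable_on_subcbox by blast
    then obtain N where N: "negligible N"
      "\<And>x e. \<lbrakk>x \<notin> N; 0 < e\<rbrakk> \<Longrightarrow> \<exists>d>0. \<forall>h. 0 < h \<and> h < d \<longrightarrow>
         norm(integral (cbox x (x + h *\<^sub>R One)) g /\<^sub>R h ^ DIM(real^3) - g x) < e"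
      using integrable_ccontinuous_explicit[of g] by blast
    have gz: "g x = 0" if xN: "x \<notin> N" for x
    proof (rule ccontr)
      assume "g x \<noteq> 0"
      then obtain d :: real where "d > 0" and d: "\<forall>h>0. \<not> h < d"
        using N(2)[OF xN, of "norm (g x)"] by (auto simp: int0)
      then show False using d[rule_format, of "d / 2"] by simp
    qed
    have "AE x in lebesgue. x \<notin> N"
      using N(1) by (intro AE_not_in) (simp add: negligible_iff_null_sets)
    then show ?thesis
    proof eventually_elim
      case (elim x)
      then show ?case using gz[of x] by (auto simp: g_def)
    qed
  qed
  obtain D where D: "countable D" "D \<subseteq> Pow U" "\<And>X. X \<in> D \<Longrightarrow> \<exists>a b. X = cbox a b" "\<Union>D = U"
    using open_countable_Union_open_cbox[OF U] by metis
  have "AE x in lebesgue. \<forall>X\<in>D. x \<in> X \<longrightarrow> f x = 0"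
  proof (rule AE_ball_countable[THEN iffD2], rule D, rule ballI)
    fix X assume "X \<in> D"
    then obtain a b where "X = cbox a b" "cbox a b \<subseteq> U" using D by blast
    then show "AE x in lebesgue. x \<in> X \<longrightarrow> f x = 0" using box by simp
  qed
  then show ?thesis by eventually_elim (use D(4) in blast)
qed

subsection \<open>Weak derivatives\<close>

lemma Lp_loc_1_nth:
  fixes G :: "real^3 \<Rightarrow> real^3"
  assumes "Lp_loc 1 U G"
  shows "Lp_loc 1 U (\<lambda>x. G x $ i)"
  unfolding Lp_loc_1_iff
proof (intro allI impI)
  fix K assume "compact K \<and> K \<subseteq> U"
  then have "integrable lebesgue (\<lambda>x. indicator K x *\<^sub>R G x)"
    using assms[unfolded Lp_loc_1_iff, rule_format, of K] by (simp add: set_integrable_def)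
  then have "integrable lebesgue (\<lambda>x. (indicator K x *\<^sub>R G x) \<bullet> axis i 1)"
    by (rule integrable_inner_left)
  then show "set_integrable lebesgue K (\<lambda>x. G x $ i)"
    by (simp add: set_integrable_def inner_axis)
qed

lemma Lp_loc_1_diff:
  fixes f g :: "real^3 \<Rightarrow> real"
  assumes "Lp_loc 1 U f" "Lp_loc 1 U g"
  shows "Lp_loc 1 U (\<lambda>x. f x - g x)"
  using assms unfolding Lp_loc_1_iff by (auto intro: set_integral_diff(1))

lemma Lp_loc_1_cmult:
  fixes f :: "real^3 \<Rightarrow> 'b::euclidean_space"
  assumes "Lp_loc 1 U f"
  shows "Lp_loc 1 U (\<lambda>x. c *\<^sub>R f x)"
  using assms unfolding Lp_loc_1_iff by (auto intro: set_integrable_scaleR_right)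

lemma AE_vec_eq:
  fixes f g :: "'a \<Rightarrow> real^3"
  assumes "\<And>i. AE x in M. P x \<longrightarrow> f x $ i = g x $ i"
  shows "AE x in M. P x \<longrightarrow> f x = g x"
proof -
  have "AE x in M. \<forall>i. P x \<longrightarrow> f x $ i = g x $ i"
    using assms by (intro AE_all_countable[THEN iffD2]) blast
  then show ?thesis by eventually_elim (simp add: vec_eq_iff)
qed

lemma fundamental_lemma_vec:
  fixes F G :: "real^3 \<Rightarrow> real^3"
  assumes U: "open U" and F: "Lp_loc 1 U F" and G: "Lp_loc 1 U G"
    and eq: "\<And>i \<psi>. test_fun U \<psi> \<Longrightarrow> (\<integral>x. F x $ i * \<psi> x \<partial>lebesgue) = (\<integral>x. G x $ i * \<psi> x \<partial>lebesgue)"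
  shows "AE x in lebesgue. x \<in> U \<longrightarrow> F x = G x"
proof (rule AE_vec_eq)
  fix i
  note nth = Lp_loc_1_nth[OF F, of i] Lp_loc_1_nth[OF G, of i]
  have "AE x in lebesgue. x \<in> U \<longrightarrow> F x $ i - G x $ i = 0"
  proof (rule fundamental_lemma[OF U])
    show "Lp_loc 1 U (\<lambda>x. F x $ i - G x $ i)"
      by (rule Lp_loc_1_diff[OF nth])
    fix \<psi> assume t: "test_fun U \<psi>"
    show "(\<integral>x. (F x $ i - G x $ i) * \<psi> x \<partial>lebesgue) = 0"
      using test_integrable[OF nth(1) t] test_integrable[OF nth(2) t] eq[OF t, of i]
      by (simp add: left_diff_distrib)
  qed
  then show "AE x in lebesgue. x \<in> U \<longrightarrow> F x $ i = G x $ i"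
    by eventually_elim auto
qed

lemma weak_grad_lebesgue:
  assumes "weak_grad U u G" "test_fun U \<psi>"
  shows "(\<integral>x. u x * partial i \<psi> x \<partial>lebesgue) = - (\<integral>x. G x $ i * \<psi> x \<partial>lebesgue)"
  using assms(1)[unfolded weak_grad_def, THEN conjunct2, THEN conjunct2, rule_format, OF assms(2), of i]
  by (simp only: test_set_integral(1)[OF test_fun_partial[OF assms(2)]] test_set_integral(1)[OF assms(2)])

lemma weak_gradI:
  assumes "Lp_loc 1 U u" "Lp_loc 1 U G"
    and "\<And>\<psi> i. test_fun U \<psi> \<Longrightarrow>
      (\<integral>x. u x * partial i \<psi> x \<partial>lebesgue) = - (\<integral>x. G x $ i * \<psi> x \<partial>lebesgue)"
  shows "weak_grad U u G"
  unfolding weak_grad_def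
proof (intro conjI allI impI)
  fix \<psi> i assume t: "test_fun U \<psi>"
  show "(LINT x:U|lebesgue. u x * partial i \<psi> x) = - (LINT x:U|lebesgue. G x $ i * \<psi> x)"
    unfolding test_set_integral(1)[OF test_fun_partial[OF t]] test_set_integral(1)[OF t]
    by (rule assms(3)[OF t])
qed (use assms in auto)

lemma weak_grad_unique:
  assumes "open U" "weak_grad U u G" "weak_grad U u G'"
  shows "AE x in lebesgue. x \<in> U \<longrightarrow> G x = G' x"
proof (rule fundamental_lemma_vec[OF assms(1)])
  show "Lp_loc 1 U G" "Lp_loc 1 U G'" using assms by (auto simp: weak_grad_def)
  show "(\<integral>x. G x $ i * \<psi> x \<partial>lebesgue) = (\<integral>x. G' x $ i * \<psi> x \<partial>lebesgue)" if "test_fun U \<psi>" for i \<psi>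
    using weak_grad_lebesgue[OF assms(2) that, of i] weak_grad_lebesgue[OF assms(3) that, of i] by simp
qed

lemma weak_grad_wgrad: "weak_grad U u G \<Longrightarrow> weak_grad U u (wgrad U u)"
  unfolding wgrad_def by (rule someI[of "weak_grad U u" G])

lemma wgrad_AE:
  assumes "open U" "weak_grad U u G"
  shows "AE x in lebesgue. x \<in> U \<longrightarrow> wgrad U u x = G x"
  using weak_grad_unique[OF assms(1) weak_grad_wgrad[OF assms(2)] assms(2)] .

section \<open>Weak curls\<close>

lemma inner_3: "(v::real^3) \<bullet> w = v $ 1 * w $ 1 + v $ 2 * w $ 2 + v $ 3 * w $ 3"
  by (simp add: inner_vec_def sum_3)

lemma test_field_set_integral:
  assumes "test_field U \<psi>"
  shows "(LINT x:U|lebesgue. F x \<bullet> \<psi> x) = (\<integral>x. F x \<bullet> \<psi> x \<partial>lebesgue)"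
proof -
  have "indicator U x *\<^sub>R (F x \<bullet> \<psi> x) = F x \<bullet> \<psi> x" for x
  proof (cases "x \<in> U")
    case False
    have "\<psi> x $ i = 0" for i
      using test_field_test_fun[OF assms, of i] False unfolding test_fun_iff by blast
    then have "\<psi> x = 0" by (simp add: vec_eq_iff)
    then show ?thesis by simp
  qed simp
  then show ?thesis unfolding set_lebesgue_integral_def by (simp only:)
qed

lemma test_field_integrable:
  assumes "Lp_loc 1 U F" "test_field U \<psi>"
  shows "integrable lebesgue (\<lambda>x. F x \<bullet> \<psi> x)"
  unfolding inner_3
  by (intro Bochner_Integration.integrable_add test_integrable[OF Lp_loc_1_nth[OF assms(1)] test_field_test_fun[OF assms(2)]])

lemma weak_curl_lebesgue:
  assumes "weak_curl U F C" "test_field U \<psi>"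
  shows "(\<integral>x. F x \<bullet> curl_op \<psi> x \<partial>lebesgue) = (\<integral>x. C x \<bullet> \<psi> x \<partial>lebesgue)"
  using assms(1)[unfolded weak_curl_def, THEN conjunct2, THEN conjunct2, rule_format, OF assms(2)]
  by (simp only: test_field_set_integral[OF test_field_curl_op[OF assms(2)]] test_field_set_integral[OF assms(2)])

lemma weak_curlI:
  assumes "Lp_loc 1 U F" "Lp_loc 1 U C"
    and "\<And>\<psi>. test_field U \<psi> \<Longrightarrow>
      (\<integral>x. F x \<bullet> curl_op \<psi> x \<partial>lebesgue) = (\<integral>x. C x \<bullet> \<psi> x \<partial>lebesgue)"
  shows "weak_curl U F C"
  unfolding weak_curl_def
proof (intro conjI allI impI)
  fix \<psi> assume t: "test_field U \<psi>"
  show "(LINT x:U|lebesgue. F x \<bullet> curl_op \<psi> x) = (LINT x:U|lebesgue. C x \<bullet> \<psi> x)"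
    unfolding test_field_set_integral[OF test_field_curl_op[OF t]] test_field_set_integral[OF t]
    by (rule assms(3)[OF t])
qed (use assms in auto)

lemma test_field_axis:
  assumes "test_fun U \<psi>"
  shows "test_field U (\<lambda>x. axis i (\<psi> x))"
proof -
  have "test_fun U (\<lambda>x. axis i (\<psi> x) $ k)" for k
    by (cases "k = i") (simp_all add: axis_def assms test_fun_0)
  then show ?thesis by (simp add: test_field_def)
qed

lemma weak_curl_unique:
  assumes "open U" "weak_curl U F C" "weak_curl U F C'"
  shows "AE x in lebesgue. x \<in> U \<longrightarrow> C x = C' x"
proof (rule fundamental_lemma_vec[OF assms(1)])
  show "Lp_loc 1 U C" "Lp_loc 1 U C'" using assms by (auto simp: weak_curl_def)
  show "(\<integral>x. C x $ i * \<psi> x \<partial>lebesgue) = (\<integral>x. C' x $ i * \<psi> x \<partial>lebesgue)" if "test_fun U \<psi>" for i \<psi>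
    using weak_curl_lebesgue[OF assms(2) test_field_axis[OF that], of i]
      weak_curl_lebesgue[OF assms(3) test_field_axis[OF that], of i]
    by (simp add: inner_axis)
qed

lemma weak_curl_wcurl: "weak_curl U F C \<Longrightarrow> weak_curl U F (wcurl U F)"
  unfolding wcurl_def by (rule someI[of "weak_curl U F" C])

lemma wcurl_AE:
  assumes "open U" "weak_curl U F C"
  shows "AE x in lebesgue. x \<in> U \<longrightarrow> wcurl U F x = C x"
  using weak_curl_unique[OF assms(1) weak_curl_wcurl[OF assms(2)] assms(2)] .

lemma weak_curl_scaleR:
  assumes "weak_curl U F C"
  shows "weak_curl U (\<lambda>x. c *\<^sub>R F x) (\<lambda>x. c *\<^sub>R C x)"
proof (rule weak_curlI)
  show "Lp_loc 1 U (\<lambda>x. c *\<^sub>R F x)" "Lp_loc 1 U (\<lambda>x. c *\<^sub>R C x)"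
    using assms by (auto simp: weak_curl_def intro: Lp_loc_1_cmult)
  show "(\<integral>x. (c *\<^sub>R F x) \<bullet> curl_op \<psi> x \<partial>lebesgue) = (\<integral>x. (c *\<^sub>R C x) \<bullet> \<psi> x \<partial>lebesgue)" if "test_field U \<psi>" for \<psi>
    using weak_curl_lebesgue[OF assms that] by simp
qed

text \<open>\<open>G k\<close> stands for the gradient of the k-th component, so
  \<open>G k x $ i\<close> is the i-th derivative of that component; with this reading the vector is
  the usual curl.\<close>

definition curl_of_grads :: "(3 \<Rightarrow> real^3 \<Rightarrow> real^3) \<Rightarrow> real^3 \<Rightarrow> real^3" where
  "curl_of_grads G x = vector [G 3 x $ 2 - G 2 x $ 3, G 1 x $ 3 - G 3 x $ 1, G 2 x $ 1 - G 1 x $ 2]"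

lemma curl_of_grads_nth:
  "curl_of_grads G x $ 1 = G 3 x $ 2 - G 2 x $ 3"
  "curl_of_grads G x $ 2 = G 1 x $ 3 - G 3 x $ 1"
  "curl_of_grads G x $ 3 = G 2 x $ 1 - G 1 x $ 2"
  by (simp_all add: curl_of_grads_def)

lemma integrable_vec:
  fixes H :: "'a \<Rightarrow> real^3"
  assumes "\<And>i. integrable M (\<lambda>x. H x $ i)"
  shows "integrable M H"
proof -
  have "integrable M (\<lambda>x. \<Sum>i\<in>UNIV. H x $ i *\<^sub>R axis i (1::real))"
    using assms by (intro Bochner_Integration.integrable_sum integrable_scaleR_left)
  moreover have "(\<Sum>i\<in>UNIV. H x $ i *\<^sub>R axis i 1) = H x" for x
    using basis_expansion[of "H x"] by (simp add: scalar_mult_eq_scaleR)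
  ultimately show ?thesis by simp
qed

lemma Lp_loc_1_vec:
  fixes F :: "real^3 \<Rightarrow> real^3"
  assumes "\<And>i. Lp_loc 1 U (\<lambda>x. F x $ i)"
  shows "Lp_loc 1 U F"
  unfolding Lp_loc_1_iff set_integrable_def
proof (intro allI impI integrable_vec)
  fix K i assume K: "compact K \<and> K \<subseteq> U"
  then have "integrable lebesgue (\<lambda>x. indicator K x *\<^sub>R F x $ i)"
    using assms[unfolded Lp_loc_1_iff, rule_format, of K i] by (simp add: set_integrable_def)
  then show "integrable lebesgue (\<lambda>x. (indicator K x *\<^sub>R F x) $ i)" by simp
qed

lemma weak_curl_of_grads:
  assumes G: "\<And>k. weak_grad U (\<lambda>x. F x $ k) (G k)"
  shows "weak_curl U F (curl_of_grads G)"
proof (rule weak_curlI)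
  have F': "Lp_loc 1 U (\<lambda>x. F x $ k)" for k using G[of k] by (simp add: weak_grad_def)
  then show "Lp_loc 1 U F" by (rule Lp_loc_1_vec)
  have G': "Lp_loc 1 U (\<lambda>x. G k x $ i)" for k i
    using Lp_loc_1_nth[of U "G k" i] G[of k] by (simp add: weak_grad_def)
  show "Lp_loc 1 U (curl_of_grads G)"
  proof (rule Lp_loc_1_vec)
    show "Lp_loc 1 U (\<lambda>x. curl_of_grads G x $ i)" for i
      using exhaust_3[of i] by (elim disjE; simp only: curl_of_grads_nth; intro Lp_loc_1_diff G')
  qed
  fix \<psi> assume t: "test_field U \<psi>"
  note t' = test_field_test_fun[OF t]
  note W = weak_grad_lebesgue[OF G t']
  note I = test_integrable[OF F' test_fun_partial[OF t']]
  note J = test_integrable[OF G' t']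
  show "(\<integral>x. F x \<bullet> curl_op \<psi> x \<partial>lebesgue) = (\<integral>x. curl_of_grads G x \<bullet> \<psi> x \<partial>lebesgue)"
    by (simp add: inner_3 curl_op_nth curl_of_grads_nth right_diff_distrib left_diff_distrib I J W)
qed

text \<open>Moving the weak gradient onto \<open>curl_op \<psi>\<close> leaves the divergence of the
  latter, which is zero by \<open>div_curl_op\<close>. This removes the unknown potential from the
  curl of A - grad \<phi>.\<close>

lemma weak_grad_orth_curl:
  assumes G: "weak_grad U u G" and t: "test_field U \<psi>"
  shows "(\<integral>x. G x \<bullet> curl_op \<psi> x \<partial>lebesgue) = 0"
proof -
  have u: "Lp_loc 1 U u" and G': "Lp_loc 1 U G" using G by (auto simp: weak_grad_def)
  note t' = test_field_test_fun[OF test_field_curl_op[OF t]]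
  have "(\<integral>x. G x \<bullet> curl_op \<psi> x \<partial>lebesgue) = (\<Sum>i\<in>UNIV. \<integral>x. G x $ i * curl_op \<psi> x $ i \<partial>lebesgue)"
    using test_integrable[OF Lp_loc_1_nth[OF G'] t'] by (simp add: inner_vec_def)
  also have "\<dots> = (\<Sum>i\<in>UNIV. - (\<integral>x. u x * partial i (\<lambda>y. curl_op \<psi> y $ i) x \<partial>lebesgue))"
    using weak_grad_lebesgue[OF G t'] by simp
  also have "\<dots> = - (\<integral>x. (\<Sum>i\<in>UNIV. u x * partial i (\<lambda>y. curl_op \<psi> y $ i) x) \<partial>lebesgue)"
    using test_integrable[OF u test_fun_partial[OF t']] by (simp add: sum_negf)
  also have "\<dots> = 0"
    using div_curl_op[OF t] by (simp add: sum_distrib_left[symmetric])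
  finally show ?thesis .
qed

subsection \<open>Density of test functions\<close>

text \<open>The complement of a product of complements is a smooth union of bumps. It is a test
  function because adjoining one bump is the operation t + \<beta> - t \<beta>, in which the
  constant 1 has cancelled.\<close>

lemma test_fun_union:
  assumes "finite S" "\<And>k. k \<in> S \<Longrightarrow> test_fun U (\<beta> k)"
  shows "test_fun U (\<lambda>x. 1 - (\<Prod>k\<in>S. 1 - \<beta> k x))"
  using assms
proof induction
  case empty
  then show ?case by (simp add: test_fun_0)
next
  case (insert k S)
  let ?t = "\<lambda>x. 1 - (\<Prod>k\<in>S. 1 - \<beta> k x)"
  have t: "test_fun U ?t" "test_fun U (\<beta> k)" using insert by auto
  have "test_fun U (\<lambda>x. ?t x + \<beta> k x - ?t x * \<beta> k x)"
    by (intro test_fun_diff test_fun_add test_fun_mult test_fun_smooth[of U] t)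
  moreover have "(\<lambda>x. ?t x + \<beta> k x - ?t x * \<beta> k x) = (\<lambda>x. 1 - (\<Prod>k\<in>insert k S. 1 - \<beta> k x))"
    using insert by (auto simp: algebra_simps)
  ultimately show ?case by simp
qed

text \<open>The n-th cutoff joins the first n bumps of a countable cover, each taken at sharpness n.
  A point in the interior of the k-th box satisfies
  \<open>1 - \<theta> n x \<le> 1 - box_bump (a k) (b k) n x\<close> once n > k, and the frontiers
  of the boxes form a null set.\<close>

lemma cutoff_sequence:
  assumes U: "open (U :: (real^3) set)"
  obtains \<theta> where "\<And>n::nat. test_fun U (\<theta> n)" "\<And>n x. 0 \<le> \<theta> n x" "\<And>n x. \<theta> n x \<le> 1"
    "AE x in lebesgue. x \<in> U \<longrightarrow> (\<lambda>n. \<theta> n x) \<longlonglongrightarrow> 1"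
proof (cases "U = {}")
  case True
  show ?thesis by (rule that[of "\<lambda>n x. 0"]) (auto simp: True test_fun_0)
next
  case False
  obtain D where D: "countable D" "D \<subseteq> Pow U" "\<And>X. X \<in> D \<Longrightarrow> \<exists>a b. X = cbox a b" "\<Union>D = U"
    using open_countable_Union_open_cbox[OF U] by metis
  have "D \<noteq> {}" using D(4) False by auto
  then have "\<exists>a b. from_nat_into D k = cbox a b" for k using D(3) from_nat_into by metis
  then obtain a b where ab: "\<And>k. from_nat_into D k = cbox (a k) (b k)" by metis
  have sub: "cbox (a k) (b k) \<subseteq> U" for k
    using from_nat_into[OF \<open>D \<noteq> {}\<close>, of k] D(2) ab[of k] by auto
  have cov: "\<exists>k. x \<in> cbox (a k) (b k)" if "x \<in> U" for x
  proof -
    from that D(4) obtain X where "X \<in> D" "x \<in> X" by auto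
    then show ?thesis using from_nat_into_surj[OF D(1), of X] ab by metis
  qed
  define \<theta> where "\<theta> n x = 1 - (\<Prod>k<n. 1 - box_bump (a k) (b k) n x)" for n :: nat and x
  have *: "0 \<le> 1 - box_bump (a k) (b k) n x" "1 - box_bump (a k) (b k) n x \<le> 1" for k n x
    using box_bump_bounds[of "a k" "b k" n x] by auto
  have P: "0 \<le> (\<Prod>k<n. 1 - box_bump (a k) (b k) n x)" "(\<Prod>k<n. 1 - box_bump (a k) (b k) n x) \<le> 1" for n x
    by (auto intro!: prod_nonneg prod_le_1 simp: * box_bump_bounds)
  show ?thesis
  proof (rule that)
    show "test_fun U (\<theta> n)" for n
      unfolding \<theta>_def[abs_def] by (intro test_fun_union test_fun_box_bump sub) auto
    show "0 \<le> \<theta> n x" "\<theta> n x \<le> 1" for n x using P[of n x] by (auto simp: \<theta>_def)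
    have "AE x in lebesgue. x \<notin> cbox (a k) (b k) - box (a k) (b k)" for k
      using negligible_frontier_interval[of "a k" "b k"]
      by (intro AE_not_in) (simp add: negligible_iff_null_sets)
    then have "AE x in lebesgue. \<forall>k. x \<notin> cbox (a k) (b k) - box (a k) (b k)"
      by (intro AE_all_countable[THEN iffD2]) blast
    then show "AE x in lebesgue. x \<in> U \<longrightarrow> (\<lambda>n. \<theta> n x) \<longlonglongrightarrow> 1"
    proof eventually_elim
      case (elim x)
      show ?case
      proof
        assume "x \<in> U"
        then obtain k where k: "x \<in> box (a k) (b k)" using cov elim by auto
        have lim: "(\<lambda>n. 1 - box_bump (a k) (b k) n x) \<longlonglongrightarrow> 0"
          using tendsto_diff[OF tendsto_const box_bump_tendsto, of 1 "a k" "b k" x] k by simp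
        have "(\<lambda>n. \<Prod>k<n. 1 - box_bump (a k) (b k) n x) \<longlonglongrightarrow> 0"
        proof (rule tendsto_sandwich[OF _ _ tendsto_const lim])
          show "\<forall>\<^sub>F n in sequentially. 0 \<le> (\<Prod>k<n. 1 - box_bump (a k) (b k) n x)"
            using P by simp
          show "\<forall>\<^sub>F n in sequentially. (\<Prod>k<n. 1 - box_bump (a k) (b k) n x) \<le> 1 - box_bump (a k) (b k) n x"
            using eventually_gt_at_top[of k]
          proof eventually_elim
            case (elim n)
            have "(\<Prod>k<n. 1 - box_bump (a k) (b k) n x)
              = (1 - box_bump (a k) (b k) n x) * (\<Prod>j\<in>{..<n} - {k}. 1 - box_bump (a j) (b j) n x)"
              using elim by (subst prod.remove[of _ k]) auto
            also have "\<dots> \<le> (1 - box_bump (a k) (b k) n x) * 1"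
              by (intro mult_left_mono prod_le_1) (auto simp: * box_bump_bounds)
            finally show ?case by simp
          qed
        qed
        then show "(\<lambda>n. \<theta> n x) \<longlonglongrightarrow> 1"
          using tendsto_diff[OF tendsto_const, of _ 0 sequentially 1] by (force simp: \<theta>_def)
      qed
    qed
  qed
qed

text \<open>The property is stable under dominated limits (\<open>test_approx_limit\<close>), so
  density of test functions in L2 is reached in layers: continuous functions times a cutoff, bounded
  continuous, bounded measurable, square integrable.\<close>

definition test_approx :: "(real^3) set \<Rightarrow> (real^3 \<Rightarrow> real) \<Rightarrow> bool" where
  "test_approx U f \<longleftrightarrow> L2 (lebesgue_on U) f \<and>
     (\<forall>e>0. \<exists>\<eta>. test_fun U \<eta> \<and> (\<integral>x. (f x - \<eta> x)\<^sup>2 \<partial>(lebesgue_on U)) < e)"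

lemma test_fun_L2:
  assumes U: "open U" "bounded U" and \<eta>: "test_fun V \<eta>"
  shows "L2 (lebesgue_on U) \<eta>"
proof -
  obtain B where "\<And>x. \<bar>\<eta> x\<bar> \<le> B" using test_fun_bounded[OF \<eta>] by metis
  then show ?thesis
    using U smooth_measurable_lebesgue[OF test_fun_smooth[OF \<eta>]]
    by (intro L2_bounded[of _ _ B] finite_measure_lebesgue_on)
       (auto simp: open_lebesgue measurable_restrict_space1)
qed

lemma L2_square_integrable: "L2 M f \<Longrightarrow> integrable M (\<lambda>x. (f x :: real)\<^sup>2)"
  using L2_integrable[of M f] by simp

lemma test_approx_test_fun: "open U \<Longrightarrow> bounded U \<Longrightarrow> test_fun U \<eta> \<Longrightarrow> test_approx U \<eta>"
  unfolding test_approx_def by (auto simp: test_fun_L2 intro!: exI[of _ \<eta>])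

text \<open>Dominated convergence with majorant 4 w^2 turns the pointwise limit into an L2 limit.
  The triangle inequality in squared form costs factors 2, whence the two shares e / 4.\<close>

lemma test_approx_limit:
  assumes U: "open U" "bounded U"
    and g: "\<And>n::nat. test_approx U (g n)"
    and f: "f \<in> borel_measurable (lebesgue_on U)"
    and w: "L2 (lebesgue_on U) w"
    and lim: "AE x in lebesgue_on U. (\<lambda>n. g n x) \<longlonglongrightarrow> f x"
    and bd: "\<And>n. AE x in lebesgue_on U. \<bar>g n x\<bar> \<le> w x"
  shows "test_approx U f"
proof -
  let ?M = "lebesgue_on U"
  have g2: "L2 ?M (g n)" for n using g by (simp add: test_approx_def)
  note [measurable] = f L2_measurable[OF g2]
  have "AE x in ?M. \<forall>n. \<bar>g n x\<bar> \<le> w x"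
    using bd by (intro AE_all_countable[THEN iffD2]) blast
  with lim have fw: "AE x in ?M. \<bar>f x\<bar> \<le> w x"
  proof eventually_elim
    case (elim x)
    show ?case
      by (rule LIMSEQ_le_const2[OF tendsto_rabs[OF elim(1)]]) (use elim(2) in auto)
  qed
  then have f2: "L2 ?M f"
    by (intro L2_bound[OF w, of _ 1] f) (auto elim: eventually_mono)
  have "(\<lambda>n. \<integral>x. (f x - g n x)\<^sup>2 \<partial>?M) \<longlonglongrightarrow> (\<integral>x. 0 \<partial>?M)"
  proof (rule integral_dominated_convergence[where w = "\<lambda>x. 4 * (w x)\<^sup>2"])
    show "integrable ?M (\<lambda>x. 4 * (w x)\<^sup>2)" using L2_square_integrable[OF w] by simp
    show "AE x in ?M. (\<lambda>n. (f x - g n x)\<^sup>2) \<longlonglongrightarrow> 0"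
      using lim
    proof eventually_elim
      case (elim x)
      from tendsto_power[OF tendsto_diff[OF tendsto_const elim], of "f x" 2] show ?case by simp
    qed
    show "AE x in ?M. norm ((f x - g n x)\<^sup>2) \<le> 4 * (w x)\<^sup>2" for n
      using fw bd[of n]
    proof eventually_elim
      case (elim x)
      then have "\<bar>f x - g n x\<bar> \<le> 2 * w x" by linarith
      from power_mono[OF this, of 2] show ?case by (simp add: power_mult_distrib)
    qed
  qed auto
  then have lim0: "(\<lambda>n. \<integral>x. (f x - g n x)\<^sup>2 \<partial>?M) \<longlonglongrightarrow> 0" by simp
  show ?thesis
    unfolding test_approx_def
  proof (intro conjI f2 allI impI)
    fix e :: real assume e: "0 < e"
    from order_tendstoD(2)[OF lim0, of "e / 4"] e obtain n where n: "(\<integral>x. (f x - g n x)\<^sup>2 \<partial>?M) < e / 4"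
      by (auto simp: eventually_sequentially)
    obtain \<eta> where \<eta>: "test_fun U \<eta>" "(\<integral>x. (g n x - \<eta> x)\<^sup>2 \<partial>?M) < e / 4"
      using g[of n] e by (auto simp: test_approx_def dest!: spec[of _ "e / 4"])
    note \<eta>2 = test_fun_L2[OF U \<eta>(1)]
    note sq = L2_square_integrable[OF L2_diff[OF f2 g2[of n]]] L2_square_integrable[OF L2_diff[OF g2[of n] \<eta>2]]
    have "(\<integral>x. (f x - \<eta> x)\<^sup>2 \<partial>?M) \<le> (\<integral>x. 2 * (f x - g n x)\<^sup>2 + 2 * (g n x - \<eta> x)\<^sup>2 \<partial>?M)"
    proof (rule integral_mono)
      show "integrable ?M (\<lambda>x. (f x - \<eta> x)\<^sup>2)"
        by (rule L2_square_integrable[OF L2_diff[OF f2 \<eta>2]])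
      show "integrable ?M (\<lambda>x. 2 * (f x - g n x)\<^sup>2 + 2 * (g n x - \<eta> x)\<^sup>2)"
        using sq by simp
      show "(f x - \<eta> x)\<^sup>2 \<le> 2 * (f x - g n x)\<^sup>2 + 2 * (g n x - \<eta> x)\<^sup>2" for x
        using sum_squares_bound[of "f x - g n x" "g n x - \<eta> x"]
        by (simp add: power2_eq_square algebra_simps)
    qed
    also have "\<dots> = 2 * (\<integral>x. (f x - g n x)\<^sup>2 \<partial>?M) + 2 * (\<integral>x. (g n x - \<eta> x)\<^sup>2 \<partial>?M)"
      using sq by simp
    also have "\<dots> < e" using n \<eta>(2) by linarith
    finally show "\<exists>\<eta>. test_fun U \<eta> \<and> (\<integral>x. (f x - \<eta> x)\<^sup>2 \<partial>?M) < e" using \<eta>(1) by blast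
  qed
qed

text \<open>Stone-Weierstrass polynomials are smooth, and multiplication by the fixed cutoff
  \<theta> gives them compact support in U.\<close>

lemma test_approx_continuous_mult:
  assumes U: "open U" "bounded U" and g: "continuous_on UNIV g" and \<theta>: "test_fun U \<theta>"
  shows "test_approx U (\<lambda>x. g x * \<theta> x)"
proof -
  have c: "compact (closure U)" using U by simp
  have "\<exists>p. real_polynomial_function p \<and> (\<forall>x\<in>closure U. \<bar>g x - p x\<bar> < inverse (Suc n))" for n
    using Stone_Weierstrass_real_polynomial_function[OF c continuous_on_subset[OF g], of "inverse (Suc n)"]
    by (metis inverse_positive_iff_positive of_nat_0_less_iff subset_UNIV zero_less_Suc)
  then obtain p where p: "\<And>n. real_polynomial_function (p n)"
    "\<And>n x. x \<in> closure U \<Longrightarrow> \<bar>g x - p n x\<bar> < inverse (Suc n)" by metis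
  obtain B where B: "0 < B" "\<And>x. \<bar>\<theta> x\<bar> \<le> B" using test_fun_bounded[OF \<theta>] by metis
  have "bounded (g ` closure U)"
    by (intro compact_imp_bounded compact_continuous_image continuous_on_subset[OF g] c) auto
  then obtain C where C: "\<And>x. x \<in> closure U \<Longrightarrow> \<bar>g x\<bar> \<le> C" unfolding bounded_iff by auto
  have fin: "finite_measure (lebesgue_on U)" using U by (simp add: finite_measure_lebesgue_on open_lebesgue)
  show ?thesis
  proof (rule test_approx_limit[OF U, where g = "\<lambda>n x. p n x * \<theta> x" and w = "\<lambda>x. (C + 1) * B"])
    show "test_approx U (\<lambda>x. p n x * \<theta> x)" for n
      using test_fun_mult[OF \<theta> smooth_real_polynomial_function[OF p(1)], of n]
      by (intro test_approx_test_fun U) (simp add: mult.commute)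
    show "(\<lambda>x. g x * \<theta> x) \<in> borel_measurable (lebesgue_on U)"
      using borel_measurable_continuous_onI[OF g] smooth_measurable[OF test_fun_smooth[OF \<theta>]]
      by (intro measurable_restrict_space1 measurable_completion) simp
    show "L2 (lebesgue_on U) (\<lambda>x. (C + 1) * B)" by (rule L2_bounded[OF fin, of _ "\<bar>(C + 1) * B\<bar>"]) auto
    have x: "AE x in lebesgue_on U. x \<in> closure U"
      using closure_subset by (intro AE_I2) auto
    show "AE x in lebesgue_on U. (\<lambda>n. p n x * \<theta> x) \<longlonglongrightarrow> g x * \<theta> x"
      using x
    proof eventually_elim
      case (elim x)
      have "(\<lambda>n. p n x - g x) \<longlonglongrightarrow> 0"
        by (rule Lim_null_comparison[OF _ LIMSEQ_inverse_real_of_nat])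
           (use p(2)[OF elim] in \<open>auto simp: abs_minus_commute less_imp_le\<close>)
      then have "(\<lambda>n. p n x) \<longlonglongrightarrow> g x" by (rule LIM_zero_cancel)
      then show ?case by (intro tendsto_intros)
    qed
    show "AE x in lebesgue_on U. \<bar>p n x * \<theta> x\<bar> \<le> (C + 1) * B" for n
      using x
    proof eventually_elim
      case (elim x)
      have "inverse (real (Suc n)) \<le> 1" by (simp add: inverse_le_1_iff)
      then have "\<bar>p n x\<bar> \<le> C + 1" using p(2)[OF elim, of n] C[OF elim] by linarith
      then show ?case using B(2)[of x] by (simp add: abs_mult mult_mono')
    qed
  qed
qed

lemma test_approx_continuous:
  assumes U: "open U" "bounded U" and g: "continuous_on UNIV g" and C: "\<And>x. \<bar>g x\<bar> \<le> C"
  shows "test_approx U g"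
proof -
  obtain \<theta> where \<theta>: "\<And>n::nat. test_fun U (\<theta> n)" "\<And>n x. 0 \<le> \<theta> n x" "\<And>n x. \<theta> n x \<le> 1"
    "AE x in lebesgue. x \<in> U \<longrightarrow> (\<lambda>n. \<theta> n x) \<longlonglongrightarrow> 1"
    by (rule cutoff_sequence[OF U(1)], rule that)
  have fin: "finite_measure (lebesgue_on U)" using U by (simp add: finite_measure_lebesgue_on open_lebesgue)
  show ?thesis
  proof (rule test_approx_limit[OF U, where g = "\<lambda>n x. g x * \<theta> n x" and w = "\<lambda>x. C"])
    show "test_approx U (\<lambda>x. g x * \<theta> n x)" for n by (rule test_approx_continuous_mult[OF U g \<theta>(1)])
    show "g \<in> borel_measurable (lebesgue_on U)"
      using borel_measurable_continuous_onI[OF g] by (intro measurable_restrict_space1 measurable_completion) simp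
    show "L2 (lebesgue_on U) (\<lambda>x. C)" by (rule L2_bounded[OF fin, of _ "\<bar>C\<bar>"]) auto
    have "AE x in lebesgue_on U. (\<lambda>n. \<theta> n x) \<longlonglongrightarrow> 1"
      using \<theta>(4) U(1) by (simp add: AE_lebesgue_on_iff open_lebesgue)
    then show "AE x in lebesgue_on U. (\<lambda>n. g x * \<theta> n x) \<longlonglongrightarrow> g x"
    proof eventually_elim
      case (elim x)
      from tendsto_mult[OF tendsto_const elim, of "g x"] show ?case by simp
    qed
    have "\<bar>g x * \<theta> n x\<bar> \<le> C" for n x
    proof -
      have "\<bar>g x\<bar> * \<theta> n x \<le> \<bar>g x\<bar> * 1" by (rule mult_left_mono[OF \<theta>(3)]) simp
      then show ?thesis using C[of x] \<theta>(2)[of n x] by (simp add: abs_mult)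
    qed
    then show "AE x in lebesgue_on U. \<bar>g x * \<theta> n x\<bar> \<le> C" for n by auto
  qed
qed

definition clip :: "real \<Rightarrow> real \<Rightarrow> real" where
  "clip C t = max (- C) (min C t)"

lemma clip_bound: "0 \<le> C \<Longrightarrow> \<bar>clip C t\<bar> \<le> C"
  and clip_le: "0 \<le> C \<Longrightarrow> \<bar>clip C t\<bar> \<le> \<bar>t\<bar>"
  and clip_id: "\<bar>t\<bar> \<le> C \<Longrightarrow> clip C t = t"
  by (auto simp: clip_def)

lemma continuous_clip: "continuous_on A (clip C)"
  unfolding clip_def[abs_def] by (intro continuous_intros)

lemma measurable_clip [measurable]: "clip C \<in> borel_measurable borel"
  by (intro borel_measurable_continuous_onI continuous_clip)

text \<open>Measurability provides continuous functions converging almost everywhere; clipping them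
  at the bound C of f keeps the limit and supplies a constant majorant.\<close>

lemma test_approx_bounded:
  assumes U: "open U" "bounded U" and f: "f \<in> borel_measurable (lebesgue_on U)" and C: "\<And>x. \<bar>f x\<bar> \<le> C"
  shows "test_approx U f"
proof -
  have "f measurable_on U"
    using f U by (simp add: measurable_on_iff_borel_measurable open_lebesgue)
  then obtain N g where N: "negligible N" and g: "\<And>n. continuous_on UNIV (g n)"
    and lim: "\<And>x. x \<notin> N \<Longrightarrow> (\<lambda>n. g n x) \<longlonglongrightarrow> (if x \<in> U then f x else 0)"
    unfolding measurable_on_def by metis
  have C0: "0 \<le> C" using C[of 0] by linarith
  have fin: "finite_measure (lebesgue_on U)" using U by (simp add: finite_measure_lebesgue_on open_lebesgue)
  show ?thesis
  proof (rule test_approx_limit[OF U, where g = "\<lambda>n x. clip C (g n x)" and w = "\<lambda>x. C"])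
    show "test_approx U (\<lambda>x. clip C (g n x))" for n
      by (rule test_approx_continuous[OF U, of _ C])
         (auto simp: clip_bound C0 intro: continuous_on_compose2[OF continuous_clip[of UNIV] g])
    show "L2 (lebesgue_on U) (\<lambda>x. C)" by (rule L2_bounded[OF fin, of _ "\<bar>C\<bar>"]) auto
    have "AE x in lebesgue. x \<notin> N" using N by (intro AE_not_in) (simp add: negligible_iff_null_sets)
    then have "AE x in lebesgue. x \<in> U \<longrightarrow> (\<lambda>n. clip C (g n x)) \<longlonglongrightarrow> f x"
    proof eventually_elim
      case (elim x)
      show ?case
      proof
        assume "x \<in> U"
        then have "(\<lambda>n. g n x) \<longlonglongrightarrow> f x" using lim[OF elim] by simp
        then have "(\<lambda>n. clip C (g n x)) \<longlonglongrightarrow> clip C (f x)"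
          by (rule continuous_on_tendsto_compose[OF continuous_clip[of UNIV]]) auto
        then show "(\<lambda>n. clip C (g n x)) \<longlonglongrightarrow> f x" using clip_id[OF C] by simp
      qed
    qed
    then show "AE x in lebesgue_on U. (\<lambda>n. clip C (g n x)) \<longlonglongrightarrow> f x"
      using U by (simp add: AE_lebesgue_on_iff open_lebesgue)
    show "AE x in lebesgue_on U. \<bar>clip C (g n x)\<bar> \<le> C" for n by (simp add: clip_bound C0)
  qed (use f in auto)
qed

lemma test_approx_L2:
  assumes U: "open U" "bounded U" and f: "L2 (lebesgue_on U) f"
  shows "test_approx U f"
proof (rule test_approx_limit[OF U, where g = "\<lambda>n x. clip (real n) (f x)" and w = "\<lambda>x. \<bar>f x\<bar>"])
  note [measurable] = L2_measurable[OF f]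
  show "test_approx U (\<lambda>x. clip (real n) (f x))" for n
    by (rule test_approx_bounded[OF U, of _ "real n"]) (auto simp: clip_bound)
  show "L2 (lebesgue_on U) (\<lambda>x. \<bar>f x\<bar>)" by (rule L2_bound[OF f, of _ 1]) auto
  show "AE x in lebesgue_on U. (\<lambda>n. clip (real n) (f x)) \<longlonglongrightarrow> f x"
  proof (rule AE_I2, rule tendsto_eventually)
    fix x
    obtain m :: nat where "\<bar>f x\<bar> \<le> real m" using real_arch_simple by blast
    then show "\<forall>\<^sub>F n in sequentially. clip (real n) (f x) = f x"
      by (auto simp: eventually_sequentially clip_id intro!: exI[of _ m])
  qed
qed (auto simp: clip_le L2_measurable[OF f])

lemma L2_approx_test_fun:
  assumes "open U" "bounded U" "L2 (lebesgue_on U) f" "0 < e"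
  obtains \<eta> where "test_fun U \<eta>" "(\<integral>x. (f x - \<eta> x)\<^sup>2 \<partial>(lebesgue_on U)) < e"
  using test_approx_L2[OF assms(1-3)] assms(4) unfolding test_approx_def by blast

section \<open>Translation invariance of Lebesgue measure\<close>

lemma distr_lebesgue_plus:
  fixes t :: "real^3"
  shows "(+) t \<in> lebesgue \<rightarrow>\<^sub>M lebesgue" "distr lebesgue lebesgue ((+) t) = lebesgue"
proof -
  have T: "(\<lambda>x. t + (\<Sum>j\<in>Basis. (1 * (x \<bullet> j)) *\<^sub>R j)) = (+) t"
    by (auto simp: euclidean_representation)
  show "(+) t \<in> lebesgue \<rightarrow>\<^sub>M lebesgue"
    using lebesgue_affine_measurable[of "\<lambda>_. 1" t] unfolding T by simp
  show "distr lebesgue lebesgue ((+) t) = lebesgue"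
    using lebesgue_affine_euclidean[of "\<lambda>_. 1" t] unfolding T by (simp add: density_1)
qed

lemma lebesgue_translate:
  fixes f :: "real^3 \<Rightarrow> 'b::euclidean_space" and t :: "real^3"
  assumes f: "f \<in> borel_measurable lebesgue"
  shows "(\<lambda>x. f (x + t)) \<in> borel_measurable lebesgue"
    "(\<integral>x. f (x + t) \<partial>lebesgue) = (\<integral>x. f x \<partial>lebesgue)"
    "integrable lebesgue (\<lambda>x. f (x + t)) \<longleftrightarrow> integrable lebesgue f"
proof -
  show "(\<lambda>x. f (x + t)) \<in> borel_measurable lebesgue"
    using measurable_compose[OF distr_lebesgue_plus(1)[of t] f] by (simp add: add.commute)
  have "(\<integral>x. f x \<partial>distr lebesgue lebesgue ((+) t)) = (\<integral>x. f (t + x) \<partial>lebesgue)"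
    by (rule integral_distr[OF distr_lebesgue_plus(1) f])
  then show "(\<integral>x. f (x + t) \<partial>lebesgue) = (\<integral>x. f x \<partial>lebesgue)"
    unfolding distr_lebesgue_plus(2) by (simp add: add.commute)
  have "integrable (distr lebesgue lebesgue ((+) t)) f \<longleftrightarrow> integrable lebesgue (\<lambda>x. f (t + x))"
    by (rule integrable_distr_eq[OF distr_lebesgue_plus(1) f])
  then show "integrable lebesgue (\<lambda>x. f (x + t)) \<longleftrightarrow> integrable lebesgue f"
    unfolding distr_lebesgue_plus(2) by (simp add: add.commute)
qed

subsection \<open>Translations\<close>

lemma lborel_integral_shift:
  fixes f :: "real^3 \<Rightarrow> real"
  shows "(\<integral>x. f (x + t) \<partial>lborel) = (\<integral>x. f x \<partial>lborel)"
    and lborel_integrable_shift: "integrable lborel f \<Longrightarrow> integrable lborel (\<lambda>x. f (x + t))"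
proof -
  have plus: "distr lborel borel (\<lambda>x. x + t) = lborel" for t :: "real^3"
  proof -
    have "(\<lambda>x. x + t) = (+) t" by (auto simp: add.commute)
    then show ?thesis using lborel_distr_plus[of t] by simp
  qed
  have sh: "distr lborel borel (\<lambda>x. x + t) = lborel"
    using plus .
  have i: "integrable lborel (\<lambda>x. f (x + t))" if "integrable lborel f" for f :: "real^3 \<Rightarrow> real" and t
  proof -
    have sh: "distr lborel borel (\<lambda>x. x + t) = lborel"
      using plus .
    have "integrable (distr lborel borel (\<lambda>x. x + t)) f" using that unfolding sh .
    then show ?thesis by (rule integrable_distr[rotated]) simp
  qed
  then show "integrable lborel f \<Longrightarrow> integrable lborel (\<lambda>x. f (x + t))" .
  show "(\<integral>x. f (x + t) \<partial>lborel) = (\<integral>x. f x \<partial>lborel)"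
  proof (cases "integrable lborel f")
    case True
    then have [measurable]: "f \<in> borel_measurable borel" by auto
    have "(\<integral>x. f x \<partial>distr lborel borel (\<lambda>x. x + t)) = (\<integral>x. f (x + t) \<partial>lborel)"
      by (rule integral_distr) auto
    then show ?thesis unfolding sh by simp
  next
    case False
    then have "\<not> integrable lborel (\<lambda>x. f (x + t))"
      using i[of "\<lambda>x. f (x + t)" "- t"] by auto
    then show ?thesis using False by (simp add: not_integrable_integral_eq)
  qed
qed

text \<open>A weighted average of translates of g along a parametrised curve \<sigma>: segments give
  the integral of a derivative along a line, square loops give circulations. The substitution x -
  \<sigma> s carries the average over to the test function. The setting is that of Borel functions
  and \<open>lborel\<close>, since Fubini needs measurability on the product of the two
  measures.\<close>

lemma shift_fubini:
  fixes g \<zeta> :: "real^3 \<Rightarrow> real" and w :: "real \<Rightarrow> real" and \<sigma> :: "real \<Rightarrow> real^3"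
  assumes g: "integrable lborel g" and w: "integrable lborel w"
    and \<sigma> [measurable]: "\<sigma> \<in> borel_measurable borel"
    and \<zeta> [measurable]: "\<zeta> \<in> borel_measurable borel" and B: "\<And>x. \<bar>\<zeta> x\<bar> \<le> B"
  shows shift_fubini_AE: "AE x in lborel. integrable lborel (\<lambda>s. w s * g (x + \<sigma> s))"
    and shift_fubini_integrable: "integrable lborel (\<lambda>x. \<integral>s. w s * g (x + \<sigma> s) \<partial>lborel)"
    and shift_fubini_integrable': "integrable lborel (\<lambda>s. w s * (\<integral>x. \<zeta> x * g (x + \<sigma> s) \<partial>lborel))"
    and shift_fubini_swap: "(\<integral>x. \<zeta> x * (\<integral>s. w s * g (x + \<sigma> s) \<partial>lborel) \<partial>lborel)
        = (\<integral>s. w s * (\<integral>x. \<zeta> x * g (x + \<sigma> s) \<partial>lborel) \<partial>lborel)"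
    and shift_fubini_eq: "(\<integral>x. \<zeta> x * (\<integral>s. w s * g (x + \<sigma> s) \<partial>lborel) \<partial>lborel)
        = (\<integral>x. g x * (\<integral>s. w s * \<zeta> (x - \<sigma> s) \<partial>lborel) \<partial>lborel)"
proof -
  have [measurable]: "g \<in> borel_measurable borel" "w \<in> borel_measurable borel" using g w by auto
  have bnd: "integrable lborel (\<lambda>x. \<xi> x * f x)"
    if "integrable lborel f" "\<xi> \<in> borel_measurable borel" "\<And>x. \<bar>\<xi> x\<bar> \<le> C" for f \<xi> :: "real^3 \<Rightarrow> real" and C
  proof (rule Bochner_Integration.integrable_bound[of _ "\<lambda>x. C * f x"])
    show "(\<lambda>x. \<xi> x * f x) \<in> borel_measurable lborel" using that by simp
    have "norm (\<xi> x * f x) \<le> norm (C * f x)" for x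
      using mult_right_mono[OF that(3)[of x] abs_ge_zero[of "f x"]] that(3)[of x]
      by (simp add: abs_mult)
    then show "AE x in lborel. norm (\<xi> x * f x) \<le> norm (C * f x)" by auto
  qed (use that in simp)
  have F: "integrable (lborel \<Otimes>\<^sub>M lborel) (\<lambda>(s, x). w s * (\<xi> x * g (x + \<sigma> s)))"
    if [measurable]: "\<xi> \<in> borel_measurable borel" and C: "\<And>x. \<bar>\<xi> x\<bar> \<le> C" for \<xi> C
  proof (rule lborel_pair.Fubini_integrable)
    show "(\<lambda>(s, x). w s * (\<xi> x * g (x + \<sigma> s))) \<in> borel_measurable (lborel \<Otimes>\<^sub>M lborel)"
      by measurable
    have i: "integrable lborel (\<lambda>x. \<xi> x * g (x + \<sigma> s))" for s
      by (rule bnd[OF lborel_integrable_shift[OF g] _ C]) simp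
    show "AE s in lborel. integrable lborel (\<lambda>x. case (s, x) of (s, x) \<Rightarrow> w s * (\<xi> x * g (x + \<sigma> s)))"
      using i by simp
    show "integrable lborel (\<lambda>s. \<integral>x. norm (case (s, x) of (s, x) \<Rightarrow> w s * (\<xi> x * g (x + \<sigma> s))) \<partial>lborel)"
    proof (rule Bochner_Integration.integrable_bound[of _ "\<lambda>s. w s * (C * (\<integral>x. \<bar>g x\<bar> \<partial>lborel))"])
      show "(\<lambda>s. \<integral>x. norm (case (s, x) of (s, x) \<Rightarrow> w s * (\<xi> x * g (x + \<sigma> s))) \<partial>lborel) \<in> borel_measurable lborel"
        by measurable
      have C0: "0 \<le> C" using C[of 0] by linarith
      have "(\<integral>x. \<bar>\<xi> x * g (x + \<sigma> s)\<bar> \<partial>lborel) \<le> C * (\<integral>x. \<bar>g x\<bar> \<partial>lborel)" for s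
      proof -
        have "(\<integral>x. \<bar>\<xi> x * g (x + \<sigma> s)\<bar> \<partial>lborel) \<le> (\<integral>x. C * \<bar>g (x + \<sigma> s)\<bar> \<partial>lborel)"
        proof (rule integral_mono)
          show "integrable lborel (\<lambda>x. \<bar>\<xi> x * g (x + \<sigma> s)\<bar>)" by (rule integrable_abs[OF i])
          show "integrable lborel (\<lambda>x. C * \<bar>g (x + \<sigma> s)\<bar>)"
            using lborel_integrable_shift[OF g, of "\<sigma> s"] by simp
        qed (use C in \<open>auto simp: abs_mult intro!: mult_right_mono\<close>)
        also have "\<dots> = C * (\<integral>x. \<bar>g x\<bar> \<partial>lborel)"
          using lborel_integral_shift[of "\<lambda>x. \<bar>g x\<bar>" "\<sigma> s"] by simp
        finally show ?thesis .
      qed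
      then have "norm (\<integral>x. norm (case (s, x) of (s, x) \<Rightarrow> w s * (\<xi> x * g (x + \<sigma> s))) \<partial>lborel)
          \<le> norm (w s * (C * (\<integral>x. \<bar>g x\<bar> \<partial>lborel)))" for s
      proof -
        assume *: "\<And>s. (\<integral>x. \<bar>\<xi> x * g (x + \<sigma> s)\<bar> \<partial>lborel) \<le> C * (\<integral>x. \<bar>g x\<bar> \<partial>lborel)"
        have "(\<integral>x. norm (case (s, x) of (s, x) \<Rightarrow> w s * (\<xi> x * g (x + \<sigma> s))) \<partial>lborel)
          = \<bar>w s\<bar> * (\<integral>x. \<bar>\<xi> x * g (x + \<sigma> s)\<bar> \<partial>lborel)"
          by (simp add: abs_mult)
        then show ?thesis
          using mult_left_mono[OF *[of s] abs_ge_zero[of "w s"]] C0 by (simp add: abs_mult integral_nonneg)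
      qed
      then show "AE s in lborel. norm (\<integral>x. norm (case (s, x) of (s, x) \<Rightarrow> w s * (\<xi> x * g (x + \<sigma> s))) \<partial>lborel)
          \<le> norm (w s * (C * (\<integral>x. \<bar>g x\<bar> \<partial>lborel)))" by auto
    qed (use w in simp)
  qed
  have F1: "integrable (lborel \<Otimes>\<^sub>M lborel) (\<lambda>(s, x). w s * g (x + \<sigma> s))"
    using F[of "\<lambda>x. 1" 1] by simp
  show "AE x in lborel. integrable lborel (\<lambda>s. w s * g (x + \<sigma> s))"
    using lborel_pair.AE_integrable_snd[OF F1] by simp
  show "integrable lborel (\<lambda>x. \<integral>s. w s * g (x + \<sigma> s) \<partial>lborel)"
    using lborel_pair.integrable_snd[OF F1] by simp
  show "integrable lborel (\<lambda>s. w s * (\<integral>x. \<zeta> x * g (x + \<sigma> s) \<partial>lborel))"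
    using lborel_pair.integrable_fst'[OF F[OF \<zeta> B]] by simp
  have "(\<integral>x. (\<integral>s. w s * (\<zeta> x * g (x + \<sigma> s)) \<partial>lborel) \<partial>lborel) = (\<integral>s. (\<integral>x. w s * (\<zeta> x * g (x + \<sigma> s)) \<partial>lborel) \<partial>lborel)"
    by (rule lborel_pair.Fubini_integral[OF F[OF \<zeta> B]])
  moreover have "(\<integral>s. w s * (\<zeta> x * g (x + \<sigma> s)) \<partial>lborel) = \<zeta> x * (\<integral>s. w s * g (x + \<sigma> s) \<partial>lborel)" for x
    by (subst integral_mult_right_zero[symmetric]) (simp add: ac_simps)
  ultimately show 1: "(\<integral>x. \<zeta> x * (\<integral>s. w s * g (x + \<sigma> s) \<partial>lborel) \<partial>lborel)
        = (\<integral>s. w s * (\<integral>x. \<zeta> x * g (x + \<sigma> s) \<partial>lborel) \<partial>lborel)" by simp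
  \<comment> \<open>After translation by \<sigma> s the inner integrals of absolute values coincide
    with those treated in \<open>F\<close>, so integrability is inherited.\<close>
  have G: "integrable (lborel \<Otimes>\<^sub>M lborel) (\<lambda>(s, x). w s * (\<zeta> (x - \<sigma> s) * g x))"
  proof (rule lborel_pair.Fubini_integrable)
    show "(\<lambda>(s, x). w s * (\<zeta> (x - \<sigma> s) * g x)) \<in> borel_measurable (lborel \<Otimes>\<^sub>M lborel)"
      by measurable
    have i: "integrable lborel (\<lambda>x. \<zeta> (x - \<sigma> s) * g x)" for s
      by (rule bnd[OF g _ B]) simp
    show "AE s in lborel. integrable lborel (\<lambda>x. case (s, x) of (s, x) \<Rightarrow> w s * (\<zeta> (x - \<sigma> s) * g x))"
      using i by simp
    have "(\<lambda>s. \<integral>x. norm (case (s, x) of (s, x) \<Rightarrow> w s * (\<zeta> (x - \<sigma> s) * g x)) \<partial>lborel)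
      = (\<lambda>s. \<integral>x. norm (case (s, x) of (s, x) \<Rightarrow> w s * (\<zeta> x * g (x + \<sigma> s))) \<partial>lborel)"
    proof
      fix s
      show "(\<integral>x. norm (case (s, x) of (s, x) \<Rightarrow> w s * (\<zeta> (x - \<sigma> s) * g x)) \<partial>lborel)
        = (\<integral>x. norm (case (s, x) of (s, x) \<Rightarrow> w s * (\<zeta> x * g (x + \<sigma> s))) \<partial>lborel)"
        using lborel_integral_shift[of "\<lambda>x. \<bar>w s * (\<zeta> (x - \<sigma> s) * g x)\<bar>" "\<sigma> s"] by simp
    qed
    moreover have "integrable lborel (\<lambda>s. \<integral>x. norm (case (s, x) of (s, x) \<Rightarrow> w s * (\<zeta> x * g (x + \<sigma> s))) \<partial>lborel)"
      using lborel_pair.integrable_fst'[OF integrable_norm[OF F[OF \<zeta> B]]] by (simp add: case_prod_unfold)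
    ultimately show "integrable lborel (\<lambda>s. \<integral>x. norm (case (s, x) of (s, x) \<Rightarrow> w s * (\<zeta> (x - \<sigma> s) * g x)) \<partial>lborel)"
      by simp
  qed
  have "(\<integral>x. (\<integral>s. w s * (\<zeta> (x - \<sigma> s) * g x) \<partial>lborel) \<partial>lborel) = (\<integral>s. (\<integral>x. w s * (\<zeta> (x - \<sigma> s) * g x) \<partial>lborel) \<partial>lborel)"
    by (rule lborel_pair.Fubini_integral[OF G])
  moreover have "(\<integral>s. w s * (\<zeta> (x - \<sigma> s) * g x) \<partial>lborel) = g x * (\<integral>s. w s * \<zeta> (x - \<sigma> s) \<partial>lborel)" for x
    by (subst integral_mult_right_zero[symmetric]) (simp add: ac_simps)
  moreover have "(\<integral>x. \<zeta> (x - \<sigma> s) * g x \<partial>lborel) = (\<integral>x. \<zeta> x * g (x + \<sigma> s) \<partial>lborel)" for s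
    using lborel_integral_shift[of "\<lambda>x. \<zeta> (x - \<sigma> s) * g x" "\<sigma> s"] by simp
  ultimately show "(\<integral>x. \<zeta> x * (\<integral>s. w s * g (x + \<sigma> s) \<partial>lborel) \<partial>lborel)
        = (\<integral>x. g x * (\<integral>s. w s * \<zeta> (x - \<sigma> s) \<partial>lborel) \<partial>lborel)"
    unfolding 1 by simp
qed

text \<open>Pointwise |t| \<le> t^2 / (2 \<kappa>) + \<kappa> / 2, so an L2 approximation controls
  the L1 distance on a set of measure m; \<kappa> is chosen with \<kappa> m < e, which keeps the
  constant term below e / 2.\<close>

lemma L1_approx_test_fun:
  fixes G :: "real^3 \<Rightarrow> real"
  assumes U: "open U" "bounded U" and G: "L2 (lebesgue_on U) G" and e: "0 < e"
  obtains \<eta> where "test_fun U \<eta>" "(\<integral>x. \<bar>G x - \<eta> x\<bar> \<partial>(lebesgue_on U)) < e"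
proof -
  let ?M = "lebesgue_on U"
  interpret finite_measure ?M using U by (simp add: finite_measure_lebesgue_on open_lebesgue)
  define m where "m = measure ?M (space ?M)"
  have m: "0 \<le> m" by (simp add: m_def)
  define \<kappa> where "\<kappa> = e / (m + 1)"
  have \<kappa>: "0 < \<kappa>" "\<kappa> * m < e" using e m by (auto simp: \<kappa>_def field_simps)
  obtain \<eta> where \<eta>: "test_fun U \<eta>" "(\<integral>x. (G x - \<eta> x)\<^sup>2 \<partial>?M) < \<kappa> * e"
    using L2_approx_test_fun[OF U G, of "\<kappa> * e"] \<kappa>(1) e by auto
  have d: "L2 ?M (\<lambda>x. G x - \<eta> x)" by (intro L2_diff G test_fun_L2[OF U \<eta>(1)])
  have "(\<integral>x. \<bar>G x - \<eta> x\<bar> \<partial>?M) \<le> (\<integral>x. (G x - \<eta> x)\<^sup>2 / (2 * \<kappa>) + \<kappa> / 2 \<partial>?M)"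
  proof (rule integral_mono)
    show "integrable ?M (\<lambda>x. \<bar>G x - \<eta> x\<bar>)"
      using L2_integrable_finite[OF d] finite_measure_axioms by simp
    show "integrable ?M (\<lambda>x. (G x - \<eta> x)\<^sup>2 / (2 * \<kappa>) + \<kappa> / 2)"
      using L2_square_integrable[OF d] by simp
    fix x
    have "0 \<le> (\<bar>G x - \<eta> x\<bar> - \<kappa>)\<^sup>2 / (2 * \<kappa>)" using \<kappa> by simp
    also have "\<dots> = (G x - \<eta> x)\<^sup>2 / (2 * \<kappa>) + \<kappa> / 2 - \<bar>G x - \<eta> x\<bar>"
      using \<kappa> by (simp add: power2_diff field_simps power2_eq_square)
    finally show "\<bar>G x - \<eta> x\<bar> \<le> (G x - \<eta> x)\<^sup>2 / (2 * \<kappa>) + \<kappa> / 2" by simp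
  qed
  also have "\<dots> = (\<integral>x. (G x - \<eta> x)\<^sup>2 \<partial>?M) / (2 * \<kappa>) + m * (\<kappa> / 2)"
    using L2_square_integrable[OF d] by (simp add: m_def)
  also have "\<dots> < (\<kappa> * e) / (2 * \<kappa>) + e / 2"
    using \<eta>(2) \<kappa> by (intro add_strict_mono divide_strict_right_mono) (auto simp: mult.commute)
  also have "\<dots> = e" using \<kappa> by simp
  finally show ?thesis using that \<eta>(1) by blast
qed

lemma integral_lebesgue_on_indicator:
  fixes f :: "real^3 \<Rightarrow> real"
  assumes "U \<in> sets lebesgue" "\<And>x. x \<notin> U \<Longrightarrow> f x = 0"
  shows "(\<integral>x. f x \<partial>(lebesgue_on U)) = (\<integral>x. f x \<partial>lebesgue)"
    "integrable (lebesgue_on U) f \<longleftrightarrow> integrable lebesgue f"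
proof -
  have *: "(\<lambda>x. indicator U x *\<^sub>R f x) = f" by (rule ext) (use assms(2) in \<open>auto simp: indicator_def\<close>)
  show "(\<integral>x. f x \<partial>(lebesgue_on U)) = (\<integral>x. f x \<partial>lebesgue)"
    unfolding integral_lebesgue_on[OF assms(1), symmetric] set_lebesgue_integral_def * ..
  show "integrable (lebesgue_on U) f \<longleftrightarrow> integrable lebesgue f"
    unfolding integrable_lebesgue_on_iff[OF assms(1), symmetric] set_integrable_def * ..
qed

lemma test_fun_integrable:
  assumes "test_fun U \<eta>"
  shows "integrable lebesgue \<eta>"
proof -
  have "Lp_loc 1 UNIV (\<lambda>x::real^3. 1::real)"
    unfolding Lp_loc_1_iff set_integrable_def
    using lmeasurable_compact by (auto simp: lmeasurable_iff_integrable)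
  from test_integrable[OF this test_fun_mono[OF assms]] show ?thesis by simp
qed

text \<open>Approximation by a test function, whose translates converge by dominated convergence.
  The approximation error appears twice because integrals are translation invariant, hence the
  shares e / 4 + e / 2 + e / 4.\<close>

lemma translation_continuous_L1:
  fixes G :: "real^3 \<Rightarrow> real"
  assumes U: "open U" "bounded U" and G: "L2 (lebesgue_on U) G" and 0: "\<And>x. x \<notin> U \<Longrightarrow> G x = 0"
    and v: "v \<longlonglongrightarrow> (0 :: real^3)"
  shows "(\<lambda>n::nat. \<integral>x. \<bar>G (x + v n) - G x\<bar> \<partial>lebesgue) \<longlonglongrightarrow> 0"
proof (rule LIMSEQ_I)
  fix e :: real assume e: "0 < e"
  have UL: "U \<in> sets lebesgue" using U by (simp add: open_lebesgue)
  obtain \<eta> where \<eta>: "test_fun U \<eta>" "(\<integral>x. \<bar>G x - \<eta> x\<bar> \<partial>(lebesgue_on U)) < e / 4"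
    using L1_approx_test_fun[OF U G, of "e / 4"] e by auto
  obtain K where K: "compact K" "K \<subseteq> U" "\<And>x. x \<notin> K \<Longrightarrow> \<eta> x = 0"
    using \<eta>(1) unfolding test_fun_iff by blast
  obtain B where B: "\<And>x. \<bar>\<eta> x\<bar> \<le> B" using test_fun_bounded[OF \<eta>(1)] by metis
  have \<eta>i: "integrable lebesgue \<eta>" by (rule test_fun_integrable[OF \<eta>(1)])
  have "integrable (lebesgue_on U) G"
    using L2_integrable_finite[OF G] finite_measure_lebesgue_on[OF UL U(2)] by simp
  then have Gi: "integrable lebesgue G" using integral_lebesgue_on_indicator(2)[OF UL 0] by simp
  have G\<eta>: "(\<integral>x. \<bar>G x - \<eta> x\<bar> \<partial>lebesgue) < e / 4"
    using \<eta>(2) integral_lebesgue_on_indicator(1)[OF UL, of "\<lambda>x. \<bar>G x - \<eta> x\<bar>"] 0 K by (metis (no_types, lifting) abs_zero diff_self subsetD)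
  obtain R where R: "0 < R" "\<And>x. x \<in> K \<Longrightarrow> norm x \<le> R"
    using compact_imp_bounded[OF K(1)] unfolding bounded_pos by auto
  obtain V where V: "0 < V" "\<And>n. norm (v n) \<le> V"
    using convergent_imp_Bseq[of v] v unfolding convergent_def Bseq_def by auto
  have "(\<lambda>n. \<integral>x. \<bar>\<eta> (x + v n) - \<eta> x\<bar> \<partial>lebesgue) \<longlonglongrightarrow> (\<integral>x. 0 \<partial>(lebesgue :: (real^3) measure))"
  proof (rule integral_dominated_convergence[where w = "\<lambda>x. 2 * B * indicator (cball 0 (R + V)) x"])
    show "integrable lebesgue (\<lambda>x::real^3. 2 * B * indicator (cball 0 (R + V)) x)"
      using lmeasurable_cball[of "0::real^3" "R + V"] by (intro integrable_mult_right) (simp add: lmeasurable_iff_integrable)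
    have c: "continuous_on UNIV \<eta>" using \<eta>(1) by (intro smooth_continuous test_fun_smooth)
    have "(\<lambda>n. \<bar>\<eta> (x + v n) - \<eta> x\<bar>) \<longlonglongrightarrow> 0" for x
    proof -
      have "(\<lambda>n. x + v n) \<longlonglongrightarrow> x + 0" by (intro tendsto_intros v)
      then have "(\<lambda>n. \<eta> (x + v n)) \<longlonglongrightarrow> \<eta> x"
        using continuous_on_tendsto_compose[OF c, of "\<lambda>n. x + v n" x sequentially] by simp
      from tendsto_rabs[OF tendsto_diff[OF this tendsto_const[of "\<eta> x"]]] show ?thesis by simp
    qed
    then show "AE x in lebesgue. (\<lambda>n. \<bar>\<eta> (x + v n) - \<eta> x\<bar>) \<longlonglongrightarrow> 0" by auto
    have "norm \<bar>\<eta> (x + v n) - \<eta> x\<bar> \<le> 2 * B * indicator (cball 0 (R + V)) x" for n x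
    proof (cases "norm x \<le> R + V")
      case True
      have "\<bar>\<eta> (x + v n) - \<eta> x\<bar> \<le> 2 * B"
        using B[of x] B[of "x + v n"] by linarith
      then show ?thesis using True by simp
    next
      case False
      have "norm x \<le> norm (x + v n) + V"
        using norm_triangle_ineq4[of "x + v n" "v n"] V(2)[of n] by simp
      then have "x \<notin> K" "x + v n \<notin> K" using R(2)[of x] R(2)[of "x + v n"] V(1) False by auto
      then show ?thesis using False K(3) by simp
    qed
    then show "AE x in lebesgue. norm \<bar>\<eta> (x + v n) - \<eta> x\<bar> \<le> 2 * B * indicator (cball 0 (R + V)) x" for n by auto
    show "(\<lambda>x. \<bar>\<eta> (x + v n) - \<eta> x\<bar>) \<in> borel_measurable lebesgue" for n
      using lebesgue_translate(1)[of \<eta> "v n"] \<eta>i by (intro borel_measurable_abs borel_measurable_diff) auto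
  qed auto
  then have "(\<lambda>n. \<integral>x. \<bar>\<eta> (x + v n) - \<eta> x\<bar> \<partial>lebesgue) \<longlonglongrightarrow> 0" by simp
  from LIMSEQ_D[OF this, of "e / 2"] e obtain N where N: "\<And>n. n \<ge> N \<Longrightarrow> (\<integral>x. \<bar>\<eta> (x + v n) - \<eta> x\<bar> \<partial>lebesgue) < e / 2"
    by fastforce
  have "norm ((\<integral>x. \<bar>G (x + v n) - G x\<bar> \<partial>lebesgue) - 0) < e" if "n \<ge> N" for n
  proof -
    have i: "integrable lebesgue (\<lambda>x. G (x + v n))" "integrable lebesgue (\<lambda>x. \<eta> (x + v n))"
      using lebesgue_translate(3)[of G "v n"] lebesgue_translate(3)[of \<eta> "v n"] Gi \<eta>i by auto
    have "(\<integral>x. \<bar>G (x + v n) - G x\<bar> \<partial>lebesgue)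
      \<le> (\<integral>x. \<bar>G (x + v n) - \<eta> (x + v n)\<bar> + \<bar>\<eta> (x + v n) - \<eta> x\<bar> + \<bar>G x - \<eta> x\<bar> \<partial>lebesgue)"
      using i Gi \<eta>i by (intro integral_mono) auto
    also have "\<dots> = (\<integral>x. \<bar>G (x + v n) - \<eta> (x + v n)\<bar> \<partial>lebesgue) + (\<integral>x. \<bar>\<eta> (x + v n) - \<eta> x\<bar> \<partial>lebesgue) + (\<integral>x. \<bar>G x - \<eta> x\<bar> \<partial>lebesgue)"
      using i Gi \<eta>i by simp
    also have "(\<integral>x. \<bar>G (x + v n) - \<eta> (x + v n)\<bar> \<partial>lebesgue) = (\<integral>x. \<bar>G x - \<eta> x\<bar> \<partial>lebesgue)"
      using Gi \<eta>i by (intro lebesgue_translate(2)[of "\<lambda>x. \<bar>G x - \<eta> x\<bar>"]) auto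
    finally have "(\<integral>x. \<bar>G (x + v n) - G x\<bar> \<partial>lebesgue) < e"
      using G\<eta> N[OF that] by linarith
    then show ?thesis by simp
  qed
  then show "\<exists>N. \<forall>n\<ge>N. norm ((\<integral>x. \<bar>G (x + v n) - G x\<bar> \<partial>lebesgue) - 0) < e" by blast
qed

subsection \<open>Chain rule for weak gradients\<close>

text \<open>Supplies the Borel functions that \<open>shift_fubini\<close> works with.\<close>

lemma borel_representative:
  fixes f :: "real^3 \<Rightarrow> real"
  assumes "integrable lebesgue f"
  obtains f' where "f' \<in> borel_measurable borel" "integrable lborel f'" "AE x in lborel. f x = f' x"
proof -
  obtain f' where f': "f' \<in> borel_measurable lborel" "AE x in lborel. f x = f' x"
    using completion_ex_borel_measurable_real[of f lborel] assms by auto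
  have "integrable lebesgue f'"
    using AE_completion[OF f'(2)] measurable_completion[OF f'(1)]
    by (intro integrable_cong_AE_imp[OF assms]) (auto elim: eventually_mono)
  then have "integrable lborel f'" using integrable_completion[OF f'(1)] by simp
  then show ?thesis using that f' by simp
qed

lemma slide_lborel:
  assumes "continuous_on UNIV f"
  shows "slide i h f x = (\<integral>s. indicator {0..h} s * f (x - s *\<^sub>R axis i 1) \<partial>lborel)"
proof -
  have "continuous_on {0..h} (\<lambda>s. f (x - s *\<^sub>R axis i 1))"
    by (rule continuous_on_compose2[OF assms]) (auto intro!: continuous_intros)
  then have "set_integrable lborel {0..h} (\<lambda>s. f (x - s *\<^sub>R axis i 1))"
    by (rule borel_integrable_atLeastAtMost')
  from set_borel_integral_eq_integral(2)[OF this] show ?thesis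
    by (simp add: slide_def set_lebesgue_integral_def)
qed

lemma integrable_lborel_mult_bounded:
  fixes f \<xi> :: "'a::euclidean_space \<Rightarrow> real"
  assumes f: "integrable lborel f" and m: "\<xi> \<in> borel_measurable borel" and C: "\<And>x. \<bar>\<xi> x\<bar> \<le> C"
  shows "integrable lborel (\<lambda>x. \<xi> x * f x)"
proof (rule Bochner_Integration.integrable_bound[of _ "\<lambda>x. C * f x"])
  show "(\<lambda>x. \<xi> x * f x) \<in> borel_measurable lborel" using f m by simp
  have "norm (\<xi> x * f x) \<le> norm (C * f x)" for x
    using mult_right_mono[OF C[of x] abs_ge_zero[of "f x"]] C[of x] by (simp add: abs_mult)
  then show "AE x in lborel. norm (\<xi> x * f x) \<le> norm (C * f x)" by auto
qed (use f in simp)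

lemma integrable_indicator_Icc: "integrable lborel (indicator {a..b::real} :: real \<Rightarrow> real)"
  by (simp add: integrable_indicator_iff emeasure_lborel_Icc_eq)

text \<open>The fundamental theorem of calculus along segments for weak derivatives. Tested with
  \<psi>, increments of u and segment integrals of g move to \<psi>; the latter become
  \<open>slide i h \<psi>\<close>, a test function in U by \<open>sub\<close>, and its i-th
  derivative is exactly the difference of \<psi> and its translate. The fundamental lemma removes
  \<psi>.\<close>

lemma difference_quotient_AE:
  fixes u g :: "real^3 \<Rightarrow> real"
  assumes u: "integrable lborel u" and g: "integrable lborel g"
    and wd: "\<And>\<psi>. test_fun U \<psi> \<Longrightarrow> (\<integral>x. u x * partial i \<psi> x \<partial>lborel) = - (\<integral>x. g x * \<psi> x \<partial>lborel)"
    and V: "open V" and h: "0 \<le> h" and sub: "\<And>x s. x \<in> V \<Longrightarrow> 0 \<le> s \<Longrightarrow> s \<le> h \<Longrightarrow> x + s *\<^sub>R axis i 1 \<in> U"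
  shows "AE x in lebesgue. x \<in> V \<longrightarrow>
    u (x + h *\<^sub>R axis i 1) - u x - (\<integral>s. indicator {0..h} s * g (x + s *\<^sub>R axis i 1) \<partial>lborel) = 0"
    (is "AE x in lebesgue. x \<in> V \<longrightarrow> ?f x = 0")
proof (rule fundamental_lemma[OF V])
  let ?W = "\<lambda>x. \<integral>s. indicator {0..h} s * g (x + s *\<^sub>R axis i 1) \<partial>lborel"
  have \<sigma>: "(\<lambda>s. s *\<^sub>R axis i 1 :: real^3) \<in> borel_measurable borel" by measurable
  have W: "integrable lborel ?W"
    by (rule shift_fubini_integrable[OF g integrable_indicator_Icc \<sigma>, of "\<lambda>x. 1" 1]) auto
  have us: "integrable lborel (\<lambda>x. u (x + h *\<^sub>R axis i 1))" by (rule lborel_integrable_shift[OF u])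
  have f: "integrable lborel ?f" using us u W by simp
  then have fb: "?f \<in> borel_measurable borel" by auto
  have fl: "integrable lebesgue ?f" using f integrable_completion[of ?f lborel] by simp
  show "Lp_loc 1 V ?f"
    unfolding Lp_loc_1_iff set_integrable_def
    using fl by (auto intro!: integrable_mult_indicator simp: compact_lebesgue simp del: real_scaleR_def)
  fix \<psi> assume t: "test_fun V \<psi>"
  have sm: "smooth \<psi>" using t by (rule test_fun_smooth)
  have pm: "\<psi> \<in> borel_measurable borel" using sm by (rule smooth_measurable)
  have pm2: "(\<lambda>x. \<psi> (x - h *\<^sub>R axis i 1)) \<in> borel_measurable borel" using pm by measurable
  obtain B where B: "\<And>x. \<bar>\<psi> x\<bar> \<le> B" using test_fun_bounded[OF t] by metis
  obtain K where K: "compact K" "K \<subseteq> V" "\<And>x. x \<notin> K \<Longrightarrow> \<psi> x = 0"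
    using t unfolding test_fun_iff by blast
  have ts: "test_fun U (slide i h \<psi>)"
    by (rule test_fun_slide[OF t K(1,3)]) (use K sub in auto)
  have "(\<integral>x. ?f x * \<psi> x \<partial>lebesgue) = (\<integral>x. \<psi> x * ?f x \<partial>lborel)"
    using integral_completion[of "\<lambda>x. ?f x * \<psi> x" lborel] fb pm by (simp add: mult.commute)
  also have "\<dots> = (\<integral>x. \<psi> x * u (x + h *\<^sub>R axis i 1) - \<psi> x * u x - \<psi> x * ?W x \<partial>lborel)"
    by (simp add: right_diff_distrib)
  also have "\<dots> = (\<integral>x. \<psi> x * u (x + h *\<^sub>R axis i 1) \<partial>lborel) - (\<integral>x. \<psi> x * u x \<partial>lborel) - (\<integral>x. \<psi> x * ?W x \<partial>lborel)"
    using integrable_lborel_mult_bounded[OF us pm B] integrable_lborel_mult_bounded[OF u pm B]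
      integrable_lborel_mult_bounded[OF W pm B] by simp
  also have "(\<integral>x. \<psi> x * u (x + h *\<^sub>R axis i 1) \<partial>lborel) = (\<integral>x. \<psi> (x - h *\<^sub>R axis i 1) * u x \<partial>lborel)"
    using lborel_integral_shift[of "\<lambda>x. \<psi> (x - h *\<^sub>R axis i 1) * u x" "h *\<^sub>R axis i 1"] by simp
  also have "(\<integral>x. \<psi> x * ?W x \<partial>lborel) = (\<integral>x. g x * slide i h \<psi> x \<partial>lborel)"
    using shift_fubini_eq[OF g integrable_indicator_Icc \<sigma> pm B, of 0 h]
    by (simp add: slide_lborel[OF smooth_continuous[OF sm]])
  also have "\<dots> = - (\<integral>x. u x * partial i (slide i h \<psi>) x \<partial>lborel)"
    using wd[OF ts] by simp
  also have "\<dots> = - (\<integral>x. \<psi> x * u x - \<psi> (x - h *\<^sub>R axis i 1) * u x \<partial>lborel)"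
    by (simp add: partial_slide[OF sm] slide_partial[OF sm h] algebra_simps)
  also have "\<dots> = - ((\<integral>x. \<psi> x * u x \<partial>lborel) - (\<integral>x. \<psi> (x - h *\<^sub>R axis i 1) * u x \<partial>lborel))"
    using integrable_lborel_mult_bounded[OF u pm B]
      integrable_lborel_mult_bounded[OF u pm2 B] by simp
  finally show "(\<integral>x. ?f x * \<psi> x \<partial>lebesgue) = 0" by simp
qed

text \<open>The value D fills the gap of the difference quotient, as the sequence may hit a.\<close>

lemma slope_tendsto:
  fixes F :: "real \<Rightarrow> real"
  assumes F: "(F has_real_derivative D) (at a)" and t: "t \<longlonglongrightarrow> a"
  shows "(\<lambda>n. if t n = a then D else (F (t n) - F a) / (t n - a)) \<longlonglongrightarrow> D"
proof -
  define q where "q y = (if y = a then D else (F y - F a) / (y - a))" for y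
  have "((\<lambda>y. (F y - F a) / (y - a)) \<longlongrightarrow> D) (at a)"
    using F by (simp add: has_field_derivative_iff)
  then have "(q \<longlongrightarrow> D) (at a)"
    by (rule Lim_transform_eventually) (auto simp: q_def eventually_at_filter)
  then have "isCont q a" by (simp add: isCont_def q_def)
  from isCont_tendsto_compose[OF this t] show ?thesis by (simp add: q_def)
qed

text \<open>The sequential statement made uniform by contradiction; uniformity in v is wanted
  because shifts will range over a whole segment.\<close>

lemma translation_uniform_L1:
  fixes G :: "real^3 \<Rightarrow> real"
  assumes U: "open U" "bounded U" and G: "L2 (lebesgue_on U) G" and 0: "\<And>x. x \<notin> U \<Longrightarrow> G x = 0"
    and e: "0 < e"
  obtains d where "0 < d" "\<And>v. norm v < d \<Longrightarrow> (\<integral>x. \<bar>G (x + v) - G x\<bar> \<partial>lebesgue) < e"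
proof (rule ccontr)
  note th = that
  assume nt: "\<not> thesis"
  have *: "\<exists>v. norm v < d \<and> e \<le> (\<integral>x. \<bar>G (x + v) - G x\<bar> \<partial>lebesgue)" if d0: "0 < d" for d
    using th[OF d0] nt by (meson not_less)
  have "\<exists>v. norm v < inverse (Suc n) \<and> e \<le> (\<integral>x. \<bar>G (x + v) - G x\<bar> \<partial>lebesgue)" for n :: nat
    by (rule *) simp
  then have "\<exists>v. \<forall>n::nat. norm (v n) < inverse (Suc n) \<and> e \<le> (\<integral>x. \<bar>G (x + v n) - G x\<bar> \<partial>lebesgue)"
    by (intro choice allI)
  then obtain v where v': "\<forall>n::nat. norm (v n) < inverse (Suc n) \<and> e \<le> (\<integral>x. \<bar>G (x + v n) - G x\<bar> \<partial>lebesgue)" ..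
  then have v: "norm (v n) < inverse (Suc n)" "e \<le> (\<integral>x. \<bar>G (x + v n) - G x\<bar> \<partial>lebesgue)" for n
    by (simp_all only:)
  have "v \<longlonglongrightarrow> 0"
    by (rule Lim_null_comparison[OF _ LIMSEQ_inverse_real_of_nat]) (intro always_eventually allI less_imp_le v(1))
  from LIMSEQ_le_const[OF translation_continuous_L1[OF U G 0 this], of e] v(2) e show False by auto
qed

text \<open>The bound on the i-th derivative is uniform in h and x, which is the domination used
  once the difference quotient has been moved from the composite function to \<psi>.\<close>

lemma test_difference_quotient:
  assumes t: "test_fun U \<psi>"
  shows "\<exists>B. (\<forall>h>0. \<forall>x. \<bar>(\<psi> (x - h *\<^sub>R axis i 1) - \<psi> x) / h\<bar> \<le> B) \<and>
    (\<forall>h x. (\<forall>n::nat. 0 < h n) \<longrightarrow> h \<longlonglongrightarrow> 0 \<longrightarrow>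
      (\<lambda>n. (\<psi> (x - h n *\<^sub>R axis i 1) - \<psi> x) / h n) \<longlonglongrightarrow> - partial i \<psi> x)"
proof -
  have sm: "smooth \<psi>" using t by (rule test_fun_smooth)
  obtain B where B: "\<And>x. \<bar>partial i \<psi> x\<bar> \<le> B"
    using test_fun_bounded[OF test_fun_partial[OF t, of i]] by metis
  show ?thesis
  proof (intro exI[of _ B] conjI allI impI)
    fix h :: real and x :: "real^3" assume h: "0 < h"
    have "\<bar>slide i h (partial i \<psi>) x\<bar> \<le> B * (h - 0)"
      unfolding slide_def real_norm_def[symmetric]
    proof (rule integral_bound)
      show "continuous_on {0..h} (\<lambda>s. partial i \<psi> (x - s *\<^sub>R axis i 1))"
        by (rule continuous_on_compose2[OF smooth_continuous[OF smooth_partial[OF sm], of UNIV]])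
           (auto intro!: continuous_intros)
    qed (use h B in auto)
    moreover have "slide i h (partial i \<psi>) x = \<psi> x - \<psi> (x - h *\<^sub>R axis i 1)"
      using slide_partial[OF sm] h by simp
    ultimately show "\<bar>(\<psi> (x - h *\<^sub>R axis i 1) - \<psi> x) / h\<bar> \<le> B"
      using h by (simp add: abs_divide divide_le_eq abs_minus_commute)
  next
    fix h :: "nat \<Rightarrow> real" and x :: "real^3" assume h: "\<forall>n. 0 < h n" "h \<longlonglongrightarrow> 0"
    have "((\<lambda>s. x - s *\<^sub>R axis i 1) has_derivative (\<lambda>d. - (d *\<^sub>R axis i 1))) (at 0)"
      by (auto intro!: derivative_eq_intros)
    moreover have "(\<psi> has_derivative (\<bullet>) (grad \<psi> x)) (at (x - 0 *\<^sub>R axis i 1))"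
      using has_derivative_grad[OF smooth_differentiable[OF sm]] by simp
    ultimately have "((\<lambda>s. \<psi> (x - s *\<^sub>R axis i 1)) has_derivative (\<lambda>d. grad \<psi> x \<bullet> (- (d *\<^sub>R axis i 1)))) (at 0)"
      by (rule has_derivative_compose)
    moreover have "(\<lambda>d. grad \<psi> x \<bullet> (- (d *\<^sub>R axis i 1))) = (*) (- partial i \<psi> x)"
      by (simp add: fun_eq_iff grad_axis[of _ _ _ 1, simplified])
    ultimately have D: "((\<lambda>s. \<psi> (x - s *\<^sub>R axis i 1)) has_real_derivative - partial i \<psi> x) (at 0)"
      by (simp only: has_field_derivative_def)
    have "h n \<noteq> 0" for n using h(1)[rule_format, of n] by simp
    then show "(\<lambda>n. (\<psi> (x - h n *\<^sub>R axis i 1) - \<psi> x) / h n) \<longlonglongrightarrow> - partial i \<psi> x"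
      using slope_tendsto[OF D h(2)] by simp
  qed
qed

text \<open>Difference quotients take the place of mollification. An increment of
  \<open>F (u x)\<close> is a slope times an increment of u, and the latter is an integral of the
  weak derivative over a short segment. Slopes are bounded by 1 and converge to
  \<open>F' (u x)\<close> almost everywhere along a subsequence, while continuity of translations in
  L1 removes the averaging over the segment. The bound 1 on F' serves both as Lipschitz constant and
  as domination.\<close>

proposition weak_grad_chain:
  fixes F F' :: "real \<Rightarrow> real"
  assumes U: "open U" "bounded U" and u: "L2 (lebesgue_on U) u" and G: "L2 (lebesgue_on U) G"
    and wg: "weak_grad U u G"
    and F: "\<And>t. (F has_real_derivative F' t) (at t)" and cF': "continuous_on UNIV F'"
    and F'1: "\<And>t. \<bar>F' t\<bar> \<le> 1"
  shows "L2 (lebesgue_on U) (\<lambda>x. F (u x))" "L2 (lebesgue_on U) (\<lambda>x. F' (u x) *\<^sub>R G x)"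
    "weak_grad U (\<lambda>x. F (u x)) (\<lambda>x. F' (u x) *\<^sub>R G x)"
proof -
  have UL: "U \<in> sets lebesgue" using U by (simp add: open_lebesgue)
  note fin = finite_measure_lebesgue_on[OF UL U(2)]
  have cF: "continuous_on UNIV F"
    using F by (intro DERIV_continuous_on) (auto intro: has_field_derivative_at_within)
  have mF [measurable]: "F \<in> borel_measurable borel" "F' \<in> borel_measurable borel"
    using cF cF' by (auto intro: borel_measurable_continuous_onI)
  have lip: "\<bar>F s - F t\<bar> \<le> \<bar>s - t\<bar>" for s t
    using field_differentiable_bound[of UNIV F F' 1 s t] F F'1 by simp
  note [measurable] = L2_measurable[OF u] L2_measurable[OF G]
  have "L2 (lebesgue_on U) (\<lambda>x. \<bar>F 0\<bar> + \<bar>u x\<bar>)"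
    by (intro L2_add L2_bounded[OF fin, of _ "\<bar>F 0\<bar>"] L2_bound[OF u, of _ 1]) auto
  then show LF: "L2 (lebesgue_on U) (\<lambda>x. F (u x))"
  proof (rule L2_bound[of _ _ _ 1])
    have "\<bar>F (u x)\<bar> \<le> \<bar>F 0\<bar> + \<bar>u x\<bar>" for x using lip[of "u x" 0] by simp
    then show "AE x in lebesgue_on U. norm (F (u x)) \<le> 1 * norm (\<bar>F 0\<bar> + \<bar>u x\<bar>)"
      by (intro AE_I2) (simp add: order_trans[OF _ abs_ge_self])
  qed simp
  show LG: "L2 (lebesgue_on U) (\<lambda>x. F' (u x) *\<^sub>R G x)"
    by (rule L2_bound[OF G, of _ 1]) (use F'1 in \<open>auto intro!: mult_left_le_one_le\<close>)
  show "weak_grad U (\<lambda>x. F (u x)) (\<lambda>x. F' (u x) *\<^sub>R G x)"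
  proof (rule weak_gradI)
    show "Lp_loc 1 U (\<lambda>x. F (u x))" by (rule Lp_loc_1_of_L2[OF UL LF])
    show "Lp_loc 1 U (\<lambda>x. F' (u x) *\<^sub>R G x)" by (rule Lp_loc_1_of_L2[OF UL LG])
    fix \<psi> i assume t: "test_fun U \<psi>"
    \<comment> \<open>Extension by zero makes translates meaningful on all of space; inside U
      nothing changes.\<close>
    define ux where "ux x = indicator U x * u x" for x
    define gx where "gx x = indicator U x * G x $ i" for x
    have uxi: "integrable lebesgue ux"
      using integrable_lebesgue_on_iff[OF UL, of u] L2_integrable_finite[OF u fin]
      by (simp add: set_integrable_def ux_def[abs_def])
    have gxi: "integrable lebesgue gx"
      using integrable_lebesgue_on_iff[OF UL, of "\<lambda>x. G x $ i"] L2_integrable_finite[OF L2_nth[OF G] fin, of i]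
      by (simp add: set_integrable_def gx_def[abs_def])
    have gx2: "L2 (lebesgue_on U) gx"
      using L2_bound[OF L2_nth[OF G, of i], of gx 1] gxi UL
      by (simp add: gx_def measurable_restrict_space1 abs_mult indicator_def)
    obtain u0 where u0: "u0 \<in> borel_measurable borel" "integrable lborel u0" "AE x in lborel. ux x = u0 x"
      by (rule borel_representative[OF uxi])
    obtain g0 where g0: "g0 \<in> borel_measurable borel" "integrable lborel g0" "AE x in lborel. gx x = g0 x"
      by (rule borel_representative[OF gxi])
    note [measurable] = u0(1) g0(1)
    have rep: "AE x in lebesgue. ux x = u0 x" "AE x in lebesgue. gx x = g0 x"
      using u0(3) g0(3) by (auto intro: AE_completion)
    have tU: "x \<in> U" if "test_fun U \<eta>" "\<eta> x \<noteq> 0" for \<eta> x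
      using that unfolding test_fun_iff by blast
    \<comment> \<open>Integrals against test functions in U see only the values in U up to null
      sets, so u and G may be replaced by Borel functions.\<close>
    have toL: "(\<integral>x. f x * \<eta> x \<partial>lebesgue) = (\<integral>x. f0 x * \<eta> x \<partial>lborel)"
      if "test_fun U \<eta>" "f0 \<in> borel_measurable borel" "AE x in lebesgue. x \<in> U \<longrightarrow> f x = f0 x"
        "(\<lambda>x. f x * \<eta> x) \<in> borel_measurable lebesgue" for f f0 \<eta>
    proof -
      have m: "(\<lambda>x. f0 x * \<eta> x) \<in> borel_measurable lborel"
        using that(2) smooth_measurable[OF test_fun_smooth[OF that(1)]] by simp
      have "(\<integral>x. f x * \<eta> x \<partial>lebesgue) = (\<integral>x. f0 x * \<eta> x \<partial>lebesgue)"
      proof (rule integral_cong_AE)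
        show "AE x in lebesgue. f x * \<eta> x = f0 x * \<eta> x"
          using that(3) by eventually_elim (use tU[OF that(1)] in auto)
      qed (use that(4) measurable_completion[OF m] in auto)
      then show ?thesis using integral_completion[OF m] by simp
    qed
    have AEu: "AE x in lebesgue. x \<in> U \<longrightarrow> u x = u0 x"
      using rep(1) by eventually_elim (auto simp: ux_def)
    have AEg: "AE x in lebesgue. x \<in> U \<longrightarrow> G x $ i = g0 x"
      using rep(2) by eventually_elim (auto simp: gx_def)
    have uL: "Lp_loc 1 U u" and gL: "Lp_loc 1 U (\<lambda>x. G x $ i)"
      using wg Lp_loc_1_nth by (auto simp: weak_grad_def)
    have wd: "(\<integral>x. u0 x * partial i \<eta> x \<partial>lborel) = - (\<integral>x. g0 x * \<eta> x \<partial>lborel)" if "test_fun U \<eta>" for \<eta>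
      using weak_grad_lebesgue[OF wg that, of i]
        toL[OF test_fun_partial[OF that] u0(1) AEu borel_measurable_integrable[OF test_integrable[OF uL test_fun_partial[OF that]]], of i]
        toL[OF that g0(1) AEg borel_measurable_integrable[OF test_integrable[OF gL that]]] by simp
    obtain K where K: "compact K" "K \<subseteq> U" "\<And>x. x \<notin> K \<Longrightarrow> \<psi> x = 0"
      using t unfolding test_fun_iff by blast
    obtain d where d: "0 < d" "(\<Union>x\<in>K. ball x d) \<subseteq> U"
      using compact_subset_open_imp_ball_epsilon_subset[OF K(1) U(1) K(2)] by metis
    \<comment> \<open>A neighbourhood of the support whose points can be moved by up to d / 2
      without leaving U; the steps \<open>h n\<close> below respect this limit.\<close>
    define V where "V = (\<Union>x\<in>K. ball x (d / 2))"
    have V: "open V" "K \<subseteq> V" using d(1) by (auto simp: V_def)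
    have VU: "x + s *\<^sub>R axis i 1 \<in> U" if x: "x \<in> V" and s: "0 \<le> s" "s \<le> d / 2" for x s
    proof -
      obtain y where y: "y \<in> K" "dist y x < d / 2" using x by (auto simp: V_def)
      have "dist y (x + s *\<^sub>R axis i 1) \<le> dist y x + dist x (x + s *\<^sub>R axis i 1)" by (rule dist_triangle)
      also have "dist x (x + s *\<^sub>R axis i 1) = s" using s by (simp add: dist_norm)
      finally show ?thesis using d(2) y s by force
    qed
    define h where "h n = d / 2 * inverse (Suc n)" for n :: nat
    have h: "0 < h n" "h n \<le> d / 2" for n
      using d(1) by (auto simp: h_def field_simps mult_le_cancel_left1)
    have hlim: "h \<longlonglongrightarrow> 0"
      unfolding h_def using tendsto_mult[OF tendsto_const LIMSEQ_inverse_real_of_nat, of "d / 2"] by simp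
    let ?e = "axis i (1::real) :: real^3"
    have "(\<lambda>n. \<integral>x. \<bar>ux (x + h n *\<^sub>R ?e) - ux x\<bar> \<partial>lebesgue) \<longlonglongrightarrow> 0"
    proof (rule translation_continuous_L1[OF U])
      show "L2 (lebesgue_on U) ux"
        using L2_bound[OF u, of ux 1] uxi UL
        by (simp add: ux_def measurable_restrict_space1 abs_mult indicator_def)
      show "(\<lambda>n. h n *\<^sub>R ?e) \<longlonglongrightarrow> 0"
        using tendsto_scaleR[OF hlim tendsto_const, of ?e] by simp
    qed (simp add: ux_def)
    moreover have shAE: "AE x in lborel. f (x + v) = f0 (x + v)" if "AE x in lborel. f x = f0 x" for f f0 :: "real^3 \<Rightarrow> real" and v
    proof -
      have "AE x in distr lborel borel ((+) v). f x = f0 x" by (subst lborel_distr_plus) (rule that)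
      then have "AE x in lborel. f (v + x) = f0 (v + x)" by (rule AE_distrD[rotated]) simp
      then show ?thesis by (simp add: add.commute)
    qed
    have eqn: "(\<integral>x. \<bar>f (x + v) - f x\<bar> \<partial>lebesgue) = (\<integral>x. \<bar>f0 (x + v) - f0 x\<bar> \<partial>lborel)"
      if f0: "f0 \<in> borel_measurable borel" and ae: "AE x in lborel. f x = f0 x" and fi: "integrable lebesgue f" for f f0 :: "real^3 \<Rightarrow> real" and v
    proof -
      have m: "(\<lambda>x. \<bar>f0 (x + v) - f0 x\<bar>) \<in> borel_measurable lborel" using f0 by simp
      have "(\<integral>x. \<bar>f (x + v) - f x\<bar> \<partial>lebesgue) = (\<integral>x. \<bar>f0 (x + v) - f0 x\<bar> \<partial>lebesgue)"
      proof (rule integral_cong_AE)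
        show "(\<lambda>x. \<bar>f (x + v) - f x\<bar>) \<in> borel_measurable lebesgue"
          using fi lebesgue_translate(1)[of f v] by (intro borel_measurable_abs borel_measurable_diff) auto
        show "(\<lambda>x. \<bar>f0 (x + v) - f0 x\<bar>) \<in> borel_measurable lebesgue" by (rule measurable_completion[OF m])
        have "AE x in lborel. \<bar>f (x + v) - f x\<bar> = \<bar>f0 (x + v) - f0 x\<bar>"
          using ae shAE[OF ae, of v] by eventually_elim simp
        then show "AE x in lebesgue. \<bar>f (x + v) - f x\<bar> = \<bar>f0 (x + v) - f0 x\<bar>" by (rule AE_completion)
      qed
      then show ?thesis using integral_completion[OF m] by simp
    qed
    ultimately have "(\<lambda>n. \<integral>x. norm (u0 (x + h n *\<^sub>R ?e) - u0 x) \<partial>lborel) \<longlonglongrightarrow> 0"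
      using eqn[OF u0(1) u0(3) uxi] by simp
    \<comment> \<open>L1 convergence yields almost everywhere convergence along a subsequence only;
      \<open>k n\<close> will denote the steps along it.\<close>
    then obtain r where r: "strict_mono r" "AE x in lborel. (\<lambda>n. u0 (x + h (r n) *\<^sub>R ?e) - u0 x) \<longlonglongrightarrow> 0"
      using tendsto_L1_AE_subseq[of lborel "\<lambda>n x. u0 (x + h n *\<^sub>R ?e) - u0 x"] u0(2) lborel_integrable_shift[OF u0(2)]
      by auto
    define k where "k n = h (r n)" for n
    have k: "0 < k n" "k n \<le> d / 2" for n using h by (auto simp: k_def)
    have klim: "k \<longlonglongrightarrow> 0" using LIMSEQ_subseq_LIMSEQ[OF hlim r(1)] by (simp add: k_def[abs_def] comp_def)
    have ulim: "AE x in lborel. (\<lambda>n. u0 (x + k n *\<^sub>R ?e)) \<longlonglongrightarrow> u0 x"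
      using r(2) by eventually_elim (auto simp: k_def intro: LIM_zero_cancel)
    have pm [measurable]: "\<psi> \<in> borel_measurable borel" by (rule smooth_measurable[OF test_fun_smooth[OF t]])
    obtain B where B: "\<And>x. \<bar>\<psi> x\<bar> \<le> B" using test_fun_bounded[OF t] by metis
    \<comment> \<open>The cut to U secures integrability over space, since F may be nonzero at
      0.\<close>
    define Fu where "Fu x = indicator U x * F (u0 x)" for x
    have Um [measurable]: "U \<in> sets borel" using U by simp
    have Fum [measurable]: "Fu \<in> borel_measurable borel" unfolding Fu_def[abs_def] by measurable
    have "integrable lborel (\<lambda>x. \<bar>F 0\<bar> * indicator U x + \<bar>u0 x\<bar>)"
      using u0(2) bounded_set_imp_lmeasurable[OF U(2) UL] Um by (simp add: integrable_indicator_iff fmeasurable_def)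
    then have Fui: "integrable lborel Fu"
    proof (rule Bochner_Integration.integrable_bound)
      have "\<bar>Fu x\<bar> \<le> \<bar>F 0\<bar> * indicator U x + \<bar>u0 x\<bar>" for x
        using lip[of "u0 x" 0] by (auto simp: Fu_def indicator_def)
      then show "AE x in lborel. norm (Fu x) \<le> norm (\<bar>F 0\<bar> * indicator U x + \<bar>u0 x\<bar>)"
        by (intro AE_I2) (simp add: order_trans[OF _ abs_ge_self])
    qed simp
    obtain Q where Q': "\<forall>h>0. \<forall>x. \<bar>(\<psi> (x - h *\<^sub>R ?e) - \<psi> x) / h\<bar> \<le> Q"
      "\<forall>h x. (\<forall>n::nat. 0 < h n) \<longrightarrow> h \<longlonglongrightarrow> 0 \<longrightarrow>
      (\<lambda>n. (\<psi> (x - h n *\<^sub>R ?e) - \<psi> x) / h n) \<longlonglongrightarrow> - partial i \<psi> x"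
      using test_difference_quotient[OF t, of i] by (elim exE conjE)
    note Q = Q'(1)[rule_format] Q'(2)[rule_format]
    have pim [measurable]: "partial i \<psi> \<in> borel_measurable borel"
      by (rule smooth_measurable[OF test_fun_smooth[OF test_fun_partial[OF t]]])
    \<comment> \<open>The shift in \<psi> goes backwards, which produces the minus sign in front of
      the derivative.\<close>
    have lim1: "(\<lambda>n. \<integral>x. Fu x * ((\<psi> (x - k n *\<^sub>R ?e) - \<psi> x) / k n) \<partial>lborel) \<longlonglongrightarrow> (\<integral>x. Fu x * (- partial i \<psi> x) \<partial>lborel)"
    proof (rule integral_dominated_convergence[where w = "\<lambda>x. Q * \<bar>Fu x\<bar>"])
      show "AE x in lborel. (\<lambda>n. Fu x * ((\<psi> (x - k n *\<^sub>R ?e) - \<psi> x) / k n)) \<longlonglongrightarrow> Fu x * (- partial i \<psi> x)"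
        by (intro AE_I2 tendsto_mult tendsto_const Q(2) k klim)
      show "AE x in lborel. norm (Fu x * ((\<psi> (x - k n *\<^sub>R ?e) - \<psi> x) / k n)) \<le> Q * \<bar>Fu x\<bar>" for n
      proof (rule AE_I2)
        fix x
        show "norm (Fu x * ((\<psi> (x - k n *\<^sub>R ?e) - \<psi> x) / k n)) \<le> Q * \<bar>Fu x\<bar>"
          using mult_left_mono[OF Q(1)[OF k(1)[of n], of x] abs_ge_zero[of "Fu x"]]
          unfolding real_norm_def abs_mult by (simp only: mult.commute)
      qed
    qed (use Fui in auto)
    \<comment> \<open>Where the increment of \<open>u0\<close> vanishes the slope is set to its
      limit value, so that increments factor at every point and the slopes converge wherever the
      translates of \<open>u0\<close> do.\<close>
    define c where "c n x = (if u0 (x + k n *\<^sub>R ?e) = u0 x then F' (u0 x)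
        else (F (u0 (x + k n *\<^sub>R ?e)) - F (u0 x)) / (u0 (x + k n *\<^sub>R ?e) - u0 x))" for n x
    have cm [measurable]: "c n \<in> borel_measurable borel" for n unfolding c_def[abs_def] by measurable
    have c1: "\<bar>c n x\<bar> \<le> 1" for n x
      using F'1[of "u0 x"] lip[of "u0 (x + k n *\<^sub>R ?e)" "u0 x"] by (auto simp: c_def abs_divide)
    have clim: "AE x in lborel. (\<lambda>n. c n x) \<longlonglongrightarrow> F' (u0 x)"
      using ulim by eventually_elim (simp add: c_def slope_tendsto[OF F])
    have B0: "0 \<le> B" using B[of 0] by linarith
    have pc: "\<bar>\<psi> x * c n x\<bar> \<le> B" for n x
      using mult_mono[OF B[of x] c1[of n x] B0 abs_ge_zero] by (simp add: abs_mult)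
    have pcm: "(\<lambda>x. \<psi> x * c n x) \<in> borel_measurable borel" for n by measurable
    have \<sigma>: "(\<lambda>s. s *\<^sub>R ?e) \<in> borel_measurable borel" by measurable
    have lim2: "(\<lambda>n. \<integral>x. (\<psi> x * c n x) * g0 x \<partial>lborel) \<longlonglongrightarrow> (\<integral>x. (\<psi> x * F' (u0 x)) * g0 x \<partial>lborel)"
    proof (rule integral_dominated_convergence[where w = "\<lambda>x. B * \<bar>g0 x\<bar>"])
      show "AE x in lborel. (\<lambda>n. \<psi> x * c n x * g0 x) \<longlonglongrightarrow> \<psi> x * F' (u0 x) * g0 x"
        using clim by eventually_elim (intro tendsto_intros)
      show "AE x in lborel. norm (\<psi> x * c n x * g0 x) \<le> B * \<bar>g0 x\<bar>" for n
        unfolding real_norm_def abs_mult[of _ "g0 _"] by (intro AE_I2 mult_right_mono pc) simp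
    qed (use g0(2) in auto)
    define J where "J n = (\<integral>x. (\<psi> x * c n x) * g0 x \<partial>lborel)" for n
    define I where "I n s = (\<integral>x. (\<psi> x * c n x) * g0 (x + s *\<^sub>R ?e) \<partial>lborel)" for n s
    define A where "A n = (\<integral>x. Fu x * ((\<psi> (x - k n *\<^sub>R ?e) - \<psi> x) / k n) \<partial>lborel)" for n
    \<comment> \<open>Discrete integration by parts moves the difference to \<open>Fu\<close>. The
      slope and \<open>difference_quotient_AE\<close> convert it into segment integrals of
      \<open>g0\<close>, and Fubini pulls the integral over s outside.\<close>
    have A_eq: "A n = (\<integral>s. indicator {0..k n} s * I n s \<partial>lborel) / k n" for n
    proof -
      let ?W = "\<lambda>x. \<integral>s. indicator {0..k n} s * g0 (x + s *\<^sub>R ?e) \<partial>lborel"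
      have pm2: "(\<lambda>x. \<psi> (x - k n *\<^sub>R ?e)) \<in> borel_measurable borel" by measurable
      have i1: "integrable lborel (\<lambda>x. \<psi> (x - k n *\<^sub>R ?e) * Fu x)" "integrable lborel (\<lambda>x. \<psi> x * Fu x)"
        "integrable lborel (\<lambda>x. \<psi> x * Fu (x + k n *\<^sub>R ?e))"
        using integrable_lborel_mult_bounded[OF Fui pm2 B] integrable_lborel_mult_bounded[OF Fui pm B]
          integrable_lborel_mult_bounded[OF lborel_integrable_shift[OF Fui] pm B] by simp_all
      have "A n = (\<integral>x. (\<psi> (x - k n *\<^sub>R ?e) * Fu x - \<psi> x * Fu x) / k n \<partial>lborel)"
        by (simp add: A_def algebra_simps diff_divide_distrib)
      also have "\<dots> = ((\<integral>x. \<psi> (x - k n *\<^sub>R ?e) * Fu x \<partial>lborel) - (\<integral>x. \<psi> x * Fu x \<partial>lborel)) / k n"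
        using i1 by simp
      also have "(\<integral>x. \<psi> (x - k n *\<^sub>R ?e) * Fu x \<partial>lborel) = (\<integral>x. \<psi> x * Fu (x + k n *\<^sub>R ?e) \<partial>lborel)"
        using lborel_integral_shift[of "\<lambda>x. \<psi> (x - k n *\<^sub>R ?e) * Fu x" "k n *\<^sub>R ?e"] by simp
      also have "(\<integral>x. \<psi> x * Fu (x + k n *\<^sub>R ?e) \<partial>lborel) - (\<integral>x. \<psi> x * Fu x \<partial>lborel)
          = (\<integral>x. \<psi> x * Fu (x + k n *\<^sub>R ?e) - \<psi> x * Fu x \<partial>lborel)"
        using i1 by simp
      also have "\<dots> = (\<integral>x. (\<psi> x * c n x) * ?W x \<partial>lborel)"
      proof -
        have Wm: "?W \<in> borel_measurable borel"
          using borel_measurable_integrable[OF shift_fubini_integrable[OF g0(2) integrable_indicator_Icc \<sigma>, of "\<lambda>x. 1" 1 0 "k n"]]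
          by simp
        have m1: "(\<lambda>x. \<psi> x * Fu (x + k n *\<^sub>R ?e) - \<psi> x * Fu x) \<in> borel_measurable lborel" by measurable
        have m2: "(\<lambda>x. \<psi> x * c n x * ?W x) \<in> borel_measurable lborel" using Wm by measurable
        have "(\<integral>x. \<psi> x * Fu (x + k n *\<^sub>R ?e) - \<psi> x * Fu x \<partial>lebesgue) = (\<integral>x. \<psi> x * c n x * ?W x \<partial>lebesgue)"
        proof (rule integral_cong_AE)
          have "AE x in lebesgue. x \<in> V \<longrightarrow> u0 (x + k n *\<^sub>R ?e) - u0 x - ?W x = 0"
            by (rule difference_quotient_AE[OF u0(2) g0(2) wd V(1)]) (use k VU order_trans less_imp_le in \<open>blast+\<close>)
          then show "AE x in lebesgue. \<psi> x * Fu (x + k n *\<^sub>R ?e) - \<psi> x * Fu x = \<psi> x * c n x * ?W x"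
          proof eventually_elim
            case (elim x)
            show ?case
            proof (cases "x \<in> K")
              case True
              then have xV: "x \<in> V" using V(2) by auto
              have "x \<in> U" using True K(2) by auto
              moreover have "x + k n *\<^sub>R ?e \<in> U" using VU[OF xV] k less_imp_le by blast
              ultimately have "Fu (x + k n *\<^sub>R ?e) - Fu x = F (u0 (x + k n *\<^sub>R ?e)) - F (u0 x)"
                by (simp add: Fu_def)
              also have "\<dots> = c n x * (u0 (x + k n *\<^sub>R ?e) - u0 x)" by (simp add: c_def)
              also have "u0 (x + k n *\<^sub>R ?e) - u0 x = ?W x" using elim xV by simp
              finally show ?thesis by (simp add: mult.assoc right_diff_distrib[symmetric])
            qed (simp add: K(3))
          qed
        qed (use measurable_completion[OF m1] measurable_completion[OF m2] in auto)
        then show ?thesis using integral_completion[OF m1] integral_completion[OF m2] by simp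
      qed
      also have "\<dots> = (\<integral>s. indicator {0..k n} s * I n s \<partial>lborel)"
        unfolding I_def by (rule shift_fubini_swap[OF g0(2) integrable_indicator_Icc \<sigma> pcm pc])
      finally show ?thesis .
    qed
    \<comment> \<open>For large n the translates of \<open>g0\<close> by s up to \<open>k n\<close>
      are L1-close to \<open>g0\<close>, uniformly in s, so the average of \<open>I n s\<close> over
      s is close to \<open>J n\<close>, the value at s = 0.\<close>
    have Ilim: "(\<lambda>n. A n - J n) \<longlonglongrightarrow> 0"
    proof (rule LIMSEQ_I)
      fix \<epsilon> :: real assume \<epsilon>: "0 < \<epsilon>"
      \<comment> \<open>The integrand carries a factor bounded by B; the summand 1 avoids division
        by zero.\<close>
      have \<epsilon>': "0 < \<epsilon> / (2 * (B + 1))" using \<epsilon> B0 by simp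
      obtain \<delta> where \<delta>: "0 < \<delta>" "\<And>v. norm v < \<delta> \<Longrightarrow> (\<integral>x. \<bar>gx (x + v) - gx x\<bar> \<partial>lebesgue) < \<epsilon> / (2 * (B + 1))"
        by (rule translation_uniform_L1[OF U gx2 _ \<epsilon>']) (auto simp: gx_def)
      obtain N where N: "\<And>n. n \<ge> N \<Longrightarrow> k n < \<delta>"
        using LIMSEQ_D[OF klim \<delta>(1)] k(1) by (auto simp: abs_less_iff)
      have "\<bar>A n - J n\<bar> \<le> \<epsilon> / 2" if n: "n \<ge> N" for n
      proof -
        have Is: "\<bar>I n s - J n\<bar> \<le> \<epsilon> / 2" if s: "s \<in> {0..k n}" for s
        proof -
          have gs: "integrable lborel (\<lambda>x. g0 (x + s *\<^sub>R ?e))" by (rule lborel_integrable_shift[OF g0(2)])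
          have "I n s - J n = (\<integral>x. (\<psi> x * c n x) * (g0 (x + s *\<^sub>R ?e) - g0 x) \<partial>lborel)"
            unfolding I_def J_def right_diff_distrib
            using integrable_lborel_mult_bounded[OF gs pcm pc] integrable_lborel_mult_bounded[OF g0(2) pcm pc]
            by (simp add: Bochner_Integration.integral_diff)
          also have "\<bar>\<dots>\<bar> \<le> (\<integral>x. \<bar>(\<psi> x * c n x) * (g0 (x + s *\<^sub>R ?e) - g0 x)\<bar> \<partial>lborel)"
            by (rule integral_abs_bound)
          also have "\<dots> \<le> (\<integral>x. B * \<bar>g0 (x + s *\<^sub>R ?e) - g0 x\<bar> \<partial>lborel)"
          proof (rule integral_mono)
            have gd: "integrable lborel (\<lambda>x. g0 (x + s *\<^sub>R ?e) - g0 x)" using gs g0(2) by simp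
            show "integrable lborel (\<lambda>x. \<bar>(\<psi> x * c n x) * (g0 (x + s *\<^sub>R ?e) - g0 x)\<bar>)"
              by (intro integrable_abs integrable_lborel_mult_bounded[OF gd pcm pc])
            show "integrable lborel (\<lambda>x. B * \<bar>g0 (x + s *\<^sub>R ?e) - g0 x\<bar>)" using gd by simp
            show "\<bar>(\<psi> x * c n x) * (g0 (x + s *\<^sub>R ?e) - g0 x)\<bar> \<le> B * \<bar>g0 (x + s *\<^sub>R ?e) - g0 x\<bar>" for x
              unfolding abs_mult[of _ "g0 _ - g0 _"] by (intro mult_right_mono pc) simp
          qed
          also have "\<dots> = B * (\<integral>x. \<bar>gx (x + s *\<^sub>R ?e) - gx x\<bar> \<partial>lebesgue)"
            using eqn[OF g0(1) g0(3) gxi] by simp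
          also have "\<dots> \<le> B * (\<epsilon> / (2 * (B + 1)))"
            using \<delta>(2)[of "s *\<^sub>R ?e"] s N[OF n] B0 by (intro mult_left_mono) auto
          also have "\<dots> \<le> \<epsilon> / 2" using B0 \<epsilon> by (simp add: field_simps)
          finally show ?thesis .
        qed
        have Ii: "integrable lborel (\<lambda>s. indicator {0..k n} s * I n s)"
          unfolding I_def by (rule shift_fubini_integrable'[OF g0(2) integrable_indicator_Icc \<sigma> pcm pc])
        have w: "(\<integral>s. indicator {0..k n} s \<partial>lborel) = k n" using k(1)[of n] by simp
        have "A n - J n = (\<integral>s. indicator {0..k n} s * I n s - indicator {0..k n} s * J n \<partial>lborel) / k n"
          using Ii integrable_indicator_Icc[of 0 "k n"] w k(1)[of n] by (simp add: A_eq diff_divide_distrib)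
        also have "\<bar>\<dots>\<bar> \<le> (\<integral>s. indicator {0..k n} s * (\<epsilon> / 2) \<partial>lborel) / k n"
        proof -
          have "\<bar>\<integral>s. indicator {0..k n} s * I n s - indicator {0..k n} s * J n \<partial>lborel\<bar>
            \<le> (\<integral>s. \<bar>indicator {0..k n} s * I n s - indicator {0..k n} s * J n\<bar> \<partial>lborel)"
            by (rule integral_abs_bound)
          also have "\<dots> \<le> (\<integral>s. indicator {0..k n} s * (\<epsilon> / 2) \<partial>lborel)"
          proof (rule integral_mono)
            show "integrable lborel (\<lambda>s. \<bar>indicator {0..k n} s * I n s - indicator {0..k n} s * J n\<bar>)"
              by (intro integrable_abs Bochner_Integration.integrable_diff Ii integrable_mult_left integrable_indicator_Icc)
            show "integrable lborel (\<lambda>s. indicator {0..k n} s * (\<epsilon> / 2))"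
              by (intro integrable_mult_left integrable_indicator_Icc)
            show "\<bar>indicator {0..k n} s * I n s - indicator {0..k n} s * J n\<bar> \<le> indicator {0..k n} s * (\<epsilon> / 2)" for s
              using Is[of s] by (cases "s \<in> {0..k n}") auto
          qed
          finally show ?thesis
            unfolding abs_divide abs_of_pos[OF k(1)] by (rule divide_right_mono) (rule less_imp_le[OF k(1)])
        qed
        also have "\<dots> = \<epsilon> / 2" using w k(1)[of n] by simp
        finally show ?thesis .
      qed
      then show "\<exists>N. \<forall>n\<ge>N. norm (A n - J n - 0) < \<epsilon>" using \<epsilon> by (intro exI[of _ N]) force
    qed
    have "A \<longlonglongrightarrow> (\<integral>x. (\<psi> x * F' (u0 x)) * g0 x \<partial>lborel)"
      using tendsto_add[OF Ilim lim2[folded J_def]] by simp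
    with lim1[folded A_def] have "(\<integral>x. Fu x * (- partial i \<psi> x) \<partial>lborel) = (\<integral>x. (\<psi> x * F' (u0 x)) * g0 x \<partial>lborel)"
      by (rule LIMSEQ_unique)
    then have fin: "(\<integral>x. Fu x * partial i \<psi> x \<partial>lborel) = - (\<integral>x. (F' (u0 x) * g0 x) * \<psi> x \<partial>lborel)"
      by (simp add: ac_simps)
    have "(\<integral>x. F (u x) * partial i \<psi> x \<partial>lebesgue) = (\<integral>x. Fu x * partial i \<psi> x \<partial>lborel)"
    proof (rule toL[OF test_fun_partial[OF t]])
      show "AE x in lebesgue. x \<in> U \<longrightarrow> F (u x) = Fu x"
        using AEu by eventually_elim (simp add: Fu_def)
      show "(\<lambda>x. F (u x) * partial i \<psi> x) \<in> borel_measurable lebesgue"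
        by (rule borel_measurable_integrable[OF test_integrable[OF Lp_loc_1_of_L2[OF UL LF] test_fun_partial[OF t]]])
    qed measurable
    moreover have "(\<integral>x. (F' (u x) *\<^sub>R G x) $ i * \<psi> x \<partial>lebesgue) = (\<integral>x. (F' (u0 x) * g0 x) * \<psi> x \<partial>lborel)"
    proof (rule toL[OF t])
      show "AE x in lebesgue. x \<in> U \<longrightarrow> (F' (u x) *\<^sub>R G x) $ i = F' (u0 x) * g0 x"
        using AEu AEg by eventually_elim simp
      show "(\<lambda>x. (F' (u x) *\<^sub>R G x) $ i * \<psi> x) \<in> borel_measurable lebesgue"
        by (rule borel_measurable_integrable[OF test_integrable[OF Lp_loc_1_nth[OF Lp_loc_1_of_L2[OF UL LG]] t]])
    qed measurable
    ultimately show "(\<integral>x. F (u x) * partial i \<psi> x \<partial>lebesgue) = - (\<integral>x. (F' (u x) *\<^sub>R G x) $ i * \<psi> x \<partial>lebesgue)"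
      using fin by simp
  qed
qed

subsection \<open>Bounds for the minimizer of the Ginzburg-Landau energy\<close>

text \<open>Completeness of Lebesgue measure: arbitrary changes on a null set preserve
  measurability. This covers \<open>wgrad\<close> and precise representatives, which are known
  almost everywhere only.\<close>

lemma lebesgue_measurable_AE:
  fixes f g :: "'a::euclidean_space \<Rightarrow> 'b::euclidean_space"
  assumes g: "g \<in> borel_measurable lebesgue" and eq: "AE x in lebesgue. f x = g x"
  shows "f \<in> borel_measurable lebesgue"
proof (rule measurableI)
  fix A :: "'b set" assume A: "A \<in> sets borel"
  show "f -` A \<inter> space lebesgue \<in> sets lebesgue"
  proof (rule completion.in_sets_AE)
    show "g -` A \<inter> space lebesgue \<in> sets lebesgue" using g A by (rule measurable_sets)
    show "AE x in lebesgue. (x \<in> g -` A \<inter> space lebesgue) = (x \<in> f -` A \<inter> space lebesgue)"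
      using eq by eventually_elim auto
  qed auto
qed auto

lemma lebesgue_on_measurable_AE:
  fixes f g :: "real^3 \<Rightarrow> 'b::euclidean_space"
  assumes U: "U \<in> sets lebesgue" and g: "g \<in> borel_measurable (lebesgue_on U)"
    and eq: "AE x in lebesgue. x \<in> U \<longrightarrow> f x = g x"
  shows "f \<in> borel_measurable (lebesgue_on U)"
proof -
  have "(\<lambda>x. indicator U x *\<^sub>R f x) \<in> borel_measurable lebesgue"
  proof (rule lebesgue_measurable_AE)
    show "(\<lambda>x. indicator U x *\<^sub>R g x) \<in> borel_measurable lebesgue"
      using g U by (simp add: borel_measurable_restrict_space_iff)
    show "AE x in lebesgue. indicator U x *\<^sub>R f x = indicator U x *\<^sub>R g x"
      using eq by eventually_elim (auto simp: indicator_def)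
  qed
  then show ?thesis using U by (simp add: borel_measurable_restrict_space_iff)
qed

lemma L2_AE:
  fixes f g :: "real^3 \<Rightarrow> 'b::euclidean_space"
  assumes U: "U \<in> sets lebesgue" and g: "L2 (lebesgue_on U) g"
    and eq: "AE x in lebesgue. x \<in> U \<longrightarrow> f x = g x"
  shows "L2 (lebesgue_on U) f"
proof (rule L2_bound[OF g, of _ 1])
  show "f \<in> borel_measurable (lebesgue_on U)"
    by (rule lebesgue_on_measurable_AE[OF U L2_measurable[OF g] eq])
  show "AE x in lebesgue_on U. norm (f x) \<le> 1 * norm (g x)"
    unfolding AE_lebesgue_on_iff[OF U] using eq by eventually_elim auto
qed

lemma H1_wgrad:
  assumes U: "open U" and u: "H1 U u"
  shows "L2 (lebesgue_on U) u" "weak_grad U u (wgrad U u)" "L2 (lebesgue_on U) (wgrad U u)"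
proof -
  have UL: "U \<in> sets lebesgue" using U by (rule open_lebesgue)
  show "L2 (lebesgue_on U) u" using u by (simp add: H1_def Lp_on_2_iff[OF UL])
  obtain G where G: "weak_grad U u G" "Lp_on 2 U G" using u by (auto simp: H1_def)
  show "weak_grad U u (wgrad U u)" by (rule weak_grad_wgrad[OF G(1)])
  have "L2 (lebesgue_on U) G" using G(2) by (simp add: Lp_on_2_iff[OF UL])
  then show "L2 (lebesgue_on U) (wgrad U u)"
    by (rule L2_AE[OF UL _ wgrad_AE[OF U G(1)]])
qed

lemma H1I:
  assumes U: "open U" and "L2 (lebesgue_on U) u" "weak_grad U u G" "L2 (lebesgue_on U) G"
  shows "H1 U u"
  using assms by (auto simp: H1_def Lp_on_2_iff open_lebesgue)

lemma set_nn_integral_lebesgue_on: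
  assumes "U \<in> sets lebesgue"
  shows "(\<integral>\<^sup>+x\<in>U. f x \<partial>lebesgue) = (\<integral>\<^sup>+x. f x \<partial>(lebesgue_on U))"
  using assms by (subst nn_integral_restrict_space) auto

text \<open>A C^1 stand-in for max 0 s, as the chain rule asks for a continuous derivative: for s >
  0 it is positive and at most s, and its slopes lie between 0 and 1.\<close>

definition ramp :: "real \<Rightarrow> real" where
  "ramp s = (max 0 s)\<^sup>2 / (1 + max 0 s)"

definition ramp' :: "real \<Rightarrow> real" where
  "ramp' s = max 0 s * (2 + max 0 s) / (1 + max 0 s)\<^sup>2"

lemma ramp_deriv: "(ramp has_real_derivative ramp' s) (at s)"
proof -
  consider "s < 0" | "s = 0" | "s > 0" by linarith
  then show ?thesis
  proof cases
    case 1
    have "((\<lambda>s. 0) has_real_derivative 0) (at s)" by simp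
    then have "(ramp has_real_derivative 0) (at s)"
      by (rule has_field_derivative_transform_within_open[where S = "{..<0}"])
         (use 1 in \<open>auto simp: ramp_def\<close>)
    then show ?thesis using 1 by (simp add: ramp'_def)
  next
    case 2
    have "(\<lambda>h. (ramp (0 + h) - ramp 0) / h) \<midarrow>0\<rightarrow> 0"
    proof (rule Lim_null_comparison)
      have "norm ((ramp (0 + h) - ramp 0) / h) \<le> \<bar>h\<bar>" for h
        by (auto simp: ramp_def max_def divide_simps power2_eq_square)
      then show "\<forall>\<^sub>F h in at 0. norm ((ramp (0 + h) - ramp 0) / h) \<le> \<bar>h\<bar>" by simp
      show "(\<lambda>h::real. \<bar>h\<bar>) \<midarrow>0\<rightarrow> 0" by (rule tendsto_eq_intros refl | simp)+
    qed
    then have "(ramp has_real_derivative 0) (at 0)" by (simp add: DERIV_def)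
    then show ?thesis using 2 by (simp add: ramp'_def)
  next
    case 3
    have "((\<lambda>s. s\<^sup>2 / (1 + s)) has_real_derivative ((2 * s) * (1 + s) - s\<^sup>2 * 1) / ((1 + s) * (1 + s))) (at s)"
      using 3 by (intro DERIV_divide) (auto intro!: derivative_eq_intros)
    moreover have "((2 * s) * (1 + s) - s\<^sup>2 * 1) / ((1 + s) * (1 + s)) = ramp' s"
      using 3 by (simp add: ramp'_def power2_eq_square algebra_simps)
    ultimately have "((\<lambda>s. s\<^sup>2 / (1 + s)) has_real_derivative ramp' s) (at s)" by simp
    then show ?thesis
      by (rule has_field_derivative_transform_within_open[where S = "{0<..}"])
         (use 3 in \<open>auto simp: ramp_def\<close>)
  qed
qed

lemma ramp'_bounds: "0 \<le> ramp' s" "ramp' s \<le> 1"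
proof -
  show "0 \<le> ramp' s" by (simp add: ramp'_def)
  have "max 0 s * (2 + max 0 s) \<le> (1 + max 0 s)\<^sup>2" by (simp add: power2_eq_square algebra_simps)
  then show "ramp' s \<le> 1" by (simp add: ramp'_def divide_le_eq)
qed

lemma continuous_ramp': "continuous_on A ramp'"
proof -
  have "(1 + max 0 s)\<^sup>2 \<noteq> 0" for s :: real by (simp add: max_def)
  then show ?thesis unfolding ramp'_def[abs_def] by (intro continuous_intros) auto
qed

text \<open>A $C^1$ substitute for truncation at the levels \<open>l\<close> and $1$.\<close>

definition soft_clip :: "real \<Rightarrow> real \<Rightarrow> real" where
  "soft_clip l t = t - ramp (t - 1) + ramp (l - t)"

lemma soft_clip_deriv:
  "(soft_clip l has_real_derivative (1 - ramp' (t - 1) - ramp' (l - t))) (at t)"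
proof -
  have 1: "((\<lambda>t. ramp (t - 1)) has_real_derivative ramp' (t - 1) * 1) (at t)"
    by (rule DERIV_chain2[OF ramp_deriv]) (auto intro!: derivative_eq_intros)
  have 2: "((\<lambda>t. ramp (l - t)) has_real_derivative ramp' (l - t) * (- 1)) (at t)"
    by (rule DERIV_chain2[OF ramp_deriv]) (auto intro!: derivative_eq_intros)
  have "((\<lambda>t. t - ramp (t - 1) + ramp (l - t)) has_real_derivative (1 - ramp' (t - 1) * 1 + ramp' (l - t) * (- 1))) (at t)"
    by (intro DERIV_add DERIV_diff DERIV_ident 1 2)
  then show ?thesis by (simp add: soft_clip_def[abs_def])
qed

text \<open>As l < 1, the ramps act for t > 1 and for t < l, never simultaneously, so at most one
  slope is subtracted from 1.\<close>

lemma soft_clip_deriv_bound: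
  assumes "l < 1"
  shows "\<bar>1 - ramp' (t - 1) - ramp' (l - t)\<bar> \<le> 1"
proof -
  have "ramp' (t - 1) = 0 \<or> ramp' (l - t) = 0"
    using assms by (auto simp: ramp'_def max_def)
  then show ?thesis using ramp'_bounds[of "t - 1"] ramp'_bounds[of "l - t"] by auto
qed

text \<open>Outside [l, 1] the value moves strictly towards the interval without passing its nearer
  end. Because a lies between l^2 and 1, the square moves towards a.\<close>

lemma soft_clip_closer:
  assumes l: "0 < l" "l < 1" and t: "0 < t" and a: "l\<^sup>2 \<le> a" "a \<le> 1"
  shows "(a - (soft_clip l t)\<^sup>2)\<^sup>2 \<le> (a - t\<^sup>2)\<^sup>2"
    "t < l \<or> 1 < t \<Longrightarrow> (a - (soft_clip l t)\<^sup>2)\<^sup>2 < (a - t\<^sup>2)\<^sup>2"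
proof -
  have aux: "s\<^sup>2 / (1 + s) \<le> s" "0 < s\<^sup>2 / (1 + s)" if "0 < s" for s :: real
    using that by (auto simp: divide_le_eq power2_eq_square algebra_simps)
  have hi: "(a - (soft_clip l t)\<^sup>2)\<^sup>2 < (a - t\<^sup>2)\<^sup>2" if t1: "1 < t"
  proof -
    let ?s = "t - 1"
    have s: "soft_clip l t = t - ?s\<^sup>2 / (1 + ?s)" using t1 l by (simp add: soft_clip_def ramp_def)
    have "?s\<^sup>2 / (1 + ?s) \<le> ?s" "0 < ?s\<^sup>2 / (1 + ?s)"
      using aux[of ?s] t1 by auto
    then have c: "1 \<le> soft_clip l t" "soft_clip l t < t" using s by auto
    have "1 \<le> (soft_clip l t)\<^sup>2" using c by simp
    moreover have "(soft_clip l t)\<^sup>2 < t\<^sup>2" using c by (intro power_strict_mono) auto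
    ultimately have "(soft_clip l t)\<^sup>2 - a < t\<^sup>2 - a" "0 \<le> (soft_clip l t)\<^sup>2 - a" using a by auto
    from power_strict_mono[OF this, of 2] show ?thesis by (simp add: power2_commute)
  qed
  have lo: "(a - (soft_clip l t)\<^sup>2)\<^sup>2 < (a - t\<^sup>2)\<^sup>2" if tl: "t < l"
  proof -
    let ?s = "l - t"
    have s: "soft_clip l t = t + ?s\<^sup>2 / (1 + ?s)" using tl l by (simp add: soft_clip_def ramp_def)
    have "?s\<^sup>2 / (1 + ?s) \<le> ?s" "0 < ?s\<^sup>2 / (1 + ?s)"
      using aux[of ?s] tl by auto
    then have c: "t < soft_clip l t" "soft_clip l t \<le> l" using s by auto
    have "(soft_clip l t)\<^sup>2 \<le> l\<^sup>2" using c t by (intro power_mono) auto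
    moreover have "t\<^sup>2 < (soft_clip l t)\<^sup>2" using c t by (intro power_strict_mono) auto
    ultimately have "a - (soft_clip l t)\<^sup>2 < a - t\<^sup>2" "0 \<le> a - (soft_clip l t)\<^sup>2" using a by auto
    from power_strict_mono[OF this, of 2] show ?thesis by simp
  qed
  show "t < l \<or> 1 < t \<Longrightarrow> (a - (soft_clip l t)\<^sup>2)\<^sup>2 < (a - t\<^sup>2)\<^sup>2" using hi lo by auto
  show "(a - (soft_clip l t)\<^sup>2)\<^sup>2 \<le> (a - t\<^sup>2)\<^sup>2"
  proof (cases "t < l \<or> 1 < t")
    case False
    then have "soft_clip l t = t" by (simp add: soft_clip_def ramp_def)
    then show ?thesis by simp
  qed (use hi lo in auto)
qed

text \<open>\<open>wgrad\<close> selects some representative; almost everywhere uniqueness makes the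
  choice irrelevant to the energy.\<close>

lemma E_energy_eq:
  assumes U: "open U" and G: "weak_grad U u G"
  shows "E_energy U a \<epsilon> u =
    (\<integral>\<^sup>+x. ennreal (1/2 * ((norm (G x))\<^sup>2 + 1 / (2 * \<epsilon>\<^sup>2) * (a x - (u x)\<^sup>2)\<^sup>2)) \<partial>(lebesgue_on U))"
  unfolding E_energy_def set_nn_integral_lebesgue_on[OF open_lebesgue[OF U]]
proof (rule nn_integral_cong_AE)
  show "AE x in lebesgue_on U. ennreal (1/2 * ((norm (wgrad U u x))\<^sup>2 + 1 / (2 * \<epsilon>\<^sup>2) * (a x - \<bar>u x\<bar>\<^sup>2)\<^sup>2))
     = ennreal (1/2 * ((norm (G x))\<^sup>2 + 1 / (2 * \<epsilon>\<^sup>2) * (a x - (u x)\<^sup>2)\<^sup>2))"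
    unfolding AE_lebesgue_on_iff[OF open_lebesgue[OF U]]
    using wgrad_AE[OF U G] by eventually_elim simp
qed

lemma weak_grad_0: "weak_grad U (\<lambda>x. 0) (\<lambda>x. 0)"
  by (rule weak_gradI) (auto simp: Lp_loc_1_iff set_integrable_def)

text \<open>\<open>soft_clip l\<close> applied to \<rho> competes with \<rho>: slopes of absolute
  value at most 1 do not increase the gradient term, and the potential term drops strictly where
  \<rho> leaves [l, 1]. Minimality makes that set null. In the application l is the square root of
  b.\<close>

proposition positive_minimizer_bounds:
  assumes U: "open U" "bounded U" and l: "0 < l" "l < 1" and \<epsilon>: "0 < \<epsilon>"
    and am: "set_borel_measurable lebesgue U a"
    and a: "AE x in lebesgue. x \<in> U \<longrightarrow> l\<^sup>2 \<le> a x \<and> a x \<le> 1"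
    and min: "positive_minimizer U a \<epsilon> \<rho>"
  shows "AE x in lebesgue. x \<in> U \<longrightarrow> l \<le> \<rho> x \<and> \<rho> x \<le> 1"
proof -
  let ?M = "lebesgue_on U"
  have UL: "U \<in> sets lebesgue" using U by (simp add: open_lebesgue)
  note fin = finite_measure_lebesgue_on[OF UL U(2)]
  have H: "H1 U \<rho>" and pos: "AE x in lebesgue. x \<in> U \<longrightarrow> 0 < \<rho> x"
    and le: "\<And>u. H1 U u \<Longrightarrow> E_energy U a \<epsilon> \<rho> \<le> E_energy U a \<epsilon> u"
    using min by (auto simp: positive_minimizer_def)
  note \<rho> = H1_wgrad[OF U(1) H]
  have [measurable]: "a \<in> borel_measurable ?M" using am by (simp add: measurable_lebesgue_on_iff[OF UL])
  note [measurable] = L2_measurable[OF \<rho>(1)] L2_measurable[OF \<rho>(3)]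
  define F' where "F' t = 1 - ramp' (t - 1) - ramp' (l - t)" for t
  have F': "(soft_clip l has_real_derivative F' t) (at t)" "\<bar>F' t\<bar> \<le> 1" for t
    using soft_clip_deriv soft_clip_deriv_bound[OF l(2)] by (auto simp: F'_def)
  have cF': "continuous_on UNIV F'"
    unfolding F'_def by (intro continuous_intros continuous_on_compose2[OF continuous_ramp'[of UNIV]]) auto
  note ch = weak_grad_chain[OF U \<rho>(1,3,2) F'(1) cF' F'(2)]
  have [measurable]: "F' \<in> borel_measurable borel" using cF' by (rule borel_measurable_continuous_onI)
  have [measurable]: "soft_clip l \<in> borel_measurable borel"
    by (intro borel_measurable_continuous_onI DERIV_continuous_on) (rule has_field_derivative_at_within[OF F'(1)])
  let ?e = "\<lambda>G u x. 1/2 * ((norm (G x))\<^sup>2 + 1 / (2 * \<epsilon>\<^sup>2) * (a x - (u x)\<^sup>2)\<^sup>2)"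
  let ?H = "\<lambda>x. F' (\<rho> x) *\<^sub>R wgrad U \<rho> x"
  let ?v = "\<lambda>x. soft_clip l (\<rho> x)"
  have le1: "(\<integral>\<^sup>+x. ennreal (?e (wgrad U \<rho>) \<rho> x) \<partial>?M) \<le> (\<integral>\<^sup>+x. ennreal (?e ?H ?v x) \<partial>?M)"
    using le[OF H1I[OF U(1) ch(1,3,2)]] unfolding E_energy_eq[OF U(1) \<rho>(2)] E_energy_eq[OF U(1) ch(3)] .
  \<comment> \<open>The zero function has finite energy, hence so does \<rho>; a strict inequality
    of integrals requires finiteness.\<close>
  have "E_energy U a \<epsilon> (\<lambda>x. 0) < \<infinity>"
  proof -
    have "E_energy U a \<epsilon> (\<lambda>x. 0) \<le> (\<integral>\<^sup>+x. ennreal (1 / (4 * \<epsilon>\<^sup>2)) \<partial>?M)"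
      unfolding E_energy_eq[OF U(1) weak_grad_0]
    proof (rule nn_integral_mono_AE)
      show "AE x in ?M. ennreal (1 / 2 * ((norm 0)\<^sup>2 + 1 / (2 * \<epsilon>\<^sup>2) * (a x - 0\<^sup>2)\<^sup>2)) \<le> ennreal (1 / (4 * \<epsilon>\<^sup>2))"
        unfolding AE_lebesgue_on_iff[OF UL] using a
      proof eventually_elim
        case (elim x)
        show ?case
        proof
          assume "x \<in> U"
          then have "0 \<le> a x" "a x \<le> 1" using elim order_trans[OF zero_le_power2[of l]] by auto
          then have "(a x)\<^sup>2 \<le> 1" by (simp add: power_le_one)
          then show "ennreal (1 / 2 * ((norm 0)\<^sup>2 + 1 / (2 * \<epsilon>\<^sup>2) * (a x - 0\<^sup>2)\<^sup>2)) \<le> ennreal (1 / (4 * \<epsilon>\<^sup>2))"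
            using \<epsilon> by (intro ennreal_leI) (simp add: divide_right_mono)
        qed
      qed
    qed
    also have "\<dots> < \<infinity>"
      using finite_measure.emeasure_finite[OF fin, of U]
      by (simp add: nn_integral_const ennreal_mult_less_top less_top space_restrict_space del: emeasure_restrict_space)
    finally show ?thesis .
  qed
  moreover have "H1 U (\<lambda>x. 0)" by (rule H1I[OF U(1) _ weak_grad_0]) (auto simp: L2_def)
  ultimately have fin\<rho>: "(\<integral>\<^sup>+x. ennreal (?e (wgrad U \<rho>) \<rho> x) \<partial>?M) < \<infinity>"
    using le order_le_less_trans unfolding E_energy_eq[OF U(1) \<rho>(2)] by blast
  have pw: "?e ?H ?v x \<le> ?e (wgrad U \<rho>) \<rho> x" "\<rho> x < l \<or> 1 < \<rho> x \<Longrightarrow> ?e ?H ?v x < ?e (wgrad U \<rho>) \<rho> x"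
    if "0 < \<rho> x" "l\<^sup>2 \<le> a x" "a x \<le> 1" for x
  proof -
    have "norm (?H x) \<le> norm (wgrad U \<rho> x)"
      using mult_right_mono[OF F'(2) norm_ge_zero, of "\<rho> x" "wgrad U \<rho> x"] by simp
    then have n: "(norm (?H x))\<^sup>2 \<le> (norm (wgrad U \<rho> x))\<^sup>2" by (intro power_mono) auto
    have e: "0 < 1 / (2 * \<epsilon>\<^sup>2)" using \<epsilon> by simp
    note c = soft_clip_closer[OF l that]
    show "?e ?H ?v x \<le> ?e (wgrad U \<rho>) \<rho> x"
      by (rule mult_left_mono[OF add_mono[OF n mult_left_mono[OF c(1) less_imp_le[OF e]]]]) simp
    assume "\<rho> x < l \<or> 1 < \<rho> x"
    then show "?e ?H ?v x < ?e (wgrad U \<rho>) \<rho> x"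
      by (intro mult_strict_left_mono[OF add_le_less_mono[OF n mult_strict_left_mono[OF c(2) e]]]) simp_all
  qed
  have AEp: "AE x in ?M. 0 < \<rho> x \<and> l\<^sup>2 \<le> a x \<and> a x \<le> 1"
    unfolding AE_lebesgue_on_iff[OF UL] using pos a by eventually_elim auto
  have AEle: "AE x in ?M. ennreal (?e ?H ?v x) \<le> ennreal (?e (wgrad U \<rho>) \<rho> x)"
    using AEp by eventually_elim (use pw(1) in \<open>auto intro!: ennreal_leI\<close>)
  \<comment> \<open>The integrands are already ordered the other way; were this to fail on a set of
    positive measure, the competitor would have strictly less energy.\<close>
  have "AE x in ?M. ennreal (?e (wgrad U \<rho>) \<rho> x) \<le> ennreal (?e ?H ?v x)"
  proof (rule ccontr)
    assume nle: "\<not> ?thesis"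
    have m: "(\<lambda>x. ennreal (?e ?H ?v x)) \<in> borel_measurable ?M" "(\<lambda>x. ennreal (?e (wgrad U \<rho>) \<rho> x)) \<in> borel_measurable ?M"
      by measurable
    have fv: "(\<integral>\<^sup>+x. ennreal (?e ?H ?v x) \<partial>?M) \<noteq> \<infinity>"
      using nn_integral_mono_AE[OF AEle] fin\<rho> by auto
    have "(\<integral>\<^sup>+x. ennreal (?e ?H ?v x) \<partial>?M) < (\<integral>\<^sup>+x. ennreal (?e (wgrad U \<rho>) \<rho> x) \<partial>?M)"
      by (rule nn_integral_less[OF m fv AEle nle])
    with le1 show False by simp
  qed
  with AEp have "AE x in ?M. l \<le> \<rho> x \<and> \<rho> x \<le> 1"
  proof eventually_elim
    case (elim x)
    show ?case
    proof (rule ccontr)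
      assume "\<not> (l \<le> \<rho> x \<and> \<rho> x \<le> 1)"
      then have "?e ?H ?v x < ?e (wgrad U \<rho>) \<rho> x" using pw(2)[of x] elim(1) by auto
      moreover have "0 \<le> ?e ?H ?v x" by simp
      ultimately have "ennreal (?e ?H ?v x) < ennreal (?e (wgrad U \<rho>) \<rho> x)"
        by (simp only: ennreal_less_iff)
      with leD[OF elim(2)] show False by contradiction
    qed
  qed
  then show ?thesis unfolding AE_lebesgue_on_iff[OF UL] .
qed

subsection \<open>The energy inequality\<close>

lemma weak_grad_scaleR:
  assumes "weak_grad U u G"
  shows "weak_grad U (\<lambda>x. c * u x) (\<lambda>x. c *\<^sub>R G x)"
proof (rule weak_gradI)
  have u: "Lp_loc 1 U u" and G: "Lp_loc 1 U G" using assms by (auto simp: weak_grad_def)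
  show "Lp_loc 1 U (\<lambda>x. c * u x)" using Lp_loc_1_cmult[OF u, of c] by simp
  show "Lp_loc 1 U (\<lambda>x. c *\<^sub>R G x)" by (rule Lp_loc_1_cmult[OF G])
  fix \<psi> i assume t: "test_fun U \<psi>"
  show "(\<integral>x. c * u x * partial i \<psi> x \<partial>lebesgue) = - (\<integral>x. (c *\<^sub>R G x) $ i * \<psi> x \<partial>lebesgue)"
    using weak_grad_lebesgue[OF assms t, of i] by (simp add: mult.assoc)
qed

lemma Lp_on_2_scaleR:
  fixes f :: "real^3 \<Rightarrow> 'b::euclidean_space"
  assumes "U \<in> sets lebesgue" "Lp_on 2 U f"
  shows "Lp_on 2 U (\<lambda>x. c *\<^sub>R f x)"
  using assms by (simp add: Lp_on_2_iff L2_scaleR)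

lemma Lp_loc_2_scaleR:
  fixes f :: "real^3 \<Rightarrow> 'b::euclidean_space"
  assumes "Lp_loc 2 U f"
  shows "Lp_loc 2 U (\<lambda>x. c *\<^sub>R f x)"
  using assms unfolding Lp_loc_def by (auto intro: Lp_on_2_scaleR[OF compact_lebesgue] simp del: scaleR_scaleR)

text \<open>Provides the competitors Aex + (1 - t) V of the energy inequality. Scaling the
  approximating test fields multiplies both families of convergent integrals by c^2.\<close>

lemma dotH1_sigma_scaleR:
  assumes V: "V \<in> dotH1_sigma"
  shows "(\<lambda>x. c *\<^sub>R V x) \<in> dotH1_sigma"
proof -
  have dV: "dotH1_field V" and div: "weak_div UNIV V (\<lambda>_. 0)" using V by (auto simp: dotH1_sigma_def)
  obtain W G where W: "\<And>n. test_field UNIV (W n)" and L: "Lp_loc 2 UNIV V"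
    and G: "\<And>i. weak_grad UNIV (\<lambda>x. V x $ i) (G i)" "\<And>i. Lp_on 2 UNIV (G i)"
    and l1: "\<And>i. (\<lambda>n::nat. LINT x|lebesgue. (norm (grad (\<lambda>y. W n y $ i) x - G i x))\<^sup>2) \<longlonglongrightarrow> 0"
    and l2: "\<And>K. compact K \<Longrightarrow> (\<lambda>n. LINT x:K|lebesgue. (norm (W n x - V x))\<^sup>2) \<longlonglongrightarrow> 0"
    using dV unfolding dotH1_field_def by blast
  have "dotH1_field (\<lambda>x. c *\<^sub>R V x)"
    unfolding dotH1_field_def
  proof (intro exI[of _ "\<lambda>n x. c *\<^sub>R W n x"] exI[of _ "\<lambda>i x. c *\<^sub>R G i x"] conjI allI impI)
    show "test_field UNIV (\<lambda>x. c *\<^sub>R W n x)" for n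
      using test_fun_cmult[OF test_field_test_fun[OF W[of n]], of c] by (simp add: test_field_def)
    show "Lp_loc 2 UNIV (\<lambda>x. c *\<^sub>R V x)" by (rule Lp_loc_2_scaleR[OF L])
    fix i
    show "weak_grad UNIV (\<lambda>x. (c *\<^sub>R V x) $ i) (\<lambda>x. c *\<^sub>R G i x)"
      using weak_grad_scaleR[OF G(1)[of i], of c] by simp
    show "Lp_on 2 UNIV (\<lambda>x. c *\<^sub>R G i x)" by (rule Lp_on_2_scaleR[OF _ G(2)]) simp
    have "grad (\<lambda>y. (c *\<^sub>R W n y) $ i) x = c *\<^sub>R grad (\<lambda>y. W n y $ i) x" for n x
      by (simp add: vec_eq_iff grad_component partial_cmult[OF smooth_differentiable[OF test_fun_smooth[OF test_field_test_fun[OF W]]]])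
    then have "(norm (grad (\<lambda>y. (c *\<^sub>R W n y) $ i) x - c *\<^sub>R G i x))\<^sup>2 = c\<^sup>2 * (norm (grad (\<lambda>y. W n y $ i) x - G i x))\<^sup>2" for n x
      by (simp only: scaleR_diff_right[symmetric] norm_scaleR power_mult_distrib power2_abs)
    then show "(\<lambda>n. LINT x|lebesgue. (norm (grad (\<lambda>y. (c *\<^sub>R W n y) $ i) x - c *\<^sub>R G i x))\<^sup>2) \<longlonglongrightarrow> 0"
      using tendsto_mult[OF tendsto_const l1[of i], of "c\<^sup>2"] by simp
  next
    fix K :: "(real^3) set" assume K: "compact K"
    have "(norm (c *\<^sub>R W n x - c *\<^sub>R V x))\<^sup>2 = c\<^sup>2 * (norm (W n x - V x))\<^sup>2" for n x
      by (simp only: scaleR_diff_right[symmetric] norm_scaleR power_mult_distrib power2_abs)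
    then show "(\<lambda>n. LINT x:K|lebesgue. (norm (c *\<^sub>R W n x - c *\<^sub>R V x))\<^sup>2) \<longlonglongrightarrow> 0"
      using tendsto_mult[OF tendsto_const l2[OF K], of "c\<^sup>2"] by simp
  qed
  moreover have "weak_div UNIV (\<lambda>x. c *\<^sub>R V x) (\<lambda>_. 0)"
    using div Lp_loc_1_cmult[of UNIV V c] unfolding weak_div_def by simp
  ultimately show ?thesis by (simp add: dotH1_sigma_def)
qed

text \<open>The curl is assembled from the weak gradients of the components, all square integrable
  over space; the selected \<open>wcurl\<close> agrees with it almost everywhere.\<close>

lemma dotH1_sigma_props:
  assumes V: "V \<in> dotH1_sigma"
  shows "Lp_loc 2 UNIV V" "weak_curl UNIV V (wcurl UNIV V)" "L2 lebesgue (wcurl UNIV V)"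
proof -
  obtain G where L: "Lp_loc 2 UNIV V" and G: "\<And>i. weak_grad UNIV (\<lambda>x. V x $ i) (G i)" "\<And>i. Lp_on 2 UNIV (G i)"
    using V unfolding dotH1_sigma_def dotH1_field_def by blast
  show "Lp_loc 2 UNIV V" by (rule L)
  note wc = weak_curl_of_grads[OF G(1)]
  show "weak_curl UNIV V (wcurl UNIV V)" by (rule weak_curl_wcurl[OF wc])
  have "L2 (lebesgue_on UNIV) (curl_of_grads G)"
  proof (rule L2_vec)
    have g: "L2 (lebesgue_on UNIV) (\<lambda>x. G k x $ i)" for k i
      using G(2)[of k] by (intro L2_nth) (simp add: Lp_on_2_iff)
    show "L2 (lebesgue_on UNIV) (\<lambda>x. curl_of_grads G x $ i)" for i
      using exhaust_3[of i] by (elim disjE; simp only: curl_of_grads_nth; intro L2_diff g)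
  qed
  from L2_AE[OF _ this wcurl_AE[OF open_UNIV wc]] show "L2 lebesgue (wcurl UNIV V)"
    by (simp add: lebesgue_on_UNIV_eq)
qed

lemma Lp_loc_2_L2:
  fixes f :: "real^3 \<Rightarrow> 'b::euclidean_space"
  assumes "Lp_loc 2 UNIV f" "open U" "bounded U"
  shows "L2 (lebesgue_on U) f"
proof -
  have K: "compact (closure U)" using assms by simp
  have "L2 (lebesgue_on (closure U)) f"
    using assms K by (simp add: Lp_loc_def Lp_on_2_iff compact_lebesgue)
  then show ?thesis
    by (rule L2_subset) (use K assms closure_subset in \<open>auto simp: compact_lebesgue open_lebesgue\<close>)
qed

text \<open>A first variation from one side: dividing by t and letting t tend to 0 leaves -2 P \<ge>
  0.\<close>

lemma quadratic_perturbation: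
  fixes P C Q :: real
  assumes "\<And>t. 0 < t \<Longrightarrow> t < 1 \<Longrightarrow> 0 \<le> - 2 * t * P + t\<^sup>2 * Q"
  shows "P \<le> 0"
proof (rule ccontr)
  assume "\<not> P \<le> 0"
  then have P: "0 < P" by simp
  \<comment> \<open>Small enough for t Q \<le> P, so that the quadratic term cannot compensate the
    linear one.\<close>
  define t where "t = min (1 / 2) (P / (\<bar>Q\<bar> + 1))"
  have t: "0 < t" "t < 1" using P by (auto simp: t_def)
  have "t * Q \<le> t * (\<bar>Q\<bar> + 1)" using t by (intro mult_left_mono) auto
  also have "\<dots> \<le> (P / (\<bar>Q\<bar> + 1)) * (\<bar>Q\<bar> + 1)" by (intro mult_right_mono) (auto simp: t_def)
  also have "\<dots> = P" by simp
  finally have "t * (t * Q) \<le> t * P" using t by (intro mult_left_mono) auto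
  moreover have "0 < t * P" using t P by simp
  ultimately show False using assms[OF t] by (simp add: power2_eq_square mult.assoc)
qed

text \<open>The potential of a competitor is not explicit, but its Neumann equation makes the field
  A' - grad \<phi>' orthogonal to gradients in the weighted product, so exchanging \<phi>' for the
  potential of A can only increase the energy. This bounds the competitor's energy by a quadratic
  polynomial in t, whose first order term gives \<open>q X V + C \<le> 0\<close>. Orthogonality of X
  to its own gradient part converts this into the bound by the pairing with
  \<open>Aex\<close>.\<close>

proposition J_minimizer_energy:
  assumes U: "open U" "bounded U"
    and \<rho>m: "\<rho> \<in> borel_measurable (lebesgue_on U)" and \<rho>1: "AE x in lebesgue_on U. 0 \<le> \<rho> x \<and> \<rho> x \<le> 1"
    and Aex: "L2 (lebesgue_on U) Aex"
    and neu: "\<And>A. A \<in> admissible Aex \<Longrightarrow> neumann_solution U \<rho> A (\<Phi> A)"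
    and min: "J_minimizer U \<rho> \<Phi> Aex A"
  defines "V \<equiv> \<lambda>x. A x - Aex x" and "X \<equiv> \<lambda>x. A x - wgrad U (\<Phi> A) x"
  shows "V \<in> dotH1_sigma" "L2 (lebesgue_on U) X"
    "(\<integral>x. (\<rho> x)\<^sup>2 * (norm (X x))\<^sup>2 \<partial>(lebesgue_on U)) + (\<integral>x. (norm (wcurl UNIV V x))\<^sup>2 \<partial>lebesgue)
      \<le> (\<integral>x. ((\<rho> x)\<^sup>2 *\<^sub>R X x) \<bullet> Aex x \<partial>(lebesgue_on U))"
proof -
  let ?M = "lebesgue_on U"
  have UL: "U \<in> sets lebesgue" using U by (simp add: open_lebesgue)
  have adm: "A \<in> admissible Aex" and le: "\<And>A'. A' \<in> admissible Aex \<Longrightarrow> J_energy U \<rho> \<Phi> Aex A \<le> J_energy U \<rho> \<Phi> Aex A'"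
    using min by (auto simp: J_minimizer_def)
  show V: "V \<in> dotH1_sigma" using adm by (simp add: admissible_def V_def)
  note VP = dotH1_sigma_props[OF V]
  have V2: "L2 ?M V" by (rule Lp_loc_2_L2[OF VP(1) U])
  have wg: "L2 ?M (wgrad U (\<Phi> A'))" if "A' \<in> admissible Aex" for A'
    using H1_wgrad(3)[OF U(1)] neu[OF that] by (simp add: neumann_solution_def)
  have orth: "(\<integral>x. ((\<rho> x)\<^sup>2 *\<^sub>R (A' x - wgrad U (\<Phi> A') x)) \<bullet> wgrad U (\<Phi> A'') x \<partial>?M) = 0"
    if "A' \<in> admissible Aex" "A'' \<in> admissible Aex" for A' A''
    using neu[OF that(1)] neu[OF that(2)] unfolding neumann_solution_def integral_lebesgue_on[OF UL] by blast
  have A_eq: "A = (\<lambda>x. Aex x + V x)" by (simp add: V_def)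
  have A2: "L2 ?M A" unfolding A_eq by (intro L2_add Aex V2)
  show X2: "L2 ?M X" unfolding X_def by (intro L2_diff A2 wg adm)
  have rL: "L2 ?M (\<lambda>x. (\<rho> x)\<^sup>2 *\<^sub>R Y x)" if Y: "L2 ?M Y" for Y :: "real^3 \<Rightarrow> real^3"
  proof (rule L2_bound[OF Y, of _ 1])
    show "(\<lambda>x. (\<rho> x)\<^sup>2 *\<^sub>R Y x) \<in> borel_measurable ?M" using \<rho>m L2_measurable[OF Y] by measurable
    show "AE x in ?M. norm ((\<rho> x)\<^sup>2 *\<^sub>R Y x) \<le> 1 * norm (Y x)"
      using \<rho>1 by eventually_elim (auto intro!: mult_left_le_one_le simp: power_le_one)
  qed
  \<comment> \<open>The product weighted with \<rho>^2, in which solving the Neumann problem is an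
    orthogonal projection.\<close>
  define q where "q Y Z = (\<integral>x. ((\<rho> x)\<^sup>2 *\<^sub>R Y x) \<bullet> Z x \<partial>?M)" for Y Z :: "real^3 \<Rightarrow> real^3"
  have qi: "integrable ?M (\<lambda>x. (\<rho> x)\<^sup>2 * (Y x \<bullet> Z x))" if "L2 ?M Y" "L2 ?M Z" for Y Z :: "real^3 \<Rightarrow> real^3"
    using L2_inner_integrable[OF rL[OF that(1)] that(2)] by simp
  have q_add: "q (\<lambda>x. Y x + s *\<^sub>R Z x) (\<lambda>x. Y x + s *\<^sub>R Z x) = q Y Y + 2 * s * q Y Z + s\<^sup>2 * q Z Z"
    if Y: "L2 ?M Y" and Z: "L2 ?M Z" for Y Z s
  proof -
    have "q (\<lambda>x. Y x + s *\<^sub>R Z x) (\<lambda>x. Y x + s *\<^sub>R Z x)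
      = (\<integral>x. (\<rho> x)\<^sup>2 * (Y x \<bullet> Y x) + 2 * s * ((\<rho> x)\<^sup>2 * (Y x \<bullet> Z x)) + s\<^sup>2 * ((\<rho> x)\<^sup>2 * (Z x \<bullet> Z x)) \<partial>?M)"
      unfolding q_def
      by (intro Bochner_Integration.integral_cong refl)
         (simp add: inner_add inner_commute algebra_simps power2_eq_square)
    also have "\<dots> = q Y Y + 2 * s * q Y Z + s\<^sup>2 * q Z Z"
      using qi[OF Y Y] qi[OF Y Z] qi[OF Z Z] by (simp add: q_def)
    finally show ?thesis .
  qed
  have q_nonneg: "0 \<le> q Y Y" for Y unfolding q_def by (intro integral_nonneg_AE) auto
  define C where "C = (\<integral>x. (norm (wcurl UNIV V x))\<^sup>2 \<partial>lebesgue)"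
  have C0: "0 \<le> C" by (simp add: C_def)
  have J1: "(\<integral>\<^sup>+x\<in>U. ennreal (1/2 * (\<rho> x)\<^sup>2 * (norm (Y x))\<^sup>2) \<partial>lebesgue) = ennreal (1/2 * q Y Y)" if Y: "L2 ?M Y" for Y
  proof -
    have "(\<integral>\<^sup>+x. ennreal (1/2 * (\<rho> x)\<^sup>2 * (norm (Y x))\<^sup>2) \<partial>?M) = ennreal (\<integral>x. 1/2 * (\<rho> x)\<^sup>2 * (norm (Y x))\<^sup>2 \<partial>?M)"
      using qi[OF Y Y] by (intro nn_integral_eq_integral) (auto simp: power2_norm_eq_inner)
    moreover have "(\<integral>x. 1/2 * (\<rho> x)\<^sup>2 * (norm (Y x))\<^sup>2 \<partial>?M) = 1/2 * q Y Y"
      unfolding q_def by (simp add: power2_norm_eq_inner)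
    ultimately show ?thesis unfolding set_nn_integral_lebesgue_on[OF UL] by simp
  qed
  have J2: "(\<integral>\<^sup>+x. ennreal (1/2 * (norm (wcurl UNIV (\<lambda>y. s *\<^sub>R V y) x))\<^sup>2) \<partial>lebesgue) = ennreal (1/2 * (s\<^sup>2 * C))" for s
  proof -
    have "AE x in lebesgue. x \<in> UNIV \<longrightarrow> wcurl UNIV (\<lambda>y. s *\<^sub>R V y) x = s *\<^sub>R wcurl UNIV V x"
      by (rule wcurl_AE[OF open_UNIV weak_curl_scaleR[OF VP(2)]])
    then have "(\<integral>\<^sup>+x. ennreal (1/2 * (norm (wcurl UNIV (\<lambda>y. s *\<^sub>R V y) x))\<^sup>2) \<partial>lebesgue)
      = (\<integral>\<^sup>+x. ennreal (1/2 * (s\<^sup>2 * (norm (wcurl UNIV V x))\<^sup>2)) \<partial>lebesgue)"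
      by (intro nn_integral_cong_AE) (auto elim!: eventually_mono simp: power_mult_distrib)
    also have "\<dots> = ennreal (\<integral>x. 1/2 * (s\<^sup>2 * (norm (wcurl UNIV V x))\<^sup>2) \<partial>lebesgue)"
      using L2_integrable[OF VP(3)] by (intro nn_integral_eq_integral) auto
    also have "(\<integral>x. 1/2 * (s\<^sup>2 * (norm (wcurl UNIV V x))\<^sup>2) \<partial>lebesgue) = 1/2 * (s\<^sup>2 * C)"
      by (simp add: C_def)
    finally show ?thesis .
  qed
  have JA: "J_energy U \<rho> \<Phi> Aex A = ennreal (1/2 * (q X X + C))"
    unfolding J_energy_def using J1[OF X2] J2[of 1] C0 q_nonneg[of X]
    by (simp add: V_def[symmetric] X_def ennreal_plus[symmetric] add_divide_distrib del: ennreal_plus)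
  have perturb: "0 \<le> - 2 * t * (q X V + C) + t\<^sup>2 * (q V V + C)" if t: "0 < t" "t < 1" for t
  proof -
    define A' where "A' x = Aex x + (1 - t) *\<^sub>R V x" for x
    have diff: "(\<lambda>x. A' x - Aex x) = (\<lambda>x. (1 - t) *\<^sub>R V x)" by (simp add: A'_def)
    have adm': "A' \<in> admissible Aex"
      unfolding admissible_def using dotH1_sigma_scaleR[OF V, of "1 - t"] diff by simp
    let ?Y = "\<lambda>x. A' x - wgrad U (\<Phi> A') x"
    let ?Z = "\<lambda>x. wgrad U (\<Phi> A') x - wgrad U (\<Phi> A) x"
    have "L2 ?M A'" unfolding A'_def[abs_def] by (intro L2_add Aex L2_scaleR V2)
    then have Y: "L2 ?M ?Y" by (intro L2_diff wg adm')
    have Z: "L2 ?M ?Z" by (intro L2_diff wg adm adm')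
    have "q ?Y ?Z = 0"
    proof -
      have "q ?Y ?Z = (\<integral>x. ((\<rho> x)\<^sup>2 *\<^sub>R ?Y x) \<bullet> wgrad U (\<Phi> A') x - ((\<rho> x)\<^sup>2 *\<^sub>R ?Y x) \<bullet> wgrad U (\<Phi> A) x \<partial>?M)"
        unfolding q_def by (simp only: inner_diff_right)
      also have "\<dots> = (\<integral>x. ((\<rho> x)\<^sup>2 *\<^sub>R ?Y x) \<bullet> wgrad U (\<Phi> A') x \<partial>?M) - (\<integral>x. ((\<rho> x)\<^sup>2 *\<^sub>R ?Y x) \<bullet> wgrad U (\<Phi> A) x \<partial>?M)"
        by (intro Bochner_Integration.integral_diff L2_inner_integrable rL Y wg adm adm')
      also have "\<dots> = 0" using orth[OF adm' adm'] orth[OF adm' adm] by simp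
      finally show ?thesis .
    qed
    \<comment> \<open>Pythagoras: X - t V splits into the competitor's field \<open>?Y\<close> and a
      difference of gradients \<open>?Z\<close>, orthogonal to each other.\<close>
    moreover have "(\<lambda>x. ?Y x + 1 *\<^sub>R ?Z x) = (\<lambda>x. X x + (- t) *\<^sub>R V x)"
      by (simp add: fun_eq_iff A'_def X_def A_eq algebra_simps)
    ultimately have qY: "q ?Y ?Y + q ?Z ?Z = q X X + 2 * (- t) * q X V + (- t)\<^sup>2 * q V V"
      using q_add[OF Y Z, of 1] q_add[OF X2 V2, of "- t"] by simp
    have "J_energy U \<rho> \<Phi> Aex A' = ennreal (1/2 * (q ?Y ?Y + (1 - t)\<^sup>2 * C))"
      unfolding J_energy_def diff using J1[OF Y] J2[of "1 - t"] C0 q_nonneg[of ?Y]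
      by (simp add: ennreal_plus[symmetric] add_divide_distrib del: ennreal_plus)
    with le[OF adm'] JA have "1/2 * (q X X + C) \<le> 1/2 * (q ?Y ?Y + (1 - t)\<^sup>2 * C)"
      using C0 q_nonneg by (simp add: ennreal_le_iff)
    then have "q X X + C \<le> q ?Y ?Y + (1 - t)\<^sup>2 * C" by simp
    also have "\<dots> \<le> q X X - 2 * t * q X V + t\<^sup>2 * q V V + (1 - t)\<^sup>2 * C"
      using qY q_nonneg[of ?Z] by simp
    finally show ?thesis by (simp add: power2_diff algebra_simps)
  qed
  have PC: "q X V + C \<le> 0" by (rule quadratic_perturbation[OF perturb])
  have "q X X = q X A - q X (wgrad U (\<Phi> A))"
  proof -
    have "q X X = (\<integral>x. ((\<rho> x)\<^sup>2 *\<^sub>R X x) \<bullet> A x - ((\<rho> x)\<^sup>2 *\<^sub>R X x) \<bullet> wgrad U (\<Phi> A) x \<partial>?M)"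
      unfolding q_def by (intro Bochner_Integration.integral_cong refl) (simp add: X_def inner_diff_right right_diff_distrib)
    also have "\<dots> = q X A - q X (wgrad U (\<Phi> A))"
      unfolding q_def by (intro Bochner_Integration.integral_diff L2_inner_integrable rL X2 A2 wg adm)
    finally show ?thesis .
  qed
  also have "q X (wgrad U (\<Phi> A)) = 0" using orth[OF adm adm] by (simp add: q_def X_def)
  also have "q X A = q X Aex + q X V"
  proof -
    have "q X A = (\<integral>x. ((\<rho> x)\<^sup>2 *\<^sub>R X x) \<bullet> Aex x + ((\<rho> x)\<^sup>2 *\<^sub>R X x) \<bullet> V x \<partial>?M)"
      unfolding q_def by (intro Bochner_Integration.integral_cong refl) (simp add: A_eq inner_add_right distrib_left)
    also have "\<dots> = q X Aex + q X V"
      unfolding q_def by (intro Bochner_Integration.integral_add L2_inner_integrable rL X2 Aex V2)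
    finally show ?thesis .
  qed
  finally have "q X X + C \<le> q X Aex" using PC by simp
  then show "(\<integral>x. (\<rho> x)\<^sup>2 * (norm (X x))\<^sup>2 \<partial>?M) + (\<integral>x. (norm (wcurl UNIV V x))\<^sup>2 \<partial>lebesgue)
      \<le> (\<integral>x. ((\<rho> x)\<^sup>2 *\<^sub>R X x) \<bullet> Aex x \<partial>?M)"
    by (simp add: q_def C_def power2_norm_eq_inner)
qed

subsection \<open>Lebesgue differentiation and precise representatives\<close>

text \<open>Sign changes of coordinates. Differentiation of integrals over cubes with lower corner x
  is transported by the eight reflections to cubes extending from x into every orthant; together
  these cover a ball around x.\<close>

definition reflect :: "(real^3 \<Rightarrow> real) \<Rightarrow> real^3 \<Rightarrow> real^3" where
  "reflect c x = (\<Sum>j\<in>Basis. (c j * (x \<bullet> j)) *\<^sub>R j)"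

definition signs :: "(real^3 \<Rightarrow> real) set" where
  "signs = (\<Pi>\<^sub>E j\<in>Basis. {1, - 1})"

lemma finite_signs: "finite signs"
  unfolding signs_def by (intro finite_PiE) auto

lemma signs_cases: "c \<in> signs \<Longrightarrow> j \<in> Basis \<Longrightarrow> c j = 1 \<or> c j = - 1"
  by (auto simp: signs_def PiE_iff)

lemma inner_reflect: "j \<in> Basis \<Longrightarrow> reflect c x \<bullet> j = c j * (x \<bullet> j)"
  unfolding reflect_def by (simp add: inner_sum_left_Basis)

lemma reflect_reflect:
  assumes "c \<in> signs"
  shows "reflect c (reflect c x) = x"
proof (rule euclidean_eqI)
  fix j :: "real^3" assume j: "j \<in> Basis"
  show "reflect c (reflect c x) \<bullet> j = x \<bullet> j"
    using signs_cases[OF assms j] by (auto simp: inner_reflect[OF j])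
qed

lemma reflect_lebesgue:
  assumes c: "c \<in> signs"
  shows "reflect c \<in> lebesgue \<rightarrow>\<^sub>M lebesgue" "distr lebesgue lebesgue (reflect c) = lebesgue"
proof -
  have nz: "\<And>j. j \<in> Basis \<Longrightarrow> c j \<noteq> 0" using signs_cases[OF c] by fastforce
  have T: "(\<lambda>x. 0 + (\<Sum>j\<in>Basis. (c j * (x \<bullet> j)) *\<^sub>R j)) = reflect c"
    by (auto simp: reflect_def)
  have p: "(\<Prod>j\<in>Basis. \<bar>c j\<bar>) = 1"
    using signs_cases[OF c] by (intro prod.neutral) fastforce
  show "reflect c \<in> lebesgue \<rightarrow>\<^sub>M lebesgue"
    using lebesgue_affine_measurable[of c 0, OF nz] unfolding T by simp
  show "distr lebesgue lebesgue (reflect c) = lebesgue"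
    using lebesgue_affine_euclidean[of c 0, OF nz] unfolding T p by (simp add: density_1)
qed

lemma integral_reflect_lebesgue:
  fixes f :: "real^3 \<Rightarrow> real"
  assumes c: "c \<in> signs" and f: "f \<in> borel_measurable lebesgue"
  shows "(\<integral>x. f (reflect c x) \<partial>lebesgue) = (\<integral>x. f x \<partial>lebesgue)"
    "integrable lebesgue (\<lambda>x. f (reflect c x)) \<longleftrightarrow> integrable lebesgue f"
  using integral_distr[OF reflect_lebesgue(1)[OF c] f] integrable_distr_eq[OF reflect_lebesgue(1)[OF c] f]
  unfolding reflect_lebesgue(2)[OF c] by simp_all

text \<open>Written as a preimage, so that indicators and integrals are pulled back along
  \<open>reflect c\<close>.\<close>

definition corner_cube :: "(real^3 \<Rightarrow> real) \<Rightarrow> real^3 \<Rightarrow> real \<Rightarrow> (real^3) set" where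
  "corner_cube c x h = {w. reflect c w \<in> cbox (reflect c x) (reflect c x + h *\<^sub>R One)}"

lemma ball_subset_corner_cubes: "ball x h \<subseteq> (\<Union>c\<in>signs. corner_cube c x h)"
proof
  fix w assume w: "w \<in> ball x h"
  define c where "c = restrict (\<lambda>j. if 0 \<le> (w - x) \<bullet> j then 1 else - 1 :: real) Basis"
  have c: "c \<in> signs" by (auto simp: c_def signs_def)
  have "reflect c w \<in> cbox (reflect c x) (reflect c x + h *\<^sub>R One)"
    unfolding mem_box
  proof (intro ballI conjI)
    fix j :: "real^3" assume j: "j \<in> Basis"
    have e: "reflect c w \<bullet> j - reflect c x \<bullet> j = \<bar>(w - x) \<bullet> j\<bar>"
      using j by (auto simp: inner_reflect c_def inner_diff_left)
    have "\<bar>(w - x) \<bullet> j\<bar> \<le> norm (w - x)" by (rule Basis_le_norm[OF j])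
    also have "\<dots> < h" using w by (simp add: dist_norm norm_minus_commute)
    finally have "\<bar>(w - x) \<bullet> j\<bar> \<le> h" by simp
    with e show "reflect c x \<bullet> j \<le> reflect c w \<bullet> j" "reflect c w \<bullet> j \<le> (reflect c x + h *\<^sub>R One) \<bullet> j"
      using j by (auto simp: inner_add_left)
  qed
  then show "w \<in> (\<Union>c\<in>signs. corner_cube c x h)" using c by (auto simp: corner_cube_def)
qed

text \<open>Differentiation is applied to |f - q| for a fixed number q, because the exceptional null
  set depends on the function; later q runs through the rationals, which keeps the union of null
  sets countable.\<close>

lemma corner_cube_average:
  fixes f :: "real^3 \<Rightarrow> real"
  assumes f: "integrable lebesgue f" and c: "c \<in> signs"
  shows "\<exists>N. negligible N \<and> (\<forall>x e. x \<notin> N \<longrightarrow> 0 < e \<longrightarrow> (\<exists>d>0. \<forall>h. 0 < h \<and> h < d \<longrightarrow>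
    integrable lebesgue (\<lambda>w. indicator (corner_cube c x h) w * \<bar>f w - q\<bar>) \<and>
    (\<integral>w. indicator (corner_cube c x h) w * \<bar>f w - q\<bar> \<partial>lebesgue) \<le> h ^ 3 * (\<bar>f x - q\<bar> + e)))"
proof -
  define g where "g y = \<bar>f (reflect c y) - q\<bar>" for y
  have fm: "f \<in> borel_measurable lebesgue" using f by auto
  have fT: "integrable lebesgue (\<lambda>y. f (reflect c y))"
    using integral_reflect_lebesgue(2)[OF c fm] f by simp
  have gi: "set_integrable lebesgue (cbox a b) g" for a b
  proof -
    have "set_integrable lebesgue (cbox a b) (\<lambda>y. f (reflect c y))"
      unfolding set_integrable_def by (intro integrable_mult_indicator fT) simp
    moreover have "set_integrable lebesgue (cbox a b) (\<lambda>y. q)"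
      by (rule absolutely_integrable_on_const) simp
    ultimately show ?thesis unfolding g_def[abs_def]
      by (intro set_integrable_abs set_integral_diff(1))
  qed
  have "g integrable_on cbox a b" for a b
    using set_lebesgue_integral_eq_integral(1)[OF gi] .
  then obtain N where N: "negligible N"
    "\<And>x e. \<lbrakk>x \<notin> N; 0 < e\<rbrakk> \<Longrightarrow> \<exists>d>0. \<forall>h. 0 < h \<and> h < d \<longrightarrow>
         norm(integral (cbox x (x + h *\<^sub>R One)) g /\<^sub>R h ^ DIM(real^3) - g x) < e"
    using integrable_ccontinuous_explicit[of g] by blast
  have "negligible (reflect c ` N)"
  proof -
    have NL: "N \<in> null_sets lebesgue" using N(1) by (simp add: negligible_iff_null_sets)
    have im: "reflect c ` N = reflect c -` N \<inter> space lebesgue"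
    proof (intro set_eqI iffI)
      fix x assume "x \<in> reflect c ` N"
      then show "x \<in> reflect c -` N \<inter> space lebesgue" using reflect_reflect[OF c] by auto
    next
      fix x assume "x \<in> reflect c -` N \<inter> space lebesgue"
      then have "reflect c x \<in> N" by simp
      then show "x \<in> reflect c ` N" by (rule rev_image_eqI) (simp add: reflect_reflect[OF c])
    qed
    have "emeasure lebesgue (reflect c -` N \<inter> space lebesgue) = emeasure (distr lebesgue lebesgue (reflect c)) N"
      using NL by (intro emeasure_distr[symmetric] reflect_lebesgue(1)[OF c]) auto
    also have "\<dots> = 0" unfolding reflect_lebesgue(2)[OF c] using NL by auto
    finally have "emeasure lebesgue (reflect c ` N) = 0" unfolding im .
    moreover have "reflect c ` N \<in> sets lebesgue"
      unfolding im using NL by (intro measurable_sets[OF reflect_lebesgue(1)[OF c]]) auto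
    ultimately show ?thesis by (auto simp: negligible_iff_null_sets null_sets_def simp del: emeasure_completion)
  qed
  moreover have "\<exists>d>0. \<forall>h. 0 < h \<and> h < d \<longrightarrow>
    integrable lebesgue (\<lambda>w. indicator (corner_cube c x h) w * \<bar>f w - q\<bar>) \<and>
    (\<integral>w. indicator (corner_cube c x h) w * \<bar>f w - q\<bar> \<partial>lebesgue) \<le> h ^ 3 * (\<bar>f x - q\<bar> + e)"
    if x: "x \<notin> reflect c ` N" and e: "0 < e" for x e
  proof -
    let ?y = "reflect c x"
    have yN: "?y \<notin> N" using x reflect_reflect[OF c, of x] by (metis imageI)
    obtain d where d: "0 < d" "\<And>h. 0 < h \<and> h < d \<Longrightarrow> norm(integral (cbox ?y (?y + h *\<^sub>R One)) g /\<^sub>R h ^ DIM(real^3) - g ?y) < e"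
      using N(2)[OF yN e] by blast
    have "integrable lebesgue (\<lambda>w. indicator (corner_cube c x h) w * \<bar>f w - q\<bar>) \<and>
      (\<integral>w. indicator (corner_cube c x h) w * \<bar>f w - q\<bar> \<partial>lebesgue) \<le> h ^ 3 * (\<bar>f x - q\<bar> + e)"
      if h: "0 < h" "h < d" for h
    proof -
      let ?Q = "cbox ?y (?y + h *\<^sub>R One)"
      let ?F = "\<lambda>w. indicator (corner_cube c x h) w * \<bar>f w - q\<bar>"
      have ind: "indicator (corner_cube c x h) w = indicator ?Q (reflect c w)" for w
        by (simp add: corner_cube_def indicator_def)
      have "(\<lambda>w. indicator ?Q (reflect c w)) \<in> borel_measurable lebesgue"
        by (rule measurable_compose[OF reflect_lebesgue(1)[OF c]], rule borel_measurable_indicator) simp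
      then have Fm: "?F \<in> borel_measurable lebesgue"
        unfolding ind using fm by (intro borel_measurable_times borel_measurable_abs borel_measurable_diff) auto
      have FT: "?F (reflect c z) = indicator ?Q z *\<^sub>R g z" for z
        by (simp add: ind reflect_reflect[OF c] g_def)
      have "integrable lebesgue (\<lambda>z. ?F (reflect c z))"
        unfolding FT using gi[of ?y "?y + h *\<^sub>R One"] by (simp add: set_integrable_def)
      then have i: "integrable lebesgue ?F" using integral_reflect_lebesgue(2)[OF c Fm] by simp
      have "(\<integral>w. ?F w \<partial>lebesgue) = (\<integral>z. ?F (reflect c z) \<partial>lebesgue)"
        using integral_reflect_lebesgue(1)[OF c Fm] by simp
      also have "\<dots> = (LINT z:?Q|lebesgue. g z)" unfolding FT set_lebesgue_integral_def ..
      also have "\<dots> = integral ?Q g" by (rule set_lebesgue_integral_eq_integral(2)[OF gi])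
      finally have I: "(\<integral>w. ?F w \<partial>lebesgue) = integral ?Q g" .
      have "\<bar>integral ?Q g / h ^ 3 - \<bar>f x - q\<bar>\<bar> < e"
        using d(2)[of h] h by (simp add: g_def reflect_reflect[OF c] divide_inverse mult.commute)
      then have "integral ?Q g / h ^ 3 \<le> \<bar>f x - q\<bar> + e" by linarith
      then have "integral ?Q g \<le> h ^ 3 * (\<bar>f x - q\<bar> + e)"
        using h by (simp add: divide_le_eq mult.commute)
      then show ?thesis using i I by simp
    qed
    then show ?thesis using d(1) by blast
  qed
  ultimately show ?thesis by blast
qed

text \<open>With a rational q within e of f x, the integral of |f - q| over the ball is at most the
  sum over the eight corner cubes. Each contributes at most 2 e r^3, which is comparable to the
  volume \<kappa> r^3 of the ball.\<close>

lemma lebesgue_differentiation_ball: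
  fixes f :: "real^3 \<Rightarrow> real"
  assumes f: "integrable lebesgue f"
  shows "AE x in lebesgue. ((\<lambda>r. (\<integral>y. indicator (ball x r) y * f y \<partial>lebesgue) / measure lebesgue (ball x r)) \<longlongrightarrow> f x) (at_right 0)"
proof -
  have "\<forall>c\<in>signs. \<forall>q::rat. \<exists>N. negligible N \<and> (\<forall>x e. x \<notin> N \<longrightarrow> 0 < e \<longrightarrow> (\<exists>d>0. \<forall>h. 0 < h \<and> h < d \<longrightarrow>
    integrable lebesgue (\<lambda>w. indicator (corner_cube c x h) w * \<bar>f w - of_rat q\<bar>) \<and>
    (\<integral>w. indicator (corner_cube c x h) w * \<bar>f w - of_rat q\<bar> \<partial>lebesgue) \<le> h ^ 3 * (\<bar>f x - of_rat q\<bar> + e)))"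
    using corner_cube_average[OF f] by blast
  then obtain N where N: "\<And>c q. c \<in> signs \<Longrightarrow> negligible (N c q)"
    and Nd: "\<And>c q x e. c \<in> signs \<Longrightarrow> x \<notin> N c q \<Longrightarrow> 0 < e \<Longrightarrow> (\<exists>d>0. \<forall>h. 0 < h \<and> h < d \<longrightarrow>
    integrable lebesgue (\<lambda>w. indicator (corner_cube c x h) w * \<bar>f w - of_rat q\<bar>) \<and>
    (\<integral>w. indicator (corner_cube c x h) w * \<bar>f w - of_rat q\<bar> \<partial>lebesgue) \<le> h ^ 3 * (\<bar>f x - of_rat q\<bar> + e))"
    unfolding bchoice_iff choice_iff by blast
  have "AE x in lebesgue. \<forall>q. x \<notin> N c q" if "c \<in> signs" for c
    using N[OF that] by (intro AE_all_countable[THEN iffD2] allI AE_not_in) (simp add: negligible_iff_null_sets)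
  then have "AE x in lebesgue. \<forall>c\<in>signs. \<forall>q. x \<notin> N c q"
    by (intro AE_finite_allI finite_signs)
  then show ?thesis
  proof eventually_elim
    case (elim x)
    define \<kappa> where "\<kappa> = measure lebesgue (ball (0::real^3) 1)"
    have \<kappa>: "measure lebesgue (ball x r) = \<kappa> * r ^ 3" if "0 < r" for r
      using that content_ball[of r x] content_ball[of 1 "0::real^3"] by (simp add: \<kappa>_def)
    have \<kappa>0: "0 < \<kappa>" unfolding \<kappa>_def by (simp add: content_ball_pos)
    define m where "m = real (card signs)"
    show ?case
    proof (rule tendstoI)
      fix \<epsilon> :: real assume \<epsilon>: "0 < \<epsilon>"
      \<comment> \<open>The total error relative to the volume of the ball: 2 m / \<kappa> from the
        m corner cubes, and 1 from replacing f x by q.\<close>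
      define D where "D = 2 * m / \<kappa> + 1"
      define e where "e = \<epsilon> / (2 * D)"
      have den: "0 < D" using \<kappa>0 by (simp add: m_def D_def add_nonneg_pos)
      have e: "0 < e" using \<epsilon> den by (simp add: e_def)
      have e2: "(2 * m / \<kappa> + 1) * e < \<epsilon>" unfolding D_def[symmetric] using \<epsilon> den by (simp add: e_def)
      obtain q :: rat where "f x < of_rat q" "of_rat q < f x + e"
        using of_rat_dense[of "f x" "f x + e"] e by auto
      then have q: "\<bar>f x - of_rat q\<bar> < e" by linarith
      have "\<forall>c\<in>signs. \<exists>d>0. \<forall>h. 0 < h \<and> h < d \<longrightarrow>
        integrable lebesgue (\<lambda>w. indicator (corner_cube c x h) w * \<bar>f w - of_rat q\<bar>) \<and>
        (\<integral>w. indicator (corner_cube c x h) w * \<bar>f w - of_rat q\<bar> \<partial>lebesgue) \<le> h ^ 3 * (\<bar>f x - of_rat q\<bar> + e)"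
        using Nd elim e by blast
      then have "\<forall>c\<in>signs. \<forall>\<^sub>F h in at_right 0.
        integrable lebesgue (\<lambda>w. indicator (corner_cube c x h) w * \<bar>f w - of_rat q\<bar>) \<and>
        (\<integral>w. indicator (corner_cube c x h) w * \<bar>f w - of_rat q\<bar> \<partial>lebesgue) \<le> h ^ 3 * (\<bar>f x - of_rat q\<bar> + e)"
        unfolding eventually_at_right_field by (simp only: imp_conjL)
      then have "\<forall>\<^sub>F h in at_right 0. \<forall>c\<in>signs.
        integrable lebesgue (\<lambda>w. indicator (corner_cube c x h) w * \<bar>f w - of_rat q\<bar>) \<and>
        (\<integral>w. indicator (corner_cube c x h) w * \<bar>f w - of_rat q\<bar> \<partial>lebesgue) \<le> h ^ 3 * (\<bar>f x - of_rat q\<bar> + e)"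
        by (intro eventually_ball_finite finite_signs)
      then show "\<forall>\<^sub>F r in at_right 0. dist ((\<integral>y. indicator (ball x r) y * f y \<partial>lebesgue) / measure lebesgue (ball x r)) (f x) < \<epsilon>"
        using eventually_at_right_less[of 0]
      proof eventually_elim
        case (elim r)
        let ?b = "indicator (ball x r) :: real^3 \<Rightarrow> real"
        let ?mu = "measure lebesgue (ball x r)"
        have mu: "0 < ?mu" using \<kappa>[OF elim(2)] \<kappa>0 elim(2) by simp
        have bi: "integrable lebesgue ?b" using lmeasurable_ball by (simp add: lmeasurable_iff_integrable)
        have bl: "ball x r \<in> sets lebesgue" by simp
        have fi: "integrable lebesgue (\<lambda>y. ?b y * f y)"
          using integrable_mult_indicator[OF bl f] by simp
        have ab: "integrable lebesgue (\<lambda>y. ?b y * (f y - f x))"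
          using fi bi by (simp add: right_diff_distrib)
        have S: "integrable lebesgue (\<lambda>y. \<Sum>c\<in>signs. indicator (corner_cube c x r) y * \<bar>f y - of_rat q\<bar>)"
          using elim(1) by (intro Bochner_Integration.integrable_sum) auto
        have "(\<integral>y. ?b y * f y \<partial>lebesgue) - f x * ?mu = (\<integral>y. ?b y * f y - ?b y * f x \<partial>lebesgue)"
          using fi bi by simp
        also have "\<bar>\<dots>\<bar> \<le> (\<integral>y. \<bar>?b y * f y - ?b y * f x\<bar> \<partial>lebesgue)" by (rule integral_abs_bound)
        also have "\<dots> \<le> (\<integral>y. (\<Sum>c\<in>signs. indicator (corner_cube c x r) y * \<bar>f y - of_rat q\<bar>) + e * ?b y \<partial>lebesgue)"
        proof (rule integral_mono)
          show "integrable lebesgue (\<lambda>y. \<bar>?b y * f y - ?b y * f x\<bar>)" using fi bi by simp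
          show "integrable lebesgue (\<lambda>y. (\<Sum>c\<in>signs. indicator (corner_cube c x r) y * \<bar>f y - of_rat q\<bar>) + e * ?b y)"
            using S bi by simp
          fix y
          show "\<bar>?b y * f y - ?b y * f x\<bar> \<le> (\<Sum>c\<in>signs. indicator (corner_cube c x r) y * \<bar>f y - of_rat q\<bar>) + e * ?b y"
          proof (cases "y \<in> ball x r")
            case True
            then obtain c where c: "c \<in> signs" "y \<in> corner_cube c x r"
              using ball_subset_corner_cubes[of x r] by blast
            have "\<bar>f y - of_rat q\<bar> = indicator (corner_cube c x r) y * \<bar>f y - of_rat q\<bar>" using c by simp
            also have "\<dots> \<le> (\<Sum>c\<in>signs. indicator (corner_cube c x r) y * \<bar>f y - of_rat q\<bar>)"
              by (rule member_le_sum[OF c(1) _ finite_signs]) simp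
            finally have "\<bar>f y - f x\<bar> \<le> (\<Sum>c\<in>signs. indicator (corner_cube c x r) y * \<bar>f y - of_rat q\<bar>) + e"
              using q by linarith
            then show ?thesis using True by simp
          qed (simp add: sum_nonneg)
        qed
        also have "\<dots> = (\<Sum>c\<in>signs. \<integral>y. indicator (corner_cube c x r) y * \<bar>f y - of_rat q\<bar> \<partial>lebesgue) + e * ?mu"
          using S bi elim(1) by simp
        also have "\<dots> \<le> (\<Sum>c\<in>signs. r ^ 3 * (\<bar>f x - of_rat q\<bar> + e)) + e * ?mu"
          using elim(1) by (intro add_right_mono sum_mono) auto
        also have "\<dots> \<le> (\<Sum>c\<in>signs. r ^ 3 * (2 * e)) + e * ?mu"
          using q elim(2) by (intro add_right_mono sum_mono mult_left_mono) auto
        also have "\<dots> = ((2 * m / \<kappa> + 1) * e) * ?mu"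
          using \<kappa>[OF elim(2)] \<kappa>0 by (simp add: m_def field_simps)
        also have "\<dots> < \<epsilon> * ?mu" using e2 mu by simp
        finally have fin: "\<bar>(\<integral>y. ?b y * f y \<partial>lebesgue) - f x * ?mu\<bar> < \<epsilon> * ?mu" .
        have "(\<integral>y. ?b y * f y \<partial>lebesgue) / ?mu - f x = ((\<integral>y. ?b y * f y \<partial>lebesgue) - f x * ?mu) / ?mu"
          using mu by (simp add: diff_divide_distrib)
        then show ?case
          unfolding dist_real_def using fin mu by (simp add: abs_divide divide_less_eq)
      qed
    qed
  qed
qed

section \<open>Averages over balls and precise representatives\<close>

lemma avg_real_AE:
  fixes f :: "real^3 \<Rightarrow> real"
  assumes U: "open U" and f: "integrable (lebesgue_on U) f"
  shows "AE x in lebesgue. x \<in> U \<longrightarrow> (avg U f x \<longlongrightarrow> f x) (at_right 0)"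
proof -
  have UL: "U \<in> sets lebesgue" using U by (rule open_lebesgue)
  define g where "g x = indicator U x * f x" for x
  have g: "integrable lebesgue g"
    using f integrable_lebesgue_on_iff[OF UL, of f] by (simp add: set_integrable_def g_def[abs_def])
  from lebesgue_differentiation_ball[OF g] show ?thesis
  proof eventually_elim
    case (elim x)
    show ?case
    proof
      assume x: "x \<in> U"
      then obtain d where d: "0 < d" "ball x d \<subseteq> U" using U open_contains_ball by blast
      have "\<forall>\<^sub>F r in at_right 0. (\<integral>y. indicator (ball x r) y * g y \<partial>lebesgue) / measure lebesgue (ball x r) = avg U f x r"
        unfolding eventually_at_right_field
      proof (intro exI[of _ d] conjI d(1) allI impI)
        fix r assume r: "0 < r" "r < d"
        have "ball x r \<subseteq> U" using d(2) r subset_ball[of r d x] by auto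
        then have b: "ball x r \<inter> U = ball x r" by auto
        have i: "indicator (ball x r) y * g y = indicator (ball x r \<inter> U) y *\<^sub>R f y" for y
          by (simp add: g_def indicator_def)
        have "avg U f x r = (\<integral>y. indicator (ball x r \<inter> U) y *\<^sub>R f y \<partial>lebesgue) / measure lebesgue (ball x r \<inter> U)"
          unfolding avg_def divide_inverse by (simp only: real_scaleR_def mult.commute)
        then show "(\<integral>y. indicator (ball x r) y * g y \<partial>lebesgue) / measure lebesgue (ball x r) = avg U f x r"
          by (simp only: b i)
      qed
      from Lim_transform_eventually[OF elim this] show "(avg U f x \<longlongrightarrow> f x) (at_right 0)"
        using x by (simp add: g_def)
    qed
  qed
qed

lemma precise_rep_AE:
  fixes F :: "real^3 \<Rightarrow> real^3"
  assumes U: "open U" and F: "integrable (lebesgue_on U) F"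
  shows "AE x in lebesgue. x \<in> U \<longrightarrow> precise_rep U F x = F x"
proof -
  have UL: "U \<in> sets lebesgue" using U by (rule open_lebesgue)
  have Fi: "integrable (lebesgue_on U) (\<lambda>x. F x $ i)" for i
    using integrable_inner_left[OF F, of "axis i 1"] by (simp add: inner_axis)
  have nth: "avg U F x r $ i = avg U (\<lambda>y. F y $ i) x r" for x r i
  proof -
    have "integrable lebesgue (\<lambda>y. indicator U y *\<^sub>R F y)"
      using F integrable_lebesgue_on_iff[OF UL, of F] by (simp add: set_integrable_def)
    from integrable_mult_indicator[OF _ this, of "ball x r"]
    have I: "integrable lebesgue (\<lambda>y. indicator (ball x r \<inter> U) y *\<^sub>R F y)"
      by (simp add: indicator_inter_arith)
    have "(\<integral>y. indicator (ball x r \<inter> U) y *\<^sub>R F y \<partial>lebesgue) \<bullet> axis i 1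
      = (\<integral>y. (indicator (ball x r \<inter> U) y *\<^sub>R F y) \<bullet> axis i 1 \<partial>lebesgue)"
      by (rule integral_inner_left[symmetric, OF I])
    then show ?thesis by (simp add: avg_def inner_axis)
  qed
  have "AE x in lebesgue. \<forall>i. x \<in> U \<longrightarrow> (avg U (\<lambda>y. F y $ i) x \<longlongrightarrow> F x $ i) (at_right 0)"
    using avg_real_AE[OF U Fi] by (intro AE_all_countable[THEN iffD2]) blast
  then show ?thesis
  proof eventually_elim
    case (elim x)
    show ?case
    proof
      assume "x \<in> U"
      then have l: "(avg U F x \<longlongrightarrow> F x) (at_right 0)"
        using elim by (intro vec_tendstoI) (simp add: nth)
      then have "Lim (at_right 0) (avg U F x) = F x" by (intro tendsto_Lim) auto
      then show "precise_rep U F x = F x" using l by (auto simp: precise_rep_def)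
    qed
  qed
qed

text \<open>The bounds are wanted at every point, because the mass estimate for weighted loops is
  pointwise. Averages inherit them, and both default values are 0: that of a quotient by measure
  zero and that of the representative where no limit exists.\<close>

lemma precise_rep_bound:
  fixes f :: "real^3 \<Rightarrow> real"
  assumes U: "open U" "bounded U" and f: "f \<in> borel_measurable (lebesgue_on U)"
    and bd: "AE x in lebesgue. x \<in> U \<longrightarrow> 0 \<le> f x \<and> f x \<le> 1"
  shows "0 \<le> precise_rep U f x" "precise_rep U f x \<le> 1"
proof -
  have UL: "U \<in> sets lebesgue" using U by (simp add: open_lebesgue)
  have a: "0 \<le> avg U f x r \<and> avg U f x r \<le> 1" for r
  proof -
    let ?S = "ball x r \<inter> U"
    have S: "?S \<in> lmeasurable" using U by (intro lmeasurable_open) auto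
    have 0: "0 \<le> (\<integral>y. indicator ?S y *\<^sub>R f y \<partial>lebesgue)"
      by (rule integral_nonneg_AE) (use bd in \<open>eventually_elim, auto simp: indicator_def\<close>)
    have "(\<integral>y. indicator ?S y *\<^sub>R f y \<partial>lebesgue) \<le> (\<integral>y. indicator ?S y \<partial>lebesgue)"
    proof (rule integral_mono_AE')
      show "integrable lebesgue (indicator ?S :: real^3 \<Rightarrow> real)" using S by (simp add: lmeasurable_iff_integrable)
      show "AE y in lebesgue. indicator ?S y *\<^sub>R f y \<le> indicator ?S y"
        using bd by eventually_elim (auto simp: indicator_def)
      show "AE y in lebesgue. 0 \<le> (indicator ?S y :: real)" by simp
    qed
    also have "\<dots> = measure lebesgue ?S" using S by simp
    finally have le: "(\<integral>y. indicator ?S y *\<^sub>R f y \<partial>lebesgue) \<le> measure lebesgue ?S" .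
    show ?thesis
    proof (cases "measure lebesgue ?S = 0")
      case False
      then have "0 < measure lebesgue ?S" by (simp add: zero_less_measure_iff)
      then show ?thesis using 0 le by (simp add: avg_def divide_inverse[symmetric] mult.commute[of "inverse _"] divide_le_eq_1)
    qed (simp add: avg_def)
  qed
  have "0 \<le> precise_rep U f x \<and> precise_rep U f x \<le> 1"
  proof (cases "\<exists>l. (avg U f x \<longlongrightarrow> l) (at_right 0)")
    case True
    then obtain l where l: "(avg U f x \<longlongrightarrow> l) (at_right 0)" by blast
    then have "Lim (at_right 0) (avg U f x) = l" by (intro tendsto_Lim) auto
    moreover have "0 \<le> l" by (rule tendsto_lowerbound[OF l]) (use a in auto)
    moreover have "l \<le> 1" by (rule tendsto_upperbound[OF l]) (use a in auto)
    ultimately show ?thesis using True by (simp add: precise_rep_def)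
  qed (simp add: precise_rep_def)
  then show "0 \<le> precise_rep U f x" "precise_rep U f x \<le> 1" by auto
qed

subsection \<open>Square loops as curves\<close>

text \<open>First coordinate of the unit square traversed on [0, 1] with sides of duration 1/4:
  rise, rest at 1, fall, rest at 0. The second coordinate is \<open>prof (1 - t)\<close>, so
  reversing time exchanges the two directions.\<close>

definition prof :: "real \<Rightarrow> real" where
  "prof t = max 0 (min 1 (min (4 * t) (3 - 4 * t)))"

definition dprof :: "real \<Rightarrow> real" where
  "dprof t = (if 0 < t \<and> t < 1/4 then 4 else if 1/2 < t \<and> t < 3/4 then - 4 else 0)"

lemma prof_simps:
  "0 \<le> t \<Longrightarrow> t \<le> 1/4 \<Longrightarrow> prof t = 4 * t"
  "1/4 \<le> t \<Longrightarrow> t \<le> 1/2 \<Longrightarrow> prof t = 1"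
  "1/2 \<le> t \<Longrightarrow> t \<le> 3/4 \<Longrightarrow> prof t = 3 - 4 * t"
  "3/4 \<le> t \<Longrightarrow> prof t = 0" "t \<le> 0 \<Longrightarrow> prof t = 0"
  by (auto simp: prof_def)

lemma prof_bounds: "0 \<le> prof t" "prof t \<le> 1"
  by (auto simp: prof_def)

lemma continuous_prof: "continuous_on A prof"
  unfolding prof_def[abs_def] by (intro continuous_intros)

lemma dprof_bound: "\<bar>dprof t\<bar> \<le> 4"
  by (simp add: dprof_def)

lemma dprof_measurable [measurable]: "dprof \<in> borel_measurable borel"
  unfolding dprof_def[abs_def] by measurable

lemma prof_measurable [measurable]: "prof \<in> borel_measurable borel"
  by (intro borel_measurable_continuous_onI continuous_prof)

lemma prof_lipschitz: "\<bar>prof s - prof t\<bar> \<le> 4 * \<bar>s - t\<bar>"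
  unfolding prof_def by (simp add: max_def min_def abs_if)

lemma prof_deriv:
  assumes "t \<notin> {0, 1/4, 1/2, 3/4}"
  shows "(prof has_real_derivative dprof t) (at t)"
proof -
  have *: "(prof has_real_derivative d) (at t)"
    if "(f has_real_derivative d) (at t)" "open S" "t \<in> S" "\<And>s. s \<in> S \<Longrightarrow> f s = prof s" for f d S
    using has_field_derivative_transform_within_open[OF that] .
  consider "t < 0" | "0 < t" "t < 1/4" | "1/4 < t" "t < 1/2" | "1/2 < t" "t < 3/4" | "3/4 < t"
    using assms by fastforce
  then show ?thesis
  proof cases
    case 1
    show ?thesis by (rule *[of "\<lambda>t. 0" _ "{..<0}"]) (use 1 in \<open>auto simp: prof_simps dprof_def\<close>)
  next
    case 2
    show ?thesis
      by (rule *[of "\<lambda>t. 4 * t" _ "{0<..<1/4}"]) (use 2 in \<open>auto simp: prof_simps dprof_def intro!: derivative_eq_intros\<close>)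
  next
    case 3
    show ?thesis by (rule *[of "\<lambda>t. 1" _ "{1/4<..<1/2}"]) (use 3 in \<open>auto simp: prof_simps dprof_def\<close>)
  next
    case 4
    show ?thesis
      by (rule *[of "\<lambda>t. 3 - 4 * t" _ "{1/2<..<3/4}"]) (use 4 in \<open>auto simp: prof_simps dprof_def intro!: derivative_eq_intros\<close>)
  next
    case 5
    show ?thesis by (rule *[of "\<lambda>t. 0" _ "{3/4<..}"]) (use 5 in \<open>auto simp: prof_simps dprof_def\<close>)
  qed
qed

lemma prof_reflect_deriv:
  assumes "t \<notin> {1/4, 1/2, 3/4, 1}"
  shows "((\<lambda>t. prof (1 - t)) has_real_derivative - dprof (1 - t)) (at t)"
proof -
  have "1 - t \<notin> {0, 1/4, 1/2, 3/4}" using assms by auto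
  moreover have "((\<lambda>t::real. 1 - t) has_real_derivative - 1) (at t)"
    by (auto intro!: derivative_eq_intros)
  ultimately show ?thesis
    using DERIV_chain2[of prof "dprof (1 - t)" "\<lambda>t. 1 - t" t "- 1" UNIV] prof_deriv[of "1 - t"] by simp
qed

text \<open>
  The square with corner \<open>y\<close> and side \<open>h\<close>, traversed from \<open>y\<close> first in direction \<open>i\<close>, then in
  direction \<open>j\<close>, on $[0,1]$.
\<close>

definition loop0 :: "3 \<Rightarrow> 3 \<Rightarrow> real \<Rightarrow> real \<Rightarrow> real^3" where
  "loop0 i j h t = (h * prof t) *\<^sub>R axis i 1 + (h * prof (1 - t)) *\<^sub>R axis j 1"

definition loop :: "3 \<Rightarrow> 3 \<Rightarrow> real \<Rightarrow> real^3 \<Rightarrow> real \<Rightarrow> real^3" where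
  "loop i j h y t = y + loop0 i j h t"

definition dloop :: "3 \<Rightarrow> 3 \<Rightarrow> real \<Rightarrow> real \<Rightarrow> real^3" where
  "dloop i j h t = (h * dprof t) *\<^sub>R axis i 1 + (h * - dprof (1 - t)) *\<^sub>R axis j 1"

lemma loop_deriv:
  assumes "t \<notin> {0, 1/4, 1/2, 3/4, 1}"
  shows "(loop i j h y has_vector_derivative dloop i j h t) (at t)"
proof -
  have d: "((\<lambda>t. h * prof t) has_vector_derivative h * dprof t) (at t)"
    "((\<lambda>t. h * prof (1 - t)) has_vector_derivative h * - dprof (1 - t)) (at t)"
    using DERIV_cmult[OF prof_deriv, of t h] DERIV_cmult[OF prof_reflect_deriv, of t h] assms
    unfolding has_real_derivative_iff_has_vector_derivative by blast+
  have s: "((\<lambda>t. g t *\<^sub>R v) has_vector_derivative g' *\<^sub>R v) (at t)" if "(g has_vector_derivative g') (at t)" for g :: "real \<Rightarrow> real" and g' and v :: "real^3"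
    by (rule bounded_linear.has_vector_derivative[OF bounded_linear_scaleR_left that])
  have "((\<lambda>t. y + ((h * prof t) *\<^sub>R axis i 1 + (h * prof (1 - t)) *\<^sub>R axis j 1)) has_vector_derivative
      (0 + ((h * dprof t) *\<^sub>R axis i 1 + (h * - dprof (1 - t)) *\<^sub>R axis j (1::real)))) (at t)"
    by (intro has_vector_derivative_add has_vector_derivative_const s d)
  then show ?thesis by (simp add: loop_def[abs_def] loop0_def dloop_def)
qed

lemma continuous_loop0: "continuous_on A (loop0 i j h)"
  unfolding loop0_def[abs_def]
  by (intro continuous_intros continuous_prof continuous_on_compose2[OF continuous_prof[of UNIV]]) auto

lemma continuous_loop: "continuous_on A (loop i j h y)"
  unfolding loop_def[abs_def] by (intro continuous_intros continuous_loop0)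

lemma loop0_measurable [measurable]: "loop0 i j h \<in> borel_measurable borel"
  by (intro borel_measurable_continuous_onI continuous_loop0)

text \<open>The position on the unit square determines the parameter except at the starting corner.
  Describing the four sides by linear relations reduces injectivity to linear arithmetic on pairs of
  sides.\<close>

lemma square_parameter_inj:
  fixes s t a b :: real
  assumes st: "s < t" "0 \<le> s" "t \<le> 1"
    and S: "(a = 4 * s \<and> b = 0 \<and> s \<le> 1/4) \<or> (a = 1 \<and> b = 4 * s - 1) \<or>
      (a = 3 - 4 * s \<and> b = 1) \<or> (a = 0 \<and> b = 4 - 4 * s \<and> 3/4 \<le> s)"
    and T: "(a = 4 * t \<and> b = 0 \<and> t \<le> 1/4) \<or> (a = 1 \<and> b = 4 * t - 1) \<or>
      (a = 3 - 4 * t \<and> b = 1) \<or> (a = 0 \<and> b = 4 - 4 * t \<and> 3/4 \<le> t)"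
  shows "s = 0 \<and> t = 1"
proof -
  consider "a = 4 * s" "b = 0" "s \<le> 1/4" | "a = 1" "b = 4 * s - 1" | "a = 3 - 4 * s" "b = 1"
    | "a = 0" "b = 4 - 4 * s" "3/4 \<le> s"
    using S by fast
  note S' = this
  consider "a = 4 * t" "b = 0" "t \<le> 1/4" | "a = 1" "b = 4 * t - 1" | "a = 3 - 4 * t" "b = 1"
    | "a = 0" "b = 4 - 4 * t" "3/4 \<le> t"
    using T by fast
  then have "s \<le> 0 \<and> 1 \<le> t"
  proof cases
    case 1 show ?thesis by (rule S') (use st 1 in linarith)+
  next
    case 2 show ?thesis by (rule S') (use st 2 in linarith)+
  next
    case 3 show ?thesis by (rule S') (use st 3 in linarith)+
  next
    case 4
    show ?thesis
    proof (rule S')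
      assume "a = 4 * s" "b = 0"
      with 4 have "s \<le> 0" "1 \<le> t" by simp_all
      then show ?thesis ..
    qed (use st 4 in linarith)+
  qed
  then show ?thesis using st by simp
qed

lemma simple_path_loop:
  assumes "i \<noteq> j" "0 < h"
  shows "simple_path (loop i j h y)"
  unfolding simple_path_def loop_free_def path_def
proof (intro conjI continuous_loop ballI impI)
  have D: "(prof r = 4 * r \<and> prof (1 - r) = 0 \<and> r \<le> 1/4) \<or> (prof r = 1 \<and> prof (1 - r) = 4 * r - 1) \<or>
    (prof r = 3 - 4 * r \<and> prof (1 - r) = 1) \<or> (prof r = 0 \<and> prof (1 - r) = 4 - 4 * r \<and> 3/4 \<le> r)"
    if "r \<in> {0..1}" for r
  proof -
    consider "r \<le> 1/4" | "1/4 \<le> r" "r \<le> 1/2" | "1/2 \<le> r" "r \<le> 3/4" | "3/4 \<le> r" by linarith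
    then show ?thesis using that by cases (auto simp: prof_simps)
  qed
  have key: "s = 0 \<and> t = 1"
    if "s < t" and st: "s \<in> {0..1}" "t \<in> {0..1}" and "prof s = prof t" "prof (1 - s) = prof (1 - t)" for s t
  proof (rule square_parameter_inj[OF that(1)])
    show "(prof t = 4 * s \<and> prof (1 - t) = 0 \<and> s \<le> 1/4) \<or> (prof t = 1 \<and> prof (1 - t) = 4 * s - 1) \<or>
      (prof t = 3 - 4 * s \<and> prof (1 - t) = 1) \<or> (prof t = 0 \<and> prof (1 - t) = 4 - 4 * s \<and> 3/4 \<le> s)"
      using D[OF st(1)] that(4,5) by simp
  qed (use D[OF st(2)] st in auto)
  fix s t assume st: "s \<in> {0..1::real}" "t \<in> {0..1::real}" and eq: "loop i j h y s = loop i j h y t"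
  have "(loop0 i j h s) $ i = (loop0 i j h t) $ i" "(loop0 i j h s) $ j = (loop0 i j h t) $ j"
    using eq by (simp_all add: loop_def)
  then have "prof s = prof t" "prof (1 - s) = prof (1 - t)"
    using assms by (auto simp: loop0_def axis_def)
  then show "s = t \<or> s = 0 \<and> t = 1 \<or> s = 1 \<and> t = 0"
    using key[of s t] key[of t s] st by (cases s t rule: linorder_cases) auto
qed

text \<open>Only one coordinate moves at a time, so the speed is in fact at most 4 h; the cruder
  bound adds both coordinates, and the lost factor 2 is absorbed by the choice of the
  threshold.\<close>

lemma norm_dloop: "0 \<le> h \<Longrightarrow> norm (dloop i j h t) \<le> 8 * h"
proof -
  assume h: "0 \<le> h"
  have "norm (dloop i j h t) \<le> norm ((h * dprof t) *\<^sub>R (axis i 1 :: real^3)) + norm ((h * - dprof (1 - t)) *\<^sub>R (axis j 1 :: real^3))"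
    unfolding dloop_def by (rule norm_triangle_ineq)
  also have "\<dots> = h * \<bar>dprof t\<bar> + h * \<bar>dprof (1 - t)\<bar>" using h by (simp add: abs_mult)
  also have "\<dots> \<le> h * 4 + h * 4"
    using h by (intro add_mono mult_left_mono dprof_bound)
  finally show ?thesis by simp
qed

lemma lipschitz_loop:
  assumes "0 \<le> h"
  shows "(8 * h)-lipschitz_on {0..1} (loop i j h y)"
proof (rule lipschitz_onI)
  fix s t :: real
  have "loop i j h y s - loop i j h y t = (h * (prof s - prof t)) *\<^sub>R axis i 1 + (h * (prof (1 - s) - prof (1 - t))) *\<^sub>R axis j 1"
    by (simp add: loop_def loop0_def algebra_simps)
  then have "dist (loop i j h y s) (loop i j h y t) \<le> norm ((h * (prof s - prof t)) *\<^sub>R (axis i 1 :: real^3)) + norm ((h * (prof (1 - s) - prof (1 - t))) *\<^sub>R (axis j 1 :: real^3))"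
    unfolding dist_norm by (simp only: norm_triangle_ineq)
  also have "\<dots> = h * \<bar>prof s - prof t\<bar> + h * \<bar>prof (1 - s) - prof (1 - t)\<bar>"
    using assms by (simp add: abs_mult)
  also have "\<dots> \<le> h * (4 * \<bar>s - t\<bar>) + h * (4 * \<bar>s - t\<bar>)"
    using prof_lipschitz[of s t] prof_lipschitz[of "1 - s" "1 - t"] assms
    by (intro add_mono mult_left_mono) (auto simp: abs_minus_commute[of t s])
  finally show "dist (loop i j h y s) (loop i j h y t) \<le> 8 * h * dist s t"
    by (simp add: dist_real_def)
qed (use assms in simp)

lemma AE_loop_deriv:
  "AE t in lebesgue. vector_derivative (loop i j h y) (at t) = dloop i j h t"
proof -
  have "AE t in lebesgue. t \<notin> {0, 1/4, 1/2, 3/4, 1::real}"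
    by (intro AE_not_in) (simp add: negligible_iff_null_sets[symmetric])
  then show ?thesis
    by eventually_elim (rule vector_derivative_at[OF loop_deriv])
qed

lemma curve_current_loop_bound:
  assumes h: "0 \<le> h" and \<omega>: "\<And>x. norm (\<omega> x) \<le> 1"
  shows "\<bar>curve_current (loop i j h y) \<omega>\<bar> \<le> 8 * h"
proof -
  let ?F = "\<lambda>t. indicator {0..1} t *\<^sub>R (\<omega> (loop i j h y t) \<bullet> vector_derivative (loop i j h y) (at t))"
  have b: "AE t in lebesgue. \<bar>?F t\<bar> \<le> 8 * h * indicator {0..1} t"
    using AE_loop_deriv[of i j h y]
  proof eventually_elim
    case (elim t)
    have "\<bar>\<omega> (loop i j h y t) \<bullet> dloop i j h t\<bar> \<le> norm (\<omega> (loop i j h y t)) * norm (dloop i j h t)"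
      by (rule Cauchy_Schwarz_ineq2)
    also have "\<dots> \<le> 1 * (8 * h)" by (intro mult_mono \<omega> norm_dloop h) auto
    finally show ?case by (simp add: elim indicator_def)
  qed
  have i: "integrable lebesgue (\<lambda>t::real. 8 * h * indicator {0..1} t)"
    using lmeasurable_cbox[of 0 "1::real"] by (intro integrable_mult_right) (simp add: lmeasurable_iff_integrable)
  \<comment> \<open>The field may be a test field times a precise representative, with nothing known
    about its measurability along the curve; a non-integrable integrand has integral 0 by
    convention.\<close>
  have "\<bar>\<integral>t. ?F t \<partial>lebesgue\<bar> \<le> (\<integral>t. 8 * h * indicator {0..1::real} t \<partial>lebesgue)"
  proof (cases "integrable lebesgue ?F")
    case True
    have "\<bar>\<integral>t. ?F t \<partial>lebesgue\<bar> \<le> (\<integral>t. \<bar>?F t\<bar> \<partial>lebesgue)" by (rule integral_abs_bound)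
    also have "\<dots> \<le> (\<integral>t. 8 * h * indicator {0..1::real} t \<partial>lebesgue)"
      using integrable_abs[OF True] i b by (rule integral_mono_AE)
    finally show ?thesis .
  next
    case False
    then show ?thesis using h by (simp add: not_integrable_integral_eq)
  qed
  also have "\<dots> = 8 * h" by simp
  finally show ?thesis by (simp add: curve_current_def set_lebesgue_integral_def)
qed

lemma mass_weighted_loop:
  assumes h: "0 \<le> h" and w: "\<And>x. 0 \<le> w x" "\<And>x. w x \<le> 1"
  shows "mass (weighted w (curve_current (loop i j h y))) \<le> ereal (8 * h)"
    "0 \<le> mass (weighted w (curve_current (loop i j h y)))"
proof -
  let ?T = "weighted w (curve_current (loop i j h y))"
  show "mass ?T \<le> ereal (8 * h)"
    unfolding mass_def
  proof (rule SUP_least)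
    fix \<omega> :: "real^3 \<Rightarrow> real^3" assume "\<omega> \<in> {\<omega>. test_field UNIV \<omega> \<and> (\<forall>x. norm (\<omega> x) \<le> 1)}"
    then have "norm (w x *\<^sub>R \<omega> x) \<le> 1" for x using w[of x] by (simp add: mult_le_one)
    from curve_current_loop_bound[OF h, of "\<lambda>x. w x *\<^sub>R \<omega> x", OF this, of i j y]
    show "ereal (?T \<omega>) \<le> ereal (8 * h)" by (simp add: weighted_def)
  qed
  have z: "(\<lambda>x. 0) \<in> {\<omega>::real^3 \<Rightarrow> real^3. test_field UNIV \<omega> \<and> (\<forall>x. norm (\<omega> x) \<le> 1)}"
    by (simp add: test_field_def test_fun_0)
  have "ereal (?T (\<lambda>x. 0)) \<le> mass ?T" unfolding mass_def by (rule SUP_upper[OF z])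
  then show "0 \<le> mass ?T" by (simp add: weighted_def curve_current_def set_lebesgue_integral_def zero_ereal_def)
qed

text \<open>The current sees only the values at almost every parameter, so a precise representative
  can be exchanged for a Borel field and Fubini becomes applicable.\<close>

lemma curve_current_loop_eq:
  assumes \<omega>': "\<omega>' \<in> borel_measurable borel"
    and eq: "AE t in lebesgue. t \<in> {0..1} \<longrightarrow> \<omega> (loop i j h y t) = \<omega>' (loop i j h y t)"
  shows "curve_current (loop i j h y) \<omega> = (\<integral>t. indicator {0..1} t * (\<omega>' (loop i j h y t) \<bullet> dloop i j h t) \<partial>lborel)"
proof -
  let ?F = "\<lambda>t. indicator {0..1} t *\<^sub>R (\<omega> (loop i j h y t) \<bullet> vector_derivative (loop i j h y) (at t))"
  let ?G = "\<lambda>t. indicator {0..1} t * (\<omega>' (loop i j h y t) \<bullet> dloop i j h t)"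
  have [measurable]: "loop i j h y \<in> borel_measurable borel"
    by (intro borel_measurable_continuous_onI continuous_loop)
  have [measurable]: "dloop i j h \<in> borel_measurable borel"
    unfolding dloop_def[abs_def] by measurable
  note [measurable] = \<omega>'
  have G: "?G \<in> borel_measurable lborel" by measurable
  have ae: "AE t in lebesgue. ?F t = ?G t"
    using eq AE_loop_deriv[of i j h y] by eventually_elim (auto simp: indicator_def)
  have "(\<integral>t. ?F t \<partial>lebesgue) = (\<integral>t. ?G t \<partial>lebesgue)"
    by (rule integral_cong_AE[OF lebesgue_measurable_AE[OF measurable_completion[OF G] ae] measurable_completion[OF G] ae])
  then show ?thesis
    using integral_completion[OF G] by (simp add: curve_current_def set_lebesgue_integral_def)
qed

lemma loop_lborel_has_integral:
  fixes f :: "real \<Rightarrow> real"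
  assumes f: "f \<in> borel_measurable borel" "\<And>t. \<bar>f t\<bar> \<le> C" and I: "(f has_integral I) {0..1}"
  shows "(\<integral>t. indicator {0..1} t * f t \<partial>lborel) = I"
proof -
  have "integrable lborel (\<lambda>t. f t * indicator {0..1} t)"
    by (rule integrable_lborel_mult_bounded[OF integrable_indicator_Icc f])
  then have "set_integrable lborel {0..1} f" by (simp add: set_integrable_def mult.commute)
  from set_borel_integral_eq_integral(2)[OF this] integral_unique[OF I] show ?thesis
    by (simp add: set_lebesgue_integral_def)
qed

text \<open>The fundamental theorem applies away from the kinks, and the loop is closed. The zero
  boundary settles both the finiteness of \<open>mass0\<close> and the support condition in
  \<open>curves\<close>.\<close>

lemma boundary_loop:
  assumes f: "test_fun U f"
  shows "boundary (curve_current (loop i j h y)) f = 0"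
proof -
  have sm: "smooth f" using f by (rule test_fun_smooth)
  have gm: "grad f \<in> borel_measurable borel"
    unfolding borel_measurable_vec_iff grad_component by (intro allI smooth_measurable smooth_partial sm)
  let ?g = "\<lambda>t. grad f (loop i j h y t) \<bullet> dloop i j h t"
  have [measurable]: "loop i j h y \<in> borel_measurable borel"
    by (intro borel_measurable_continuous_onI continuous_loop)
  have [measurable]: "dloop i j h \<in> borel_measurable borel"
    unfolding dloop_def[abs_def] by measurable
  note [measurable] = gm
  have "\<exists>C. \<forall>t. \<bar>?g t\<bar> \<le> C"
  proof -
    have "\<exists>B. \<forall>x. \<bar>partial k f x\<bar> \<le> B" for k
      using test_fun_bounded[OF test_fun_partial[OF f, of k]] by metis
    then obtain B where B: "\<And>k x. \<bar>partial k f x\<bar> \<le> B k" by metis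
    have g: "?g t = h * dprof t * partial i f (loop i j h y t) + h * - dprof (1 - t) * partial j f (loop i j h y t)" for t
      by (simp only: dloop_def inner_add_right inner_scaleR_right grad_axis mult_1_left)
    have "\<bar>?g t\<bar> \<le> \<bar>h\<bar> * 4 * B i + \<bar>h\<bar> * 4 * B j" for t
    proof -
      have "\<bar>?g t\<bar> \<le> \<bar>h * dprof t * partial i f (loop i j h y t)\<bar> + \<bar>h * - dprof (1 - t) * partial j f (loop i j h y t)\<bar>"
        unfolding g by (rule abs_triangle_ineq)
      also have "\<dots> \<le> \<bar>h\<bar> * 4 * B i + \<bar>h\<bar> * 4 * B j"
        unfolding abs_mult abs_minus_cancel by (intro add_mono mult_mono dprof_bound B mult_nonneg_nonneg) auto
      finally show ?thesis .
    qed
    then show ?thesis by blast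
  qed
  then obtain C where C: "\<And>t. \<bar>?g t\<bar> \<le> C" by blast
  have "(?g has_integral (f (loop i j h y 1) - f (loop i j h y 0))) {0..1}"
  proof (rule fundamental_theorem_of_calculus_interior_strong[of "{1/4, 1/2, 3/4}"])
    fix t :: real assume t: "t \<in> {0<..<1} - {1/4, 1/2, 3/4}"
    have "(loop i j h y has_derivative (\<lambda>d. d *\<^sub>R dloop i j h t)) (at t)"
      using loop_deriv[of t i j h y] t by (simp add: has_vector_derivative_def)
    from has_derivative_compose[OF this has_derivative_grad[OF smooth_differentiable[OF sm]]]
    show "((\<lambda>t. f (loop i j h y t)) has_vector_derivative ?g t) (at t)"
      by (simp add: has_vector_derivative_def)
  next
    show "continuous_on {0..1} (\<lambda>t. f (loop i j h y t))"
      by (rule continuous_on_compose2[OF smooth_continuous[OF sm, of UNIV] continuous_loop]) auto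
  qed auto
  moreover have "loop i j h y 1 = loop i j h y 0" by (simp add: loop_def loop0_def prof_def)
  ultimately have I: "(?g has_integral 0) {0..1}" by simp
  have "curve_current (loop i j h y) (grad f) = (\<integral>t. indicator {0..1} t * ?g t \<partial>lborel)"
    by (rule curve_current_loop_eq[OF gm]) simp
  also have "\<dots> = 0" by (rule loop_lborel_has_integral[OF _ C I]) measurable
  finally show ?thesis by (simp add: boundary_def)
qed

lemma loop_in_curves:
  assumes ij: "i \<noteq> j" and h: "0 < h" and sub: "\<And>t. t \<in> {0..1} \<Longrightarrow> loop i j h y t \<in> \<Omega>"
  shows "loop i j h y \<in> curves \<Omega>"
proof -
  let ?T = "curve_current (loop i j h y)"
  have "weighted (\<lambda>x. 1) ?T = ?T" by (simp add: weighted_def fun_eq_iff)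
  then have "mass ?T \<le> ereal (8 * h)"
    using mass_weighted_loop(1)[of h "\<lambda>x. 1" i j y] h by simp
  then have m: "mass ?T < \<infinity>" by (rule order_le_less_trans) simp
  have "mass0 (boundary ?T) \<le> 0"
    unfolding mass0_def by (rule SUP_least) (use boundary_loop in \<open>auto simp: zero_ereal_def\<close>)
  then have m0: "mass0 (boundary ?T) < \<infinity>" by (rule order_le_less_trans) simp
  have "?T \<omega> = 0" if "test_field (- closure \<Omega>) \<omega>" for \<omega>
  proof -
    have "\<omega> x = 0" if "x \<in> \<Omega>" for x
    proof -
      have "x \<notin> - closure \<Omega>" using that closure_subset by auto
      then have "\<omega> x $ k = 0" for k
        using test_field_test_fun[OF \<open>test_field (- closure \<Omega>) \<omega>\<close>, of k] unfolding test_fun_iff by blast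
      then show ?thesis by (simp add: vec_eq_iff)
    qed
    then have "indicator {0..1} t *\<^sub>R (\<omega> (loop i j h y t) \<bullet> vector_derivative (loop i j h y) (at t)) = 0" for t
      using sub[of t] by (simp add: indicator_def)
    then show ?thesis unfolding curve_current_def set_lebesgue_integral_def by (simp only: integral_zero)
  qed
  then show ?thesis
    using simple_path_loop[OF ij h] lipschitz_loop[of h i j y] h m m0 boundary_loop
    by (auto simp: curves_def normal_current_def supported_in_def supported_in0_def)
qed

text \<open>The mass is at most 8 h, and for positive circulation a smaller mass only enlarges the
  quotient; a circulation that is not positive satisfies the claim trivially.\<close>

lemma isoflux_loop_bound:
  assumes U: "open \<Omega>" "bounded \<Omega>" and \<rho>: "\<rho> \<in> borel_measurable (lebesgue_on \<Omega>)"
    "AE x in lebesgue. x \<in> \<Omega> \<longrightarrow> 0 \<le> \<rho> x \<and> \<rho> x \<le> 1"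
    and R: "isoflux_ratio \<Omega> \<rho> B < ereal \<delta>" and \<delta>: "0 < \<delta>"
    and ij: "i \<noteq> j" and h: "0 < h" and sub: "\<And>t. t \<in> {0..1} \<Longrightarrow> loop i j h y t \<in> \<Omega>"
  shows "curve_current (loop i j h y) (precise_rep \<Omega> B) \<le> 8 * h * \<delta>"
proof (rule ccontr)
  let ?c = "curve_current (loop i j h y) (precise_rep \<Omega> B)"
  let ?m = "mass (weighted (\<lambda>x. (precise_rep \<Omega> \<rho> x)\<^sup>2) (curve_current (loop i j h y)))"
  assume "\<not> ?c \<le> 8 * h * \<delta>"
  then have c: "8 * h * \<delta> < ?c" by simp
  moreover have "0 < 8 * h * \<delta>" using h \<delta> by simp
  ultimately have c0: "0 < ?c" by linarith
  have p: "0 \<le> (precise_rep \<Omega> \<rho> x)\<^sup>2" "(precise_rep \<Omega> \<rho> x)\<^sup>2 \<le> 1" for x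
    using precise_rep_bound[OF U \<rho>, of x] by (auto simp: power_le_one)
  have m: "0 \<le> ?m" "?m \<le> ereal (8 * h)"
    using mass_weighted_loop[of h "\<lambda>x. (precise_rep \<Omega> \<rho> x)\<^sup>2" i j y] p h by auto
  then obtain \<mu> where \<mu>: "?m = ereal \<mu>" "0 \<le> \<mu>" "\<mu> \<le> 8 * h"
    by (cases ?m) auto
  have "ereal ?c / ?m \<le> isoflux_ratio \<Omega> \<rho> B"
    unfolding isoflux_ratio_def by (rule SUP_upper[OF loop_in_curves[OF ij h sub]])
  then have lt: "ereal ?c / ereal \<mu> < ereal \<delta>" using R \<mu>(1) by simp
  show False
  proof (cases "\<mu> = 0")
    case True
    \<comment> \<open>A positive number divided by 0 is infinite in \<open>ereal\<close>, so zero
      mass contradicts the bound on the supremum as well.\<close>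
    then show ?thesis using lt c0 by (simp add: divide_ereal_def)
  next
    case False
    then have "?c / \<mu> < \<delta>" using lt by simp
    then have "?c < \<delta> * \<mu>" using False \<mu>(2) by (simp add: divide_less_eq)
    also have "\<dots> \<le> \<delta> * (8 * h)" using \<mu> \<delta> by (intro mult_left_mono) auto
    finally show ?thesis using c by (simp add: mult.commute mult.left_commute)
  qed
qed

subsection \<open>Circulation and flux\<close>

lemma prof_has_integral:
  fixes G :: "real \<Rightarrow> real"
  assumes G: "continuous_on UNIV G" and h: "0 < h"
  shows "((\<lambda>t. h * dprof t * G (h * prof t)) has_integral integral {0..h} G) {0..1/2}"
    "((\<lambda>t. h * dprof t * G (h * prof t)) has_integral - integral {0..h} G) {1/2..1}"
proof -
  \<comment> \<open>The lower limit -1 keeps 0, where the profile rests, in the interior of the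
    interval on which the antiderivative is differentiable.\<close>
  define P where "P s = integral {-1..s} G" for s
  have P: "(P has_real_derivative G s) (at s)" if "-1 < s" for s
  proof -
    have "(P has_real_derivative G s) (at s within {-1..s + 1})"
      unfolding P_def[abs_def]
      by (rule integral_has_real_derivative[OF continuous_on_subset[OF G]]) (use that in auto)
    then show ?thesis using that by (simp add: at_within_Icc_at)
  qed
  have P_diff: "P h - P 0 = integral {0..h} G"
    using Henstock_Kurzweil_Integration.integral_combine[of "-1" 0 h G] h
      integrable_continuous_interval[OF continuous_on_subset[OF G], of "-1" h] by (simp add: P_def)
  have pos: "-1 < h * prof t" for t
    using mult_nonneg_nonneg[of h "prof t"] prof_bounds[of t] h by linarith
  have cont: "continuous_on A (\<lambda>t. P (h * prof t))" for A
  proof -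
    have "continuous_on {-1<..} P"
      by (rule DERIV_continuous_on) (auto intro: has_field_derivative_at_within P)
    then show ?thesis
      by (rule continuous_on_compose2) (auto intro!: continuous_intros continuous_prof pos)
  qed
  have der: "((\<lambda>t. P (h * prof t)) has_vector_derivative h * dprof t * G (h * prof t)) (at t)"
    if "t \<notin> {0, 1/4, 1/2, 3/4}" for t
    using DERIV_chain2[OF P[OF pos, of t] DERIV_cmult[OF prof_deriv[OF that], of h]]
    by (simp add: has_real_derivative_iff_has_vector_derivative mult.commute mult.left_commute)
  have "((\<lambda>t. h * dprof t * G (h * prof t)) has_integral (P (h * prof (1/2)) - P (h * prof 0))) {0..1/2}"
    by (rule fundamental_theorem_of_calculus_interior_strong[of "{0, 1/4, 1/2, 3/4}"]) (use der cont in auto)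
  then show "((\<lambda>t. h * dprof t * G (h * prof t)) has_integral integral {0..h} G) {0..1/2}"
    using P_diff by (simp add: prof_simps)
  have "((\<lambda>t. h * dprof t * G (h * prof t)) has_integral (P (h * prof 1) - P (h * prof (1/2)))) {1/2..1}"
    by (rule fundamental_theorem_of_calculus_interior_strong[of "{0, 1/4, 1/2, 3/4}"]) (use der cont in auto)
  moreover have "P (h * prof 1) - P (h * prof (1/2)) = - integral {0..h} G"
    using P_diff by (simp add: prof_simps)
  ultimately show "((\<lambda>t. h * dprof t * G (h * prof t)) has_integral - integral {0..h} G) {1/2..1}" by simp
qed

lemma loop0_reflect: "loop0 i j h (1 - t) = loop0 j i h t"
  by (simp add: loop0_def add.commute)

lemma dloop_reflect: "dloop i j h (1 - t) = - dloop j i h t"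
  by (simp add: dloop_def)

lemma lborel_integral_unit_reflect:
  fixes f :: "real \<Rightarrow> real"
  shows "(\<integral>t. indicator {0..1} t * f t \<partial>lborel) = (\<integral>t. indicator {0..1} t * f (1 - t) \<partial>lborel)"
proof -
  have "(\<integral>t. indicator {0..1} t * f t \<partial>lborel) = (\<integral>t. indicator {0..1} (1 - t) * f (1 - t) \<partial>lborel)"
    using lborel_integral_real_affine[of "-1" "\<lambda>t. indicator {0..1} t * f t" 1] by simp
  moreover have "indicator {0..1} (1 - t) = (indicator {0..1} t :: real)" for t :: real
    by (auto simp: indicator_def)
  ultimately show ?thesis by simp
qed

text \<open>While the first coordinate moves, the second is at rest: at 0 in the first half of the
  time, at h in the second half. The halves thus give the two sides parallel to direction i, with
  opposite orientation.\<close>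

lemma loop_integral_first:
  fixes f :: "real^3 \<Rightarrow> real"
  assumes f: "continuous_on UNIV f" and B: "\<And>x. \<bar>f x\<bar> \<le> B" and h: "0 < h"
  shows "(\<integral>t. indicator {0..1} t * (h * dprof t * f (loop0 i j h t)) \<partial>lborel)
    = integral {0..h} (\<lambda>s. f (s *\<^sub>R axis i 1)) - integral {0..h} (\<lambda>s. f (s *\<^sub>R axis i 1 + h *\<^sub>R axis j 1))"
proof (rule loop_lborel_has_integral)
  let ?G0 = "\<lambda>s. f (s *\<^sub>R axis i 1)" and ?G1 = "\<lambda>s. f (s *\<^sub>R axis i 1 + h *\<^sub>R axis j 1)"
  have G: "continuous_on UNIV ?G0" "continuous_on UNIV ?G1"
    by (rule continuous_on_compose2[OF f]; auto intro!: continuous_intros)+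
  have [measurable]: "f \<in> borel_measurable borel" using f by (rule borel_measurable_continuous_onI)
  show "(\<lambda>t. h * dprof t * f (loop0 i j h t)) \<in> borel_measurable borel" by measurable
  show "\<bar>h * dprof t * f (loop0 i j h t)\<bar> \<le> h * 4 * B" for t
    unfolding abs_mult using h by (intro mult_mono dprof_bound B mult_nonneg_nonneg) auto
  have 1: "((\<lambda>t. h * dprof t * f (loop0 i j h t)) has_integral integral {0..h} ?G0) {0..1/2}"
  proof (rule has_integral_eq[OF _ prof_has_integral(1)[OF G(1) h]])
    fix t assume "t \<in> {0..1/2::real}"
    then have "dprof t = 0 \<or> prof (1 - t) = 0" by (auto simp: dprof_def prof_simps)
    then show "h * dprof t * ?G0 (h * prof t) = h * dprof t * f (loop0 i j h t)" by (auto simp: loop0_def)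
  qed
  have 2: "((\<lambda>t. h * dprof t * f (loop0 i j h t)) has_integral - integral {0..h} ?G1) {1/2..1}"
  proof (rule has_integral_eq[OF _ prof_has_integral(2)[OF G(2) h]])
    fix t assume "t \<in> {1/2..1::real}"
    then have "dprof t = 0 \<or> prof (1 - t) = 1" by (auto simp: dprof_def prof_simps)
    then show "h * dprof t * ?G1 (h * prof t) = h * dprof t * f (loop0 i j h t)" by (auto simp: loop0_def)
  qed
  from has_integral_combine[OF _ _ 1 2]
  show "((\<lambda>t. h * dprof t * f (loop0 i j h t)) has_integral integral {0..h} ?G0 - integral {0..h} ?G1) {0..1}"
    by simp
qed

text \<open>Time reversal turns the sides in direction j into the previous case with i and j
  exchanged and the sign changed.\<close>

lemma loop_integral_second:
  fixes f :: "real^3 \<Rightarrow> real"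
  assumes f: "continuous_on UNIV f" and B: "\<And>x. \<bar>f x\<bar> \<le> B" and h: "0 < h"
  shows "(\<integral>t. indicator {0..1} t * (h * - dprof (1 - t) * f (loop0 i j h t)) \<partial>lborel)
    = integral {0..h} (\<lambda>s. f (s *\<^sub>R axis j 1 + h *\<^sub>R axis i 1)) - integral {0..h} (\<lambda>s. f (s *\<^sub>R axis j 1))"
proof -
  have "(\<integral>t. indicator {0..1} t * (h * - dprof (1 - t) * f (loop0 i j h t)) \<partial>lborel)
    = (\<integral>t. - (indicator {0..1} t * (h * dprof t * f (loop0 j i h t))) \<partial>lborel)"
    using lborel_integral_unit_reflect[of "\<lambda>t. h * - dprof (1 - t) * f (loop0 i j h t)"]
    by (simp add: loop0_reflect)
  also have "\<dots> = - (\<integral>t. indicator {0..1} t * (h * dprof t * f (loop0 j i h t)) \<partial>lborel)"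
    by (rule Bochner_Integration.integral_minus)
  finally show ?thesis unfolding loop_integral_first[OF f B h] by simp
qed

text \<open>\<open>curve_current\<close> for a Borel field, with \<open>lborel\<close> and the
  explicit velocity, in the form that Fubini accepts.\<close>

definition circ :: "(real^3 \<Rightarrow> real^3) \<Rightarrow> 3 \<Rightarrow> 3 \<Rightarrow> real \<Rightarrow> real^3 \<Rightarrow> real" where
  "circ F i j h y = (\<integral>t. indicator {0..1} t * (F (loop i j h y t) \<bullet> dloop i j h t) \<partial>lborel)"

lemma circ_swap: "circ F j i h y = - circ F i j h y"
proof -
  have "circ F j i h y = (\<integral>t. - (indicator {0..1} t * (F (loop i j h y t) \<bullet> dloop i j h t)) \<partial>lborel)"
    unfolding circ_def
    by (subst lborel_integral_unit_reflect) (simp add: loop_def loop0_reflect dloop_reflect)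
  also have "\<dots> = - circ F i j h y" unfolding circ_def by (rule Bochner_Integration.integral_minus)
  finally show ?thesis .
qed

text \<open>Stokes' formula in embryo: differentiating the integral over a square leaves the
  difference of the integrals over two opposite sides.\<close>

lemma partial_slide_slide:
  assumes \<eta>: "smooth \<eta>" and h: "0 \<le> h"
  shows "partial i (slide i h (slide j h \<eta>)) x = slide j h \<eta> x - slide j h \<eta> (x - h *\<^sub>R axis i 1)"
    "partial j (slide i h (slide j h \<eta>)) x = slide i h \<eta> x - slide i h \<eta> (x - h *\<^sub>R axis j 1)"
proof -
  have sm: "smooth (slide j h \<eta>)" by (rule smooth_slide[OF \<eta>])
  show "partial i (slide i h (slide j h \<eta>)) x = slide j h \<eta> x - slide j h \<eta> (x - h *\<^sub>R axis i 1)"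
    unfolding partial_slide[OF sm] by (rule slide_partial[OF sm h])
  have "partial j (slide j h \<eta>) = (\<lambda>x. \<eta> x - \<eta> (x - h *\<^sub>R axis j 1))"
    unfolding partial_slide[OF \<eta>] using slide_partial[OF \<eta> h] by auto
  then have "partial j (slide i h (slide j h \<eta>)) x = slide i h (\<lambda>x. \<eta> x - \<eta> (x - h *\<^sub>R axis j 1)) x"
    unfolding partial_slide[OF sm] by simp
  also have "\<dots> = integral {0..h} (\<lambda>s. \<eta> (x - s *\<^sub>R axis i 1)) - integral {0..h} (\<lambda>s. \<eta> (x - s *\<^sub>R axis i 1 - h *\<^sub>R axis j 1))"
    unfolding slide_def
    using slide_integrable[OF smooth_continuous[OF \<eta>]] slide_integrable[OF smooth_continuous[OF smooth_translate(1)[OF \<eta>]]]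
    by (intro Henstock_Kurzweil_Integration.integral_diff) auto
  also have "\<dots> = slide i h \<eta> x - slide i h \<eta> (x - h *\<^sub>R axis j 1)"
    by (simp add: slide_def diff_diff_eq add.commute)
  finally show "partial j (slide i h (slide j h \<eta>)) x = slide i h \<eta> x - slide i h \<eta> (x - h *\<^sub>R axis j 1)" .
qed

text \<open>
  Averaging the circulation over translated squares turns it into a pairing of the field with the
  curl of a smoothed test function.
\<close>

lemma integral_test_circ:
  assumes Fm [measurable]: "F \<in> borel_measurable borel" and Fi: "\<And>k. integrable lborel (\<lambda>x. F x $ k)"
    and \<eta>: "test_fun U \<eta>" and h: "0 < h"
  shows "(\<integral>y. \<eta> y * circ F i j h y \<partial>lborel)
    = (\<integral>x. F x $ i * partial j (slide i h (slide j h \<eta>)) x - F x $ j * partial i (slide i h (slide j h \<eta>)) x \<partial>lborel)"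
    "circ F i j h \<in> borel_measurable borel"
proof -
  have sm: "smooth \<eta>" using \<eta> by (rule test_fun_smooth)
  obtain B where B: "\<And>x. \<bar>\<eta> x\<bar> \<le> B" using test_fun_bounded[OF \<eta>] by metis
  have \<eta>m [measurable]: "\<eta> \<in> borel_measurable borel" by (rule smooth_measurable[OF sm])
  \<comment> \<open>The two components of the velocity serve as weights, so that the circulation
    becomes a sum of two averages of the kind treated by \<open>shift_fubini\<close>.\<close>
  let ?w1 = "\<lambda>t. indicator {0..1} t * (h * dprof t)"
  let ?w2 = "\<lambda>t. indicator {0..1} t * (h * - dprof (1 - t))"
  have w1: "integrable lborel ?w1"
    using integrable_lborel_mult_bounded[OF integrable_indicator_Icc, of "\<lambda>t. h * dprof t" "h * 4" 0 1] h dprof_bound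
    by (simp add: abs_mult mult.commute)
  have w2: "integrable lborel ?w2"
    using integrable_lborel_mult_bounded[OF integrable_indicator_Icc, of "\<lambda>t. h * - dprof (1 - t)" "h * 4" 0 1] h dprof_bound
    by (simp add: abs_mult mult.commute)
  have lm: "loop0 i j h \<in> borel_measurable borel" by measurable
  have dm [measurable]: "dloop i j h \<in> borel_measurable borel" unfolding dloop_def[abs_def] by measurable
  have split: "indicator {0..1} t * (F (loop i j h y t) \<bullet> dloop i j h t)
    = ?w1 t * F (y + loop0 i j h t) $ i + ?w2 t * F (y + loop0 i j h t) $ j" for y t
    by (simp add: loop_def dloop_def inner_axis algebra_simps)
  show cm: "circ F i j h \<in> borel_measurable borel"
    unfolding circ_def[abs_def] loop_def by measurable
  let ?W1 = "\<lambda>y. \<integral>t. ?w1 t * F (y + loop0 i j h t) $ i \<partial>lborel"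
  let ?W2 = "\<lambda>y. \<integral>t. ?w2 t * F (y + loop0 i j h t) $ j \<partial>lborel"
  have iW: "integrable lborel ?W1" "integrable lborel ?W2"
    by (rule shift_fubini_integrable[OF Fi w1 lm \<eta>m B] shift_fubini_integrable[OF Fi w2 lm \<eta>m B])+
  \<comment> \<open>Splitting the circulation requires both parts to be integrable in t, which
    Fubini grants for almost every corner y.\<close>
  have ae: "AE y in lborel. \<eta> y * circ F i j h y = \<eta> y * ?W1 y + \<eta> y * ?W2 y"
    using shift_fubini_AE[OF Fi w1 lm \<eta>m B, of i] shift_fubini_AE[OF Fi w2 lm \<eta>m B, of j]
  proof eventually_elim
    case (elim y)
    then show ?case unfolding circ_def split by (simp add: right_diff_distrib)
  qed
  have iW': "integrable lborel (\<lambda>y. \<eta> y * ?W1 y)" "integrable lborel (\<lambda>y. \<eta> y * ?W2 y)"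
    by (rule integrable_lborel_mult_bounded[OF iW(1) \<eta>m B] integrable_lborel_mult_bounded[OF iW(2) \<eta>m B])+
  have "(\<integral>y. \<eta> y * circ F i j h y \<partial>lborel) = (\<integral>y. \<eta> y * ?W1 y + \<eta> y * ?W2 y \<partial>lborel)"
  proof (rule integral_cong_AE[OF _ _ ae])
    show "(\<lambda>y. \<eta> y * circ F i j h y) \<in> borel_measurable lborel" using cm by simp
    show "(\<lambda>y. \<eta> y * ?W1 y + \<eta> y * ?W2 y) \<in> borel_measurable lborel"
      using iW' by (intro borel_measurable_add) auto
  qed
  also have "\<dots> = (\<integral>y. \<eta> y * ?W1 y \<partial>lborel) + (\<integral>y. \<eta> y * ?W2 y \<partial>lborel)"
    by (rule Bochner_Integration.integral_add[OF iW'])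
  also have "(\<integral>y. \<eta> y * ?W1 y \<partial>lborel) = (\<integral>x. F x $ i * (\<integral>t. ?w1 t * \<eta> (x - loop0 i j h t) \<partial>lborel) \<partial>lborel)"
    by (rule shift_fubini_eq[OF Fi w1 lm \<eta>m B])
  also have "(\<integral>y. \<eta> y * ?W2 y \<partial>lborel) = (\<integral>x. F x $ j * (\<integral>t. ?w2 t * \<eta> (x - loop0 i j h t) \<partial>lborel) \<partial>lborel)"
    by (rule shift_fubini_eq[OF Fi w2 lm \<eta>m B])
  \<comment> \<open>This weight runs along the two sides parallel to direction i; their difference
    is the j-th derivative of the doubly slid test function.\<close>
  also have "(\<lambda>x. \<integral>t. ?w1 t * \<eta> (x - loop0 i j h t) \<partial>lborel) = partial j (slide i h (slide j h \<eta>))"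
  proof
    fix x
    have c: "continuous_on UNIV (\<lambda>z. \<eta> (x - z))"
      by (rule continuous_on_compose2[OF smooth_continuous[OF sm, of UNIV]]) (auto intro!: continuous_intros)
    have "(\<integral>t. ?w1 t * \<eta> (x - loop0 i j h t) \<partial>lborel) = (\<integral>t. indicator {0..1} t * (h * dprof t * \<eta> (x - loop0 i j h t)) \<partial>lborel)"
      by (simp add: mult.assoc)
    also have "\<dots> = slide i h \<eta> x - slide i h \<eta> (x - h *\<^sub>R axis j 1)"
      unfolding loop_integral_first[OF c B h] slide_def by (simp add: diff_diff_eq add.commute)
    finally show "(\<integral>t. ?w1 t * \<eta> (x - loop0 i j h t) \<partial>lborel) = partial j (slide i h (slide j h \<eta>)) x"
      using partial_slide_slide(2)[OF sm, where h = h and i = i and j = j and x = x] h by simp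
  qed
  also have "(\<lambda>x. \<integral>t. ?w2 t * \<eta> (x - loop0 i j h t) \<partial>lborel) = (\<lambda>x. - partial i (slide i h (slide j h \<eta>)) x)"
  proof
    fix x
    have c: "continuous_on UNIV (\<lambda>z. \<eta> (x - z))"
      by (rule continuous_on_compose2[OF smooth_continuous[OF sm, of UNIV]]) (auto intro!: continuous_intros)
    have "(\<integral>t. ?w2 t * \<eta> (x - loop0 i j h t) \<partial>lborel) = (\<integral>t. indicator {0..1} t * (h * - dprof (1 - t) * \<eta> (x - loop0 i j h t)) \<partial>lborel)"
      by (simp add: mult.assoc)
    also have "\<dots> = slide j h \<eta> (x - h *\<^sub>R axis i 1) - slide j h \<eta> x"
      unfolding loop_integral_second[OF c B h] slide_def by (simp add: diff_diff_eq add.commute)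
    finally show "(\<integral>t. ?w2 t * \<eta> (x - loop0 i j h t) \<partial>lborel) = - partial i (slide i h (slide j h \<eta>)) x"
      using partial_slide_slide(1)[OF sm, where h = h and i = i and j = j and x = x] h by simp
  qed
  finally have "(\<integral>y. \<eta> y * circ F i j h y \<partial>lborel) = (\<integral>x. F x $ i * partial j (slide i h (slide j h \<eta>)) x \<partial>lborel)
    + (\<integral>x. F x $ j * - partial i (slide i h (slide j h \<eta>)) x \<partial>lborel)" .
  moreover have "integrable lborel (\<lambda>x. F x $ m * partial l (slide i h (slide j h \<eta>)) x)" for m l
  proof -
    obtain K where K: "compact K" "\<And>x. x \<notin> K \<Longrightarrow> \<eta> x = 0" using \<eta> unfolding test_fun_iff by blast
    have t1: "test_fun UNIV (slide j h \<eta>)" by (rule test_fun_slide[OF \<eta> K]) auto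
    obtain K' where K': "compact K'" "\<And>x. x \<notin> K' \<Longrightarrow> slide j h \<eta> x = 0" using t1 unfolding test_fun_iff by blast
    have "test_fun UNIV (slide i h (slide j h \<eta>))" by (rule test_fun_slide[OF t1 K']) auto
    then have t2: "test_fun UNIV (partial l (slide i h (slide j h \<eta>)))" by (rule test_fun_partial)
    obtain C where "\<And>x. \<bar>partial l (slide i h (slide j h \<eta>)) x\<bar> \<le> C" using test_fun_bounded[OF t2] by metis
    from integrable_lborel_mult_bounded[OF Fi smooth_measurable[OF test_fun_smooth[OF t2]] this]
    show ?thesis by (simp add: mult.commute)
  qed
  ultimately show "(\<integral>y. \<eta> y * circ F i j h y \<partial>lborel)
    = (\<integral>x. F x $ i * partial j (slide i h (slide j h \<eta>)) x - F x $ j * partial i (slide i h (slide j h \<eta>)) x \<partial>lborel)"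
    by simp
qed

text \<open>Holds for the cyclic permutations (i, j, k) of (1, 2, 3). Encoding it by the identity
  that the flux estimate consumes allows one proof for all three components.\<close>

definition curl_pair :: "3 \<Rightarrow> 3 \<Rightarrow> 3 \<Rightarrow> bool" where
  "curl_pair i j k \<longleftrightarrow> i \<noteq> j \<and> (\<forall>v N x. v \<bullet> curl_op (\<lambda>y. axis k (N y)) x = v $ i * partial j N x - v $ j * partial i N x)"

lemma ex_curl_pair: "\<exists>i j. curl_pair i j k"
proof -
  have "curl_pair 2 3 1" "curl_pair 3 1 2" "curl_pair 1 2 3"
    by (auto simp: curl_pair_def inner_3 curl_op_nth axis_def)
  then show ?thesis using exhaust_3[of k] by blast
qed

text \<open>An averaged Stokes theorem: the pairing of the k-th component of J with the doubly slid
  \<eta> equals the integral of \<eta> against the circulations of B along squares with corner y.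
  For almost every y in K these are at most 8 h \<delta> in absolute value, and other corners do not
  count because \<eta> vanishes there.\<close>

lemma flux_bound:
  assumes U: "open \<Omega>" "bounded \<Omega>" and \<rho>: "\<rho> \<in> borel_measurable (lebesgue_on \<Omega>)"
    "AE x in lebesgue. x \<in> \<Omega> \<longrightarrow> 0 \<le> \<rho> x \<and> \<rho> x \<le> 1"
    and R: "isoflux_ratio \<Omega> \<rho> B < ereal \<delta>" and \<delta>: "0 < \<delta>"
    and B: "integrable (lebesgue_on \<Omega>) B" and J: "weak_curl \<Omega> B J"
    and ijk: "curl_pair i j k" and h: "0 < h"
    and \<eta>: "test_fun \<Omega> \<eta>" and K: "compact K" "\<And>x. x \<notin> K \<Longrightarrow> \<eta> x = 0"
    and sub: "\<And>x s t. x \<in> K \<Longrightarrow> 0 \<le> s \<Longrightarrow> s \<le> h \<Longrightarrow> 0 \<le> t \<Longrightarrow> t \<le> h \<Longrightarrow> x + s *\<^sub>R axis i 1 + t *\<^sub>R axis j 1 \<in> \<Omega>"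
  shows "test_fun \<Omega> (slide i h (slide j h \<eta>))"
    "\<bar>\<integral>x. J x $ k * slide i h (slide j h \<eta>) x \<partial>lebesgue\<bar> \<le> 8 * h * \<delta> * (\<integral>x. \<bar>\<eta> x\<bar> \<partial>lborel)"
proof -
  have UL: "\<Omega> \<in> sets lebesgue" using U by (simp add: open_lebesgue)
  have ij: "i \<noteq> j" and pair: "\<And>v N x. v \<bullet> curl_op (\<lambda>y. axis k (N y)) x = v $ i * partial j N x - v $ j * partial i N x"
    using ijk by (auto simp: curl_pair_def)
  let ?N = "slide i h (slide j h \<eta>)"
  \<comment> \<open>The sweep of K in direction j; recording the support between the two slides
    keeps the second sweep inside \<Omega>.\<close>
  let ?K1 = "{x + t *\<^sub>R axis j 1 | x t. x \<in> K \<and> 0 \<le> t \<and> t \<le> h}"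
  have t1: "test_fun ?K1 (slide j h \<eta>)" by (rule test_fun_slide[OF \<eta> K]) auto
  then obtain K' where K': "compact K'" "K' \<subseteq> ?K1" "\<And>x. x \<notin> K' \<Longrightarrow> slide j h \<eta> x = 0" unfolding test_fun_iff by blast
  show N: "test_fun \<Omega> ?N"
  proof (rule test_fun_slide[OF t1 K'(1,3)])
    fix x s assume "x \<in> K'" and s: "0 \<le> s" "s \<le> h"
    then obtain y t where y: "x = y + t *\<^sub>R axis j 1" "y \<in> K" "0 \<le> t" "t \<le> h" using K'(2) by auto
    show "x + s *\<^sub>R axis i 1 \<in> \<Omega>" using sub[OF y(2) s y(3,4)] by (simp add: y(1) ac_simps)
  qed
  have bk: "\<exists>b'. b' \<in> borel_measurable borel \<and> integrable lborel b' \<and> (AE x in lborel. indicator \<Omega> x * B x $ m = b' x)" for m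
  proof -
    have "integrable (lebesgue_on \<Omega>) (\<lambda>x. B x $ m)"
      using integrable_inner_left[OF B, of "axis m 1"] by (simp add: inner_axis)
    then have "integrable lebesgue (\<lambda>x. indicator \<Omega> x * B x $ m)"
      using integrable_lebesgue_on_iff[OF UL, of "\<lambda>x. B x $ m"] by (simp add: set_integrable_def)
    then show ?thesis by (rule borel_representative) blast
  qed
  have "\<forall>m. \<exists>b'. b' \<in> borel_measurable borel \<and> integrable lborel b' \<and> (AE x in lborel. indicator \<Omega> x * B x $ m = b' x)"
    using bk by blast
  then obtain b' where b': "\<forall>m. b' m \<in> borel_measurable borel \<and> integrable lborel (b' m) \<and> (AE x in lborel. indicator \<Omega> x * B x $ m = b' m x)"
    unfolding choice_iff by (elim exE)
  \<comment> \<open>A Borel version of B extended by zero, up to null sets.\<close>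
  define F where "F x = (\<chi> m. b' m x)" for x
  have Fm [measurable]: "F \<in> borel_measurable borel"
    using b' by (simp add: borel_measurable_vec_iff F_def)
  have Fi: "integrable lborel (\<lambda>x. F x $ m)" for m using b' by (simp add: F_def)
  have "AE x in lborel. \<forall>m. indicator \<Omega> x * B x $ m = b' m x"
    using b' by (intro AE_all_countable[THEN iffD2]) blast
  then have "AE x in lborel. x \<in> \<Omega> \<longrightarrow> B x = F x"
    by eventually_elim (auto simp: F_def vec_eq_iff)
  then have BF: "AE x in lebesgue. x \<in> \<Omega> \<longrightarrow> B x = F x" by (rule AE_completion)
  then have "AE x in lebesgue. x \<in> \<Omega> \<longrightarrow> precise_rep \<Omega> B x = F x"
    using precise_rep_AE[OF U(1) B] by eventually_elim auto
  then obtain N0 where N0: "N0 \<in> null_sets lebesgue" "{x. \<not> (x \<in> \<Omega> \<longrightarrow> precise_rep \<Omega> B x = F x)} \<subseteq> N0"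
    by (auto simp: eventually_ae_filter)
  \<comment> \<open>A Borel null set off which the precise representative of B equals F in \<Omega>;
    being Borel makes it accessible to Fubini.\<close>
  then obtain S where S: "S \<in> null_sets lborel" "N0 \<subseteq> S"
    using null_sets_completion_iff2[of N0 lborel] by blast
  have PF: "precise_rep \<Omega> B x = F x" if "x \<in> \<Omega>" "x \<notin> S" for x
    using that N0(2) S(2) by blast
  have Sm [measurable]: "S \<in> sets borel" using S(1) by auto
  have Si: "integrable lborel (indicator S :: real^3 \<Rightarrow> real)"
    using S(1) by (simp add: integrable_indicator_iff null_sets_def)
  \<comment> \<open>The time that the loop at y spends in S, integrated over y, equals the measure
    of S times the total time, hence 0. So almost every loop meets S in a null set of
    parameters.\<close>
  have AE_loop: "AE y in lborel. AE t in lborel. t \<in> {0..1} \<longrightarrow> y + loop0 p q h t \<notin> S" for p q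
  proof -
    let ?W = "\<lambda>y. \<integral>t. indicator {0..1} t * indicator S (y + loop0 p q h t) \<partial>lborel :: real"
    have lm: "loop0 p q h \<in> borel_measurable borel" by measurable
    have b1: "\<And>x::real^3. \<bar>1\<bar> \<le> (1::real)" by simp
    note sf = Si integrable_indicator_Icc[of 0 1] lm borel_measurable_const b1
    have Wi: "integrable lborel ?W"
      using shift_fubini_integrable[OF sf] .
    have "(\<integral>y. 1 * ?W y \<partial>lborel) = (\<integral>x. indicator S x * (\<integral>t. indicator {0..1::real} t * 1 \<partial>lborel) \<partial>lborel)"
      using shift_fubini_eq[OF sf] .
    also have "\<dots> = 0" using S(1) by (simp add: measure_def null_sets_def)
    finally have "(\<integral>y. ?W y \<partial>lborel) = 0" by simp
    moreover have "0 \<le> ?W y" for y by (rule integral_nonneg_AE) auto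
    ultimately have "AE y in lborel. ?W y = 0"
      using integral_nonneg_eq_0_iff_AE[OF Wi] by simp
    then show ?thesis
      using shift_fubini_AE[OF sf]
    proof eventually_elim
      case (elim y)
      have "AE t in lborel. indicator {0..1} t * indicator S (y + loop0 p q h t) = (0::real)"
        using integral_nonneg_eq_0_iff_AE[OF elim(2)] elim(1) by simp
      then show ?case by eventually_elim (auto simp: indicator_def)
    qed
  qed
  have loopU: "loop i j h y t \<in> \<Omega>" "loop j i h y t \<in> \<Omega>" if "y \<in> K" for y t
  proof -
    have p: "0 \<le> h * prof r" "h * prof r \<le> h" for r using h prof_bounds[of r] by (auto simp: mult_left_le)
    show "loop i j h y t \<in> \<Omega>" using sub[OF that p p, of t "1 - t"] by (simp add: loop_def loop0_def add.assoc)
    have "loop j i h y t = y + (h * prof (1 - t)) *\<^sub>R axis i 1 + (h * prof t) *\<^sub>R axis j 1"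
      by (simp add: loop_def loop0_def)
    then show "loop j i h y t \<in> \<Omega>" using sub[OF that p p, of "1 - t" t] by simp
  qed
  have circ_le: "circ F p q h y \<le> 8 * h * \<delta>"
    if "p \<noteq> q" "\<And>t. loop p q h y t \<in> \<Omega>" "AE t in lborel. t \<in> {0..1} \<longrightarrow> y + loop0 p q h t \<notin> S" for p q y
  proof -
    have "AE t in lborel. t \<in> {0..1} \<longrightarrow> precise_rep \<Omega> B (loop p q h y t) = F (loop p q h y t)"
      using that(3)
    proof eventually_elim
      case (elim t)
      then show ?case using PF[OF that(2)[of t]] by (simp add: loop_def)
    qed
    then have "AE t in lebesgue. t \<in> {0..1} \<longrightarrow> precise_rep \<Omega> B (loop p q h y t) = F (loop p q h y t)"
      by (rule AE_completion)
    from curve_current_loop_eq[OF Fm this] isoflux_loop_bound[OF U \<rho> R \<delta> that(1) h that(2)]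
    show ?thesis by (simp add: circ_def)
  qed
  have "AE y in lborel. y \<in> K \<longrightarrow> \<bar>circ F i j h y\<bar> \<le> 8 * h * \<delta>"
    using AE_loop[of i j] AE_loop[of j i]
  proof eventually_elim
    case (elim y)
    show ?case
    proof
      assume y: "y \<in> K"
      have "circ F i j h y \<le> 8 * h * \<delta>" by (rule circ_le[OF ij loopU(1)[OF y] elim(1)])
      \<comment> \<open>Exchanging the directions reverses the loop, which bounds the circulation
        from below.\<close>
      moreover have "circ F j i h y \<le> 8 * h * \<delta>" by (rule circ_le[OF ij[symmetric] loopU(2)[OF y] elim(2)])
      ultimately show "\<bar>circ F i j h y\<bar> \<le> 8 * h * \<delta>" unfolding circ_swap[of F j i] by linarith
    qed
  qed
  then have ae: "AE y in lborel. \<bar>\<eta> y * circ F i j h y\<bar> \<le> 8 * h * \<delta> * \<bar>\<eta> y\<bar>"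
  proof eventually_elim
    case (elim y)
    show ?case
    proof (cases "y \<in> K")
      case True
      then show ?thesis using mult_left_mono[OF elim[rule_format, OF True] abs_ge_zero[of "\<eta> y"]] by (simp add: abs_mult mult.commute)
    qed (simp add: K(2))
  qed
  have \<eta>m [measurable]: "\<eta> \<in> borel_measurable borel" by (rule smooth_measurable[OF test_fun_smooth[OF \<eta>]])
  have \<eta>i: "integrable lborel \<eta>"
    using test_fun_integrable[OF \<eta>] integrable_completion[of \<eta> lborel] \<eta>m by simp
  note itc = integral_test_circ[OF Fm Fi \<eta> h, of i j]
  have cm [measurable]: "circ F i j h \<in> borel_measurable borel" by (rule itc(2))
  have bi: "integrable lborel (\<lambda>y. 8 * h * \<delta> * \<bar>\<eta> y\<bar>)" using \<eta>i by simp
  have ci: "integrable lborel (\<lambda>y. \<eta> y * circ F i j h y)"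
    by (rule Bochner_Integration.integrable_bound[OF bi]) (use ae h \<delta> in \<open>auto simp: abs_mult\<close>)
  have "\<bar>\<integral>y. \<eta> y * circ F i j h y \<partial>lborel\<bar> \<le> (\<integral>y. \<bar>\<eta> y * circ F i j h y\<bar> \<partial>lborel)" by (rule integral_abs_bound)
  also have "\<dots> \<le> (\<integral>y. 8 * h * \<delta> * \<bar>\<eta> y\<bar> \<partial>lborel)"
    using integrable_abs[OF ci] bi ae by (rule integral_mono_AE)
  finally have bound: "\<bar>\<integral>y. \<eta> y * circ F i j h y \<partial>lborel\<bar> \<le> 8 * h * \<delta> * (\<integral>x. \<bar>\<eta> x\<bar> \<partial>lborel)" by simp
  have tN: "test_field \<Omega> (\<lambda>x. axis k (?N x))" by (rule test_field_axis[OF N])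
  have BL: "Lp_loc 1 \<Omega> B" using J by (simp add: weak_curl_def)
  have pN [measurable]: "partial m ?N \<in> borel_measurable borel" for m
    by (rule smooth_measurable[OF test_fun_smooth[OF test_fun_partial[OF N]]])
  have "(\<integral>x. J x $ k * ?N x \<partial>lebesgue) = (\<integral>x. B x \<bullet> curl_op (\<lambda>x. axis k (?N x)) x \<partial>lebesgue)"
    unfolding weak_curl_lebesgue[OF J tN] by (simp add: inner_axis)
  also have "\<dots> = (\<integral>x. F x $ i * partial j ?N x - F x $ j * partial i ?N x \<partial>lebesgue)"
  proof (rule integral_cong_AE)
    show "(\<lambda>x. B x \<bullet> curl_op (\<lambda>x. axis k (?N x)) x) \<in> borel_measurable lebesgue"
      by (rule borel_measurable_integrable[OF test_field_integrable[OF BL test_field_curl_op[OF tN]]])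
    show "(\<lambda>x. F x $ i * partial j ?N x - F x $ j * partial i ?N x) \<in> borel_measurable lebesgue"
      by (rule measurable_completion) measurable
    have p0: "partial m ?N x = 0" if "x \<notin> \<Omega>" for m x
      using test_fun_partial[OF N, of m] that unfolding test_fun_iff by blast
    show "AE x in lebesgue. B x \<bullet> curl_op (\<lambda>x. axis k (?N x)) x = F x $ i * partial j ?N x - F x $ j * partial i ?N x"
      unfolding pair using BF
    proof eventually_elim
      case (elim x)
      then show ?case by (cases "x \<in> \<Omega>") (simp_all add: p0)
    qed
  qed
  also have "\<dots> = (\<integral>x. F x $ i * partial j ?N x - F x $ j * partial i ?N x \<partial>lborel)"
    by (rule integral_completion) measurable
  also have "\<dots> = (\<integral>y. \<eta> y * circ F i j h y \<partial>lborel)" by (rule itc(1)[symmetric])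
  finally show "\<bar>\<integral>x. J x $ k * ?N x \<partial>lebesgue\<bar> \<le> 8 * h * \<delta> * (\<integral>x. \<bar>\<eta> x\<bar> \<partial>lborel)"
    using bound by simp
qed

subsection \<open>Weak smallness of the current\<close>

lemma integral_near_const:
  fixes g :: "real \<Rightarrow> real"
  assumes g: "continuous_on {0..h} g" and h: "0 \<le> h" and e: "\<And>s. s \<in> {0..h} \<Longrightarrow> \<bar>g s - c\<bar> \<le> e"
  shows "\<bar>integral {0..h} g - h * c\<bar> \<le> h * e"
proof -
  have gi: "g integrable_on {0..h}" using g by (rule integrable_continuous_interval)
  have "norm (integral {0..h} (\<lambda>s. g s - c)) \<le> e * (h - 0)"
    by (rule integral_bound) (use g h e in \<open>auto intro!: continuous_intros\<close>)
  moreover have "integral {0..h} (\<lambda>s. g s - c) = integral {0..h} g - h * c"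
    using Henstock_Kurzweil_Integration.integral_diff[OF gi integrable_continuous_interval[OF continuous_on_const], of c] h
    by simp
  ultimately show ?thesis by (simp add: mult.commute)
qed

lemma slide_slide_near:
  assumes \<eta>: "smooth \<eta>" and h: "0 < h"
    and e: "\<And>s t. 0 \<le> s \<Longrightarrow> s \<le> h \<Longrightarrow> 0 \<le> t \<Longrightarrow> t \<le> h \<Longrightarrow> \<bar>\<eta> (x - s *\<^sub>R axis i 1 - t *\<^sub>R axis j 1) - \<eta> x\<bar> \<le> e"
  shows "\<bar>slide i h (slide j h \<eta>) x / h\<^sup>2 - \<eta> x\<bar> \<le> e"
proof -
  have c: "continuous_on {0..h} (\<lambda>t. g (y - t *\<^sub>R axis k 1))" if "smooth g" for g y k
    by (rule continuous_on_compose2[OF smooth_continuous[OF that, of UNIV]]) (auto intro!: continuous_intros)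
  have 1: "\<bar>slide j h \<eta> (x - s *\<^sub>R axis i 1) - h * \<eta> x\<bar> \<le> h * e" if "s \<in> {0..h}" for s
    unfolding slide_def by (rule integral_near_const[OF c[OF \<eta>]]) (use h e that in auto)
  have "\<bar>slide i h (slide j h \<eta>) x - h * (h * \<eta> x)\<bar> \<le> h * (h * e)"
    unfolding slide_def[of i] by (rule integral_near_const[OF c[OF smooth_slide[OF \<eta>]]]) (use h 1 in auto)
  then have "\<bar>slide i h (slide j h \<eta>) x - h\<^sup>2 * \<eta> x\<bar> \<le> h\<^sup>2 * e" by (simp add: power2_eq_square mult.assoc)
  then have "\<bar>slide i h (slide j h \<eta>) x - h\<^sup>2 * \<eta> x\<bar> / h\<^sup>2 \<le> e" using h by (simp add: divide_le_eq mult.commute)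
  moreover have "\<bar>slide i h (slide j h \<eta>) x - h\<^sup>2 * \<eta> x\<bar> / h\<^sup>2 = \<bar>slide i h (slide j h \<eta>) x / h\<^sup>2 - \<eta> x\<bar>"
  proof -
    have "slide i h (slide j h \<eta>) x / h\<^sup>2 - \<eta> x = (slide i h (slide j h \<eta>) x - h\<^sup>2 * \<eta> x) / h\<^sup>2"
      using h by (simp add: diff_divide_distrib)
    then show ?thesis by (simp add: abs_divide)
  qed
  ultimately show ?thesis by simp
qed

text \<open>The ball of radius R + 1 contains the support with margin 1, so when one of the two
  points lies outside it, a shift shorter than 1 leaves both points off the support.\<close>

lemma test_fun_uniformly_continuous:
  assumes \<eta>: "test_fun U \<eta>" and e: "0 < e"
  obtains d where "0 < d" "\<And>x v. norm v < d \<Longrightarrow> \<bar>\<eta> (x - v) - \<eta> x\<bar> \<le> e"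
proof -
  obtain K where K: "compact K" "\<And>x. x \<notin> K \<Longrightarrow> \<eta> x = 0" using \<eta> unfolding test_fun_iff by blast
  obtain R where R: "0 < R" "\<And>x. x \<in> K \<Longrightarrow> norm x \<le> R"
    using compact_imp_bounded[OF K(1)] unfolding bounded_pos by auto
  let ?C = "cball (0::real^3) (R + 1)"
  have "uniformly_continuous_on ?C \<eta>"
    by (intro compact_uniformly_continuous smooth_continuous test_fun_smooth[OF \<eta>]) auto
  then obtain d where d: "0 < d" "\<And>x y. x \<in> ?C \<Longrightarrow> y \<in> ?C \<Longrightarrow> dist y x < d \<Longrightarrow> dist (\<eta> y) (\<eta> x) < e"
    unfolding uniformly_continuous_on_def using e by metis
  have "\<bar>\<eta> (x - v) - \<eta> x\<bar> \<le> e" if v: "norm v < min d 1" for x v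
  proof (cases "x \<in> ?C \<and> x - v \<in> ?C")
    case True
    then have "dist (\<eta> (x - v)) (\<eta> x) < e" using v by (intro d(2)) (auto simp: dist_norm)
    then show ?thesis by (simp add: dist_real_def)
  next
    case False
    have "norm x \<le> norm (x - v) + norm v" "norm (x - v) \<le> norm x + norm v"
      using norm_triangle_ineq[of "x - v" v] norm_triangle_ineq4[of x v] by auto
    then have "R < norm x" "R < norm (x - v)" using False v by auto
    then have "x \<notin> K" "x - v \<notin> K" using R(2)[of x] R(2)[of "x - v"] by auto
    then show ?thesis using K(2) e by simp
  qed
  then show ?thesis using that[of "min d 1"] d(1) by simp
qed

text \<open>Collects what varies with \<epsilon>. Quantifying over these objects after \<delta>
  makes the smallness uniform in \<epsilon>; M is the only size of J that enters.\<close>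

definition isoflux_data :: "(real^3) set \<Rightarrow> real \<Rightarrow> (real^3 \<Rightarrow> real) \<Rightarrow> (real^3 \<Rightarrow> real^3) \<Rightarrow> (real^3 \<Rightarrow> real^3) \<Rightarrow> bool" where
  "isoflux_data \<Omega> M \<rho> B J \<longleftrightarrow> \<rho> \<in> borel_measurable (lebesgue_on \<Omega>) \<and>
     (AE x in lebesgue. x \<in> \<Omega> \<longrightarrow> 0 \<le> \<rho> x \<and> \<rho> x \<le> 1) \<and>
     integrable (lebesgue_on \<Omega>) B \<and> weak_curl \<Omega> B J \<and>
     L2 (lebesgue_on \<Omega>) J \<and> (\<integral>x. (norm (J x))\<^sup>2 \<partial>(lebesgue_on \<Omega>)) \<le> M"

text \<open>f is replaced by Q, a square average of a test function \<eta>, whose pairing with J is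
  an averaged flux. The error f - Q is paired with J by Young's inequality, which uses only the
  bound M. The shares are \<tau> / 2 and \<tau> / 4 for the two Young terms and \<tau> / 4 for the
  flux.\<close>

lemma weak_smallness_component:
  assumes U: "open \<Omega>" "bounded \<Omega>" and f: "L2 (lebesgue_on \<Omega>) f" and M: "0 \<le> M" and \<tau>: "0 < \<tau>"
  shows "\<exists>\<delta>>0. \<forall>\<rho> B J. isoflux_data \<Omega> M \<rho> B J \<longrightarrow> isoflux_ratio \<Omega> \<rho> B < ereal \<delta> \<longrightarrow>
    \<bar>\<integral>x. J x $ k * f x \<partial>(lebesgue_on \<Omega>)\<bar> < \<tau>"
proof -
  let ?M = "lebesgue_on \<Omega>"
  have UL: "\<Omega> \<in> sets lebesgue" using U by (simp add: open_lebesgue)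
  interpret finite_measure ?M by (rule finite_measure_lebesgue_on[OF UL U(2)])
  define m where "m = measure ?M (space ?M)"
  have m: "0 \<le> m" by (simp add: m_def)
  obtain i j where ijk: "curl_pair i j k" using ex_curl_pair by blast
  \<comment> \<open>c M < \<tau> keeps the J term of Young's inequality below \<tau> / 2, and E is
    then chosen with E / (2 c) = \<tau> / 4.\<close>
  define c where "c = \<tau> / (M + 1)"
  have c: "0 < c" "c * M < \<tau>" using \<tau> M by (auto simp: c_def field_simps)
  define E where "E = c * \<tau> / 2"
  have E: "0 < E" using c \<tau> by (simp add: E_def)
  obtain \<eta> where \<eta>: "test_fun \<Omega> \<eta>" "(\<integral>x. (f x - \<eta> x)\<^sup>2 \<partial>?M) < E / 4"
    using L2_approx_test_fun[OF U f, of "E / 4"] E by auto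
  obtain K where K: "compact K" "K \<subseteq> \<Omega>" "\<And>x. x \<notin> K \<Longrightarrow> \<eta> x = 0"
    using \<eta>(1) unfolding test_fun_iff by blast
  obtain d1 where d1: "0 < d1" "(\<Union>x\<in>K. ball x d1) \<subseteq> \<Omega>"
    using compact_subset_open_imp_ball_epsilon_subset[OF K(1) U(1) K(2)] by metis
  \<comment> \<open>The uniform error allowed between \<eta> and Q: on a set of measure m it
    contributes 2 e^2 m < E / 2, the other half of E being spent on f - \<eta>.\<close>
  define e where "e = sqrt (E / (4 * (m + 1)))"
  have e: "0 < e" "e\<^sup>2 * m < E / 4" using E m by (auto simp: e_def field_simps)
  obtain d2 where d2: "0 < d2" "\<And>x v. norm v < d2 \<Longrightarrow> \<bar>\<eta> (x - v) - \<eta> x\<bar> \<le> e"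
    by (rule test_fun_uniformly_continuous[OF \<eta>(1) e(1)], rule that)
  \<comment> \<open>Points of a square are within 2 h of its corner. Hence squares based in K stay
    in \<Omega>, and \<eta> varies by at most e over a square.\<close>
  define h where "h = min d1 d2 / 3"
  have h: "0 < h" "2 * h < d1" "2 * h < d2" using d1(1) d2(1) by (auto simp: h_def min_def)
  have nv: "norm (s *\<^sub>R axis i 1 + t *\<^sub>R axis j (1::real) :: real^3) \<le> 2 * h"
    if "0 \<le> s" "s \<le> h" "0 \<le> t" "t \<le> h" for s t
    using norm_triangle_ineq[of "s *\<^sub>R axis i (1::real) :: real^3" "t *\<^sub>R axis j 1"] that by simp
  have sub: "x + s *\<^sub>R axis i 1 + t *\<^sub>R axis j 1 \<in> \<Omega>"
    if "x \<in> K" "0 \<le> s" "s \<le> h" "0 \<le> t" "t \<le> h" for x s t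
  proof -
    have e: "x - (x + s *\<^sub>R axis i 1 + t *\<^sub>R axis j 1) = - (s *\<^sub>R axis i 1 + t *\<^sub>R axis j 1)" by simp
    have "x + s *\<^sub>R axis i 1 + t *\<^sub>R axis j 1 \<in> ball x d1"
      unfolding mem_ball dist_norm e norm_minus_cancel using nv[OF that(2-5)] h by linarith
    then show ?thesis using d1(2) that(1) by blast
  qed
  let ?N = "slide i h (slide j h \<eta>)"
  have near: "\<bar>?N x / h\<^sup>2 - \<eta> x\<bar> \<le> e" for x
  proof (rule slide_slide_near[OF test_fun_smooth[OF \<eta>(1)] h(1)])
    fix s t :: real assume "0 \<le> s" "s \<le> h" "0 \<le> t" "t \<le> h"
    then show "\<bar>\<eta> (x - s *\<^sub>R axis i 1 - t *\<^sub>R axis j 1) - \<eta> x\<bar> \<le> e"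
      using d2(2)[of "s *\<^sub>R axis i 1 + t *\<^sub>R axis j 1" x] nv[of s t] h by (simp add: diff_diff_eq)
  qed
  define S where "S = (\<integral>x. \<bar>\<eta> x\<bar> \<partial>lborel)"
  have S: "0 \<le> S" by (simp add: S_def)
  \<comment> \<open>With this T the flux bound 8 h \<delta> S / h^2 becomes \<tau> S / T < \<tau> /
    4; the summand 1 keeps T positive when S = 0.\<close>
  define T where "T = 4 * S + 1"
  have T: "0 < T" using S by (simp add: T_def)
  define \<delta> where "\<delta> = \<tau> * h / (8 * T)"
  have \<delta>: "0 < \<delta>" using \<tau> h T by (simp add: \<delta>_def)
  have \<delta>2: "8 * h * \<delta> * S / h\<^sup>2 < \<tau> / 4"
  proof -
    have "8 * h * \<delta> * S / h\<^sup>2 = \<tau> * S / T" using h T by (simp add: \<delta>_def power2_eq_square)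
    also have "\<dots> < \<tau> / 4" using \<tau> S T by (simp add: divide_simps T_def)
    finally show ?thesis .
  qed
  have "\<bar>\<integral>x. J x $ k * f x \<partial>?M\<bar> < \<tau>"
    if data: "isoflux_data \<Omega> M \<rho> B J" and R: "isoflux_ratio \<Omega> \<rho> B < ereal \<delta>" for \<rho> B J
  proof -
    have \<rho>: "\<rho> \<in> borel_measurable ?M" "AE x in lebesgue. x \<in> \<Omega> \<longrightarrow> 0 \<le> \<rho> x \<and> \<rho> x \<le> 1"
      and B: "integrable ?M B" and wc: "weak_curl \<Omega> B J" and J: "L2 ?M J" "(\<integral>x. (norm (J x))\<^sup>2 \<partial>?M) \<le> M"
      using data by (auto simp: isoflux_data_def)
    note fb = flux_bound[OF U \<rho> R \<delta> B wc ijk h(1) \<eta>(1) K(1,3) sub]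
    have Jk: "L2 ?M (\<lambda>x. J x $ k)" by (rule L2_nth[OF J(1)])
    have JkM: "(\<integral>x. (norm (J x $ k))\<^sup>2 \<partial>?M) \<le> M"
    proof -
      have "(\<integral>x. (norm (J x $ k))\<^sup>2 \<partial>?M) \<le> (\<integral>x. (norm (J x))\<^sup>2 \<partial>?M)"
        using L2_integrable[OF Jk] L2_integrable[OF J(1)]
        by (rule integral_mono) (intro power_mono, auto simp: component_le_norm_cart)
      then show ?thesis using J(2) by simp
    qed
    define Q where "Q x = ?N x / h\<^sup>2" for x
    have Q: "L2 ?M Q"
      using L2_scaleR[OF test_fun_L2[OF U fb(1)], of "inverse (h\<^sup>2)"] by (simp add: Q_def[abs_def] divide_inverse mult.commute)
    have \<eta>2: "L2 ?M \<eta>" by (rule test_fun_L2[OF U \<eta>(1)])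
    have fQ: "(\<integral>x. (norm (f x - Q x))\<^sup>2 \<partial>?M) \<le> E"
    proof -
      have "(\<integral>x. (norm (f x - Q x))\<^sup>2 \<partial>?M) \<le> (\<integral>x. 2 * (f x - \<eta> x)\<^sup>2 + 2 * e\<^sup>2 \<partial>?M)"
      proof (rule integral_mono)
        show "integrable ?M (\<lambda>x. (norm (f x - Q x))\<^sup>2)" by (rule L2_integrable[OF L2_diff[OF f Q]])
        show "integrable ?M (\<lambda>x. 2 * (f x - \<eta> x)\<^sup>2 + 2 * e\<^sup>2)"
          using L2_square_integrable[OF L2_diff[OF f \<eta>2]] by simp
        fix x
        have "(\<eta> x - Q x)\<^sup>2 \<le> e\<^sup>2"
          using near[of x] e(1) by (intro power2_le_iff_abs_le[THEN iffD2]) (auto simp: Q_def abs_minus_commute)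
        moreover have "(f x - Q x)\<^sup>2 \<le> 2 * (f x - \<eta> x)\<^sup>2 + 2 * (\<eta> x - Q x)\<^sup>2"
          using sum_squares_bound[of "f x - \<eta> x" "\<eta> x - Q x"] by (simp add: power2_eq_square algebra_simps)
        ultimately show "(norm (f x - Q x))\<^sup>2 \<le> 2 * (f x - \<eta> x)\<^sup>2 + 2 * e\<^sup>2" by simp
      qed
      also have "\<dots> = 2 * (\<integral>x. (f x - \<eta> x)\<^sup>2 \<partial>?M) + m * (2 * e\<^sup>2)"
        using L2_square_integrable[OF L2_diff[OF f \<eta>2]] by (simp add: m_def)
      also have "\<dots> \<le> E" using \<eta>(2) e(2) by (simp add: algebra_simps)
      finally show ?thesis .
    qed
    have "\<bar>\<integral>x. J x $ k * (f x - Q x) \<partial>?M\<bar> \<le> c / 2 * M + 1 / (2 * c) * E"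
    proof -
      have "\<bar>\<integral>x. J x $ k * (f x - Q x) \<partial>?M\<bar>
        \<le> c / 2 * (\<integral>x. (norm (J x $ k))\<^sup>2 \<partial>?M) + 1 / (2 * c) * (\<integral>x. (norm (f x - Q x))\<^sup>2 \<partial>?M)"
        using L2_young[OF Jk L2_diff[OF f Q] c(1)] by (simp add: inner_real_def)
      also have "\<dots> \<le> c / 2 * M + 1 / (2 * c) * E"
        using c(1) by (intro add_mono mult_left_mono JkM fQ) auto
      finally show ?thesis .
    qed
    also have "\<dots> < \<tau> / 2 + \<tau> / 4"
    proof -
      have "1 / (2 * c) * E = \<tau> / 4" using c(1) by (simp add: E_def)
      moreover have "c / 2 * M < \<tau> / 2" using c(2) by (simp add: mult.commute)
      ultimately show ?thesis by linarith
    qed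
    finally have b1: "\<bar>\<integral>x. J x $ k * (f x - Q x) \<partial>?M\<bar> < \<tau> / 2 + \<tau> / 4" .
    have N0: "?N x = 0" if "x \<notin> \<Omega>" for x using fb(1) that unfolding test_fun_iff by blast
    have "(\<integral>x. J x $ k * Q x \<partial>?M) = (\<integral>x. J x $ k * ?N x \<partial>?M) / h\<^sup>2" by (simp add: Q_def)
    also have "(\<integral>x. J x $ k * ?N x \<partial>?M) = (\<integral>x. J x $ k * ?N x \<partial>lebesgue)"
      by (rule integral_lebesgue_on_indicator(1)[OF UL]) (simp add: N0)
    finally have "\<bar>\<integral>x. J x $ k * Q x \<partial>?M\<bar> = \<bar>\<integral>x. J x $ k * ?N x \<partial>lebesgue\<bar> / h\<^sup>2" by (simp add: abs_divide)
    also have "\<dots> \<le> 8 * h * \<delta> * S / h\<^sup>2" using fb(2) h(1) unfolding S_def by (intro divide_right_mono) auto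
    finally have b2: "\<bar>\<integral>x. J x $ k * Q x \<partial>?M\<bar> < \<tau> / 4" using \<delta>2 by linarith
    have "(\<integral>x. J x $ k * f x \<partial>?M) = (\<integral>x. J x $ k * (f x - Q x) + J x $ k * Q x \<partial>?M)"
      by (simp add: right_diff_distrib)
    also have "\<dots> = (\<integral>x. J x $ k * (f x - Q x) \<partial>?M) + (\<integral>x. J x $ k * Q x \<partial>?M)"
      by (intro Bochner_Integration.integral_add L2_mult_integrable Jk L2_diff f Q)
    finally show ?thesis using b1 b2 by linarith
  qed
  then show ?thesis using \<delta> by blast
qed

proposition weak_smallness:
  assumes U: "open \<Omega>" "bounded \<Omega>" and f: "L2 (lebesgue_on \<Omega>) f" and M: "0 \<le> M" and \<tau>: "0 < \<tau>"
  shows "\<exists>\<delta>>0. \<forall>\<rho> B J. isoflux_data \<Omega> M \<rho> B J \<longrightarrow> isoflux_ratio \<Omega> \<rho> B < ereal \<delta> \<longrightarrow>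
    \<bar>\<integral>x. J x \<bullet> f x \<partial>(lebesgue_on \<Omega>)\<bar> < \<tau>"
proof -
  have "\<forall>k. \<exists>\<delta>. 0 < \<delta> \<and> (\<forall>\<rho> B J. isoflux_data \<Omega> M \<rho> B J \<longrightarrow> isoflux_ratio \<Omega> \<rho> B < ereal \<delta> \<longrightarrow>
    \<bar>\<integral>x. J x $ k * f x $ k \<partial>(lebesgue_on \<Omega>)\<bar> < \<tau> / 3)"
    by (intro allI weak_smallness_component[OF U L2_nth[OF f] M]) (use \<tau> in simp)
  from choice[OF this] obtain d where d': "\<forall>k. 0 < d k \<and> (\<forall>\<rho> B J. isoflux_data \<Omega> M \<rho> B J \<longrightarrow>
    isoflux_ratio \<Omega> \<rho> B < ereal (d k) \<longrightarrow> \<bar>\<integral>x. J x $ k * f x $ k \<partial>(lebesgue_on \<Omega>)\<bar> < \<tau> / 3)" ..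
  note d = d'[rule_format, THEN conjunct1] d'[THEN spec, THEN conjunct2, rule_format]
  define \<delta> where "\<delta> = min (d 1) (min (d 2) (d 3))"
  have \<delta>: "0 < \<delta>" using d(1) by (simp add: \<delta>_def)
  have "\<bar>\<integral>x. J x \<bullet> f x \<partial>(lebesgue_on \<Omega>)\<bar> < \<tau>"
    if data: "isoflux_data \<Omega> M \<rho> B J" and R: "isoflux_ratio \<Omega> \<rho> B < ereal \<delta>" for \<rho> B J
  proof -
    have J: "L2 (lebesgue_on \<Omega>) J" using data by (simp add: isoflux_data_def)
    have i: "integrable (lebesgue_on \<Omega>) (\<lambda>x. J x $ k * f x $ k)" for k
      by (intro L2_mult_integrable L2_nth J f)
    have lt: "isoflux_ratio \<Omega> \<rho> B < ereal (d k)" for k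
    proof -
      have "\<delta> \<le> d k" using exhaust_3[of k] by (auto simp: \<delta>_def)
      then show ?thesis using R by (meson ereal_less_eq(3) order_less_le_trans)
    qed
    have "(\<integral>x. J x \<bullet> f x \<partial>(lebesgue_on \<Omega>)) = (\<integral>x. J x $ 1 * f x $ 1 \<partial>(lebesgue_on \<Omega>))
      + (\<integral>x. J x $ 2 * f x $ 2 \<partial>(lebesgue_on \<Omega>)) + (\<integral>x. J x $ 3 * f x $ 3 \<partial>(lebesgue_on \<Omega>))"
      using i by (simp add: inner_3)
    then show ?thesis using d(2)[OF data lt, of 1] d(2)[OF data lt, of 2] d(2)[OF data lt, of 3] by linarith
  qed
  then show ?thesis using \<delta> by blast
qed

subsection \<open>Conclusion\<close>

lemma test_fun_L2_lebesgue:
  assumes \<eta>: "test_fun U \<eta>"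
  shows "L2 lebesgue \<eta>"
  using test_fun_integrable[OF test_fun_mult[OF \<eta> test_fun_smooth[OF \<eta>]]]
    smooth_measurable_lebesgue[OF test_fun_smooth[OF \<eta>]]
  by (simp add: L2_def power2_eq_square)

lemma test_field_mono: "test_field U F \<Longrightarrow> U \<subseteq> W \<Longrightarrow> test_field W F"
  unfolding test_field_def by (auto intro: test_fun_mono)

text \<open>
  Inside \<open>\<Omega>\<close> the curl of \<open>X = A - grad \<phi>\<close> is \<open>Hex + curl (A - Aex)\<close>, so a field \<open>Hex\<close> that does not
  vanish bounds the energy from below.
\<close>

lemma energy_lower_bound:
  assumes U: "open U" "bounded U" and \<psi>: "test_field U \<psi>"
    and V: "V \<in> dotH1_sigma" and Hex: "weak_curl UNIV Aex Hex"
    and \<phi>: "weak_grad U \<phi> G" and X: "L2 (lebesgue_on U) X" "\<And>x. X x = Aex x + V x - G x"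
    and c: "0 < c"
  shows "\<bar>\<integral>x. Hex x \<bullet> \<psi> x \<partial>lebesgue\<bar> \<le>
    c / 2 * ((\<integral>x. (norm (X x))\<^sup>2 \<partial>(lebesgue_on U)) + (\<integral>x. (norm (wcurl UNIV V x))\<^sup>2 \<partial>lebesgue))
    + 1 / (2 * c) * ((\<integral>x. (norm (curl_op \<psi> x))\<^sup>2 \<partial>(lebesgue_on U)) + (\<integral>x. (norm (\<psi> x))\<^sup>2 \<partial>lebesgue))"
proof -
  have UL: "U \<in> sets lebesgue" using U by (simp add: open_lebesgue)
  note VP = dotH1_sigma_props[OF V]
  have \<psi>': "test_field UNIV \<psi>" by (rule test_field_mono[OF \<psi>]) simp
  note cu = test_field_curl_op[OF \<psi>] and cu' = test_field_curl_op[OF \<psi>']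
  have AL: "Lp_loc 1 UNIV Aex" and HL: "Lp_loc 1 UNIV Hex" using Hex by (auto simp: weak_curl_def)
  have VL: "Lp_loc 1 UNIV V" using VP(2) by (simp add: weak_curl_def)
  have GL: "Lp_loc 1 U G" using \<phi> by (simp add: weak_grad_def)
  have "(\<integral>x. X x \<bullet> curl_op \<psi> x \<partial>lebesgue) = (\<integral>x. Aex x \<bullet> curl_op \<psi> x + V x \<bullet> curl_op \<psi> x - G x \<bullet> curl_op \<psi> x \<partial>lebesgue)"
    by (simp add: X(2) inner_add_left inner_diff_left)
  also have "\<dots> = (\<integral>x. Aex x \<bullet> curl_op \<psi> x \<partial>lebesgue) + (\<integral>x. V x \<bullet> curl_op \<psi> x \<partial>lebesgue) - (\<integral>x. G x \<bullet> curl_op \<psi> x \<partial>lebesgue)"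
    using test_field_integrable[OF AL cu'] test_field_integrable[OF VL cu'] test_field_integrable[OF GL cu] by simp
  finally have id: "(\<integral>x. X x \<bullet> curl_op \<psi> x \<partial>lebesgue) = (\<integral>x. Hex x \<bullet> \<psi> x \<partial>lebesgue) + (\<integral>x. wcurl UNIV V x \<bullet> \<psi> x \<partial>lebesgue)"
    unfolding weak_curl_lebesgue[OF Hex \<psi>'] weak_curl_lebesgue[OF VP(2) \<psi>'] weak_grad_orth_curl[OF \<phi> \<psi>] by simp
  have on: "(\<integral>x. X x \<bullet> curl_op \<psi> x \<partial>lebesgue) = (\<integral>x. X x \<bullet> curl_op \<psi> x \<partial>(lebesgue_on U))"
    unfolding test_field_set_integral[OF cu, symmetric] by (rule integral_lebesgue_on[OF UL])
  have c2: "L2 (lebesgue_on U) (curl_op \<psi>)"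
    by (rule L2_vec) (rule test_fun_L2[OF U test_field_test_fun[OF cu]])
  have p2: "L2 lebesgue \<psi>"
    by (rule L2_vec) (rule test_fun_L2_lebesgue[OF test_field_test_fun[OF \<psi>]])
  show ?thesis
    using L2_young[OF X(1) c2 c] L2_young[OF VP(3) p2 c] id on
    by (simp add: distrib_left)
qed

theorem proposition1p2:
  fixes \<Omega> :: "(real^3) set" and \<nu> :: "real^3 \<Rightarrow> real^3"
    and b :: real and a :: "real \<Rightarrow> real^3 \<Rightarrow> real"
    and Hex Aex :: "real^3 \<Rightarrow> real^3"
    and \<rho> :: "real \<Rightarrow> real^3 \<Rightarrow> real"
    and \<Phi> :: "real \<Rightarrow> (real^3 \<Rightarrow> real^3) \<Rightarrow> real^3 \<Rightarrow> real"
    and A0 B0 :: "real \<Rightarrow> real^3 \<Rightarrow> real^3"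
  assumes "open \<Omega>" "\<Omega> \<noteq> {}" "connected \<Omega>" "bounded \<Omega>"
    and "simply_connected \<Omega>" "connected (frontier \<Omega>)"
    and "C2_boundary \<Omega>" "\<And>p. p \<in> frontier \<Omega> \<Longrightarrow> outer_unit_normal \<Omega> p (\<nu> p)"
    and "0 < b" "b < 1"
    and "\<And>\<epsilon>. \<epsilon> > 0 \<Longrightarrow> set_borel_measurable lebesgue \<Omega> (a \<epsilon>)"
    and "\<And>\<epsilon>. \<epsilon> > 0 \<Longrightarrow> AE x in lebesgue. x \<in> \<Omega> \<longrightarrow> b \<le> a \<epsilon> x \<and> a \<epsilon> x \<le> 1"
    and "Lp_loc 2 UNIV Hex" "weak_div UNIV Hex (\<lambda>_. 0)" "Lp_on 3 \<Omega> Hex"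
    and "H1_loc_field Aex" "weak_curl UNIV Aex Hex" "weak_div UNIV Aex (\<lambda>_. 0)"
    and "\<And>\<epsilon>. \<epsilon> > 0 \<Longrightarrow> positive_minimizer \<Omega> (a \<epsilon>) \<epsilon> (\<rho> \<epsilon>)"
    and "\<And>\<epsilon> A. \<epsilon> > 0 \<Longrightarrow> A \<in> admissible Aex \<Longrightarrow> neumann_solution \<Omega> (\<rho> \<epsilon>) A (\<Phi> \<epsilon> A)"
    and "\<And>\<epsilon>. \<epsilon> > 0 \<Longrightarrow> J_minimizer \<Omega> (\<rho> \<epsilon>) (\<Phi> \<epsilon>) Aex (A0 \<epsilon>)"
    and "\<And>\<epsilon>. \<epsilon> > 0 \<Longrightarrow> B_field_of \<Omega> \<nu> (\<rho> \<epsilon>) (A0 \<epsilon>) (\<Phi> \<epsilon> (A0 \<epsilon>)) (B0 \<epsilon>)"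
    and curl_nonzero: "\<not> weak_curl \<Omega> Hex (\<lambda>_. 0)"
  shows "Liminf (at_right 0) (\<lambda>\<epsilon>. isoflux_ratio \<Omega> (\<rho> \<epsilon>) (B0 \<epsilon>)) > 0"
proof -
  have U: "open \<Omega>" "bounded \<Omega>" by (fact assms)+
  have UL: "\<Omega> \<in> sets lebesgue" using U by (simp add: open_lebesgue)
  let ?M = "lebesgue_on \<Omega>"
  have b: "0 < b" "b < 1" by (fact assms)+
  \<comment> \<open>The level for \<rho> itself: a \<ge> b corresponds to \<rho> \<ge> sqrt
    b.\<close>
  define l where "l = sqrt b"
  have l: "0 < l" "l < 1" "l\<^sup>2 = b" using b by (auto simp: l_def)
  have am: "set_borel_measurable lebesgue \<Omega> (a \<epsilon>)" and
    ab: "AE x in lebesgue. x \<in> \<Omega> \<longrightarrow> b \<le> a \<epsilon> x \<and> a \<epsilon> x \<le> 1" and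
    pm: "positive_minimizer \<Omega> (a \<epsilon>) \<epsilon> (\<rho> \<epsilon>)" and
    neu: "\<And>A. A \<in> admissible Aex \<Longrightarrow> neumann_solution \<Omega> (\<rho> \<epsilon>) A (\<Phi> \<epsilon> A)" and
    Jm: "J_minimizer \<Omega> (\<rho> \<epsilon>) (\<Phi> \<epsilon>) Aex (A0 \<epsilon>)" and
    Bf: "B_field_of \<Omega> \<nu> (\<rho> \<epsilon>) (A0 \<epsilon>) (\<Phi> \<epsilon> (A0 \<epsilon>)) (B0 \<epsilon>)"
    if "0 < \<epsilon>" for \<epsilon>
    using that assms by blast+
  have Hex: "weak_curl UNIV Aex Hex" and Hex2: "Lp_loc 2 UNIV Hex" and H1A: "H1_loc_field Aex"
    by (fact assms)+
  have Aex: "L2 ?M Aex"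
  proof (rule L2_vec)
    show "L2 ?M (\<lambda>x. Aex x $ i)" for i
      using H1A by (intro Lp_loc_2_L2 U) (simp add: H1_loc_field_def)
  qed
  define M where "M = (\<integral>x. (norm (Aex x))\<^sup>2 \<partial>?M)"
  have M0: "0 \<le> M" by (simp add: M_def)
  \<comment> \<open>Since Hex is locally integrable, failure of the weak equation curl Hex = 0 in
    \<Omega> means that some test field detects it.\<close>
  obtain \<xi> where \<xi>: "test_field \<Omega> \<xi>" "(\<integral>x. Hex x \<bullet> curl_op \<xi> x \<partial>lebesgue) \<noteq> 0"
  proof (rule ccontr)
    note th = that
    assume n: "\<not> thesis"
    have "weak_curl \<Omega> Hex (\<lambda>_. 0)"
    proof (rule weak_curlI)
      show "Lp_loc 1 \<Omega> Hex"
        using Lp_loc_1_of_Lp_loc_2[OF Hex2] by (simp add: Lp_loc_def)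
      show "Lp_loc 1 \<Omega> (\<lambda>_. 0 :: real^3)" by (simp add: Lp_loc_1_iff set_integrable_def)
      show "(\<integral>x. Hex x \<bullet> curl_op \<psi> x \<partial>lebesgue) = (\<integral>x. 0 \<bullet> \<psi> x \<partial>lebesgue)" if "test_field \<Omega> \<psi>" for \<psi>
        using n th[OF that] by auto
    qed
    with curl_nonzero show False by blast
  qed
  \<comment> \<open>The curl is used twice: Hex, itself the curl of \<open>Aex\<close>, is paired
    with \<psi> = curl \<xi>, and X is tested with the curl of \<psi>.\<close>
  define \<psi> where "\<psi> = curl_op \<xi>"
  have \<psi>: "test_field \<Omega> \<psi>" unfolding \<psi>_def by (rule test_field_curl_op[OF \<xi>(1)])
  define m where "m = \<bar>\<integral>x. Hex x \<bullet> \<psi> x \<partial>lebesgue\<bar>"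
  have m: "0 < m" using \<xi>(2) by (simp add: m_def \<psi>_def)
  define P where "P = (\<integral>x. (norm (curl_op \<psi> x))\<^sup>2 \<partial>?M) + (\<integral>x. (norm (\<psi> x))\<^sup>2 \<partial>lebesgue)"
  have P: "0 \<le> P" by (simp add: P_def)
  \<comment> \<open>Makes the term with P in the lower bound less than m / 2. The threshold \<tau>
    below is fixed so that the energy term is at most m / 2, and together they contradict m <
    m.\<close>
  define c where "c = (P + 1) / m"
  have c: "0 < c" using m P by (simp add: c_def)
  have cP: "1 / (2 * c) * P < m / 2"
  proof -
    have "1 / (2 * c) * P = m / 2 * (P / (P + 1))" using m by (simp add: c_def)
    also have "\<dots> < m / 2 * 1" using m P by (intro mult_strict_left_mono) auto
    finally show ?thesis by simp
  qed
  define \<tau> where "\<tau> = b * m / c"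
  have \<tau>: "0 < \<tau>" using b m c by (simp add: \<tau>_def)
  \<comment> \<open>\<delta> is determined by \<Omega>, \<open>Aex\<close>, M and \<tau>, none of
    which involves \<epsilon>.\<close>
  obtain \<delta> where \<delta>: "0 < \<delta>" "\<forall>\<rho> B J. isoflux_data \<Omega> M \<rho> B J \<longrightarrow> isoflux_ratio \<Omega> \<rho> B < ereal \<delta> \<longrightarrow>
    \<bar>\<integral>x. J x \<bullet> Aex x \<partial>?M\<bar> < \<tau>"
    using weak_smallness[OF U Aex M0 \<tau>] by (elim exE conjE)
  have main: "ereal \<delta> \<le> isoflux_ratio \<Omega> (\<rho> \<epsilon>) (B0 \<epsilon>)" if \<epsilon>: "0 < \<epsilon>" for \<epsilon>
  proof (rule ccontr)
    assume "\<not> ereal \<delta> \<le> isoflux_ratio \<Omega> (\<rho> \<epsilon>) (B0 \<epsilon>)"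
    then have R: "isoflux_ratio \<Omega> (\<rho> \<epsilon>) (B0 \<epsilon>) < ereal \<delta>" by simp
    have ab': "AE x in lebesgue. x \<in> \<Omega> \<longrightarrow> l\<^sup>2 \<le> a \<epsilon> x \<and> a \<epsilon> x \<le> 1" unfolding l(3) by (rule ab[OF \<epsilon>])
    have \<rho>b: "AE x in lebesgue. x \<in> \<Omega> \<longrightarrow> l \<le> \<rho> \<epsilon> x \<and> \<rho> \<epsilon> x \<le> 1"
      by (rule positive_minimizer_bounds[OF U l(1,2) \<epsilon> am[OF \<epsilon>] ab' pm[OF \<epsilon>]])
    have "H1 \<Omega> (\<rho> \<epsilon>)" using pm[OF \<epsilon>] by (simp add: positive_minimizer_def)
    then have \<rho>m [measurable]: "\<rho> \<epsilon> \<in> borel_measurable ?M" by (intro L2_measurable H1_wgrad(1) U)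
    have \<rho>01: "AE x in lebesgue. x \<in> \<Omega> \<longrightarrow> 0 \<le> \<rho> \<epsilon> x \<and> \<rho> \<epsilon> x \<le> 1"
      using \<rho>b by eventually_elim (use l(1) in auto)
    have \<rho>01': "AE x in ?M. 0 \<le> \<rho> \<epsilon> x \<and> \<rho> \<epsilon> x \<le> 1" unfolding AE_lebesgue_on_iff[OF UL] by (rule \<rho>01)
    have \<rho>l: "AE x in ?M. b \<le> (\<rho> \<epsilon> x)\<^sup>2 \<and> (\<rho> \<epsilon> x)\<^sup>2 \<le> 1"
      unfolding AE_lebesgue_on_iff[OF UL] using \<rho>b
    proof eventually_elim
      case (elim x)
      then show ?case using l power_mono[of l "\<rho> \<epsilon> x" 2] by (auto simp: power_le_one)
    qed
    define V where "V = (\<lambda>x. A0 \<epsilon> x - Aex x)"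
    define G where "G = wgrad \<Omega> (\<Phi> \<epsilon> (A0 \<epsilon>))"
    define X where "X = (\<lambda>x. A0 \<epsilon> x - G x)"
    define J where "J = (\<lambda>x. (\<rho> \<epsilon> x)\<^sup>2 *\<^sub>R X x)"
    define D where "D = (\<integral>x. (\<rho> \<epsilon> x)\<^sup>2 * (norm (X x))\<^sup>2 \<partial>?M)"
    define C where "C = (\<integral>x. (norm (wcurl UNIV V x))\<^sup>2 \<partial>lebesgue)"
    have C0: "0 \<le> C" by (simp add: C_def)
    have V: "V \<in> dotH1_sigma" and X: "L2 ?M X" and DC: "D + C \<le> (\<integral>x. J x \<bullet> Aex x \<partial>?M)"
      unfolding D_def C_def J_def V_def X_def G_def
      by (rule J_minimizer_energy[OF U \<rho>m \<rho>01' Aex _ Jm[OF \<epsilon>]], erule neu[OF \<epsilon>])+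
    note [measurable] = L2_measurable[OF X]
    have J2: "L2 ?M J"
      unfolding J_def
    proof (rule L2_bound[OF X, of _ 1])
      show "AE x in ?M. norm ((\<rho> \<epsilon> x)\<^sup>2 *\<^sub>R X x) \<le> 1 * norm (X x)"
        using \<rho>l by eventually_elim (auto intro!: mult_left_le_one_le)
    qed measurable
    have Di: "integrable ?M (\<lambda>x. (\<rho> \<epsilon> x)\<^sup>2 * (norm (X x))\<^sup>2)"
      using L2_inner_integrable[OF J2 X] by (simp add: J_def power2_norm_eq_inner)
    have JD: "(\<integral>x. (norm (J x))\<^sup>2 \<partial>?M) \<le> D"
      unfolding D_def
    proof (rule integral_mono_AE[OF L2_integrable[OF J2] Di])
      show "AE x in ?M. (norm (J x))\<^sup>2 \<le> (\<rho> \<epsilon> x)\<^sup>2 * (norm (X x))\<^sup>2"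
        using \<rho>l
      proof eventually_elim
        case (elim x)
        have "(norm (J x))\<^sup>2 = (\<rho> \<epsilon> x)\<^sup>2 * ((\<rho> \<epsilon> x)\<^sup>2 * (norm (X x))\<^sup>2)"
          by (simp add: J_def power_mult_distrib power2_eq_square)
        also have "\<dots> \<le> 1 * ((\<rho> \<epsilon> x)\<^sup>2 * (norm (X x))\<^sup>2)" using elim by (intro mult_right_mono) auto
        finally show ?case by simp
      qed
    qed
    have XD: "b * (\<integral>x. (norm (X x))\<^sup>2 \<partial>?M) \<le> D"
    proof -
      have "(\<integral>x. b * (norm (X x))\<^sup>2 \<partial>?M) \<le> D"
        unfolding D_def
      proof (rule integral_mono_AE[OF _ Di])
        show "integrable ?M (\<lambda>x. b * (norm (X x))\<^sup>2)" using L2_integrable[OF X] by simp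
        show "AE x in ?M. b * (norm (X x))\<^sup>2 \<le> (\<rho> \<epsilon> x)\<^sup>2 * (norm (X x))\<^sup>2"
          using \<rho>l by eventually_elim (auto intro!: mult_right_mono)
      qed
      then show ?thesis by simp
    qed
    \<comment> \<open>Absorption: the energy inequality and Young's inequality with parameter 1 give
      D \<le> D / 2 + M / 2, so M bounds the square norm of J for all \<epsilon> at once.\<close>
    have "\<bar>\<integral>x. J x \<bullet> Aex x \<partial>?M\<bar> \<le> 1 / 2 * (\<integral>x. (norm (J x))\<^sup>2 \<partial>?M) + 1 / 2 * M"
      using L2_young[OF J2 Aex, of 1] by (simp add: M_def)
    then have DM: "D \<le> M" using DC C0 JD by linarith
    have Bi: "integrable ?M (B0 \<epsilon>)"
    proof (rule L2_integrable_finite[OF _ finite_measure_lebesgue_on[OF UL U(2)]])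
      show "L2 ?M (B0 \<epsilon>)"
      proof (rule L2_vec)
        show "L2 ?M (\<lambda>x. B0 \<epsilon> x $ i)" for i
          using Bf[OF \<epsilon>] H1_wgrad(1)[OF U(1)] by (simp add: B_field_of_def H1_field_def)
      qed
    qed
    have "isoflux_data \<Omega> M (\<rho> \<epsilon>) (B0 \<epsilon>) J"
      using \<rho>m \<rho>01 Bi J2 JD DM Bf[OF \<epsilon>] unfolding isoflux_data_def
      by (auto simp: B_field_of_def J_def X_def G_def)
    then have "\<bar>\<integral>x. J x \<bullet> Aex x \<partial>?M\<bar> < \<tau>" using \<delta>(2) R by blast
    then have DCt: "D + C < \<tau>" using DC by linarith
    have \<phi>: "weak_grad \<Omega> (\<Phi> \<epsilon> (A0 \<epsilon>)) G"
      unfolding G_def using H1_wgrad(2)[OF U(1)] neu[OF \<epsilon>] Jm[OF \<epsilon>]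
      by (simp add: neumann_solution_def J_minimizer_def)
    have Xeq: "X x = Aex x + V x - G x" for x by (simp add: X_def V_def)
    have "m \<le> c / 2 * ((\<integral>x. (norm (X x))\<^sup>2 \<partial>?M) + C) + 1 / (2 * c) * P"
      unfolding m_def C_def P_def by (rule energy_lower_bound[OF U \<psi> V Hex \<phi> X Xeq c])
    also have "\<dots> < c / 2 * (\<tau> / b) + m / 2"
    proof (rule add_le_less_mono[OF _ cP])
      \<comment> \<open>The curl term carries no weight; shrinking it by b < 1 lets one factor b
        serve the whole energy.\<close>
      have "b * C \<le> C" using b C0 by (simp add: mult_left_le_one_le)
      then have "b * ((\<integral>x. (norm (X x))\<^sup>2 \<partial>?M) + C) \<le> \<tau>" using XD DCt by (simp add: distrib_left)
      then have "(\<integral>x. (norm (X x))\<^sup>2 \<partial>?M) + C \<le> \<tau> / b" using b by (simp add: le_divide_eq mult.commute)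
      then show "c / 2 * ((\<integral>x. (norm (X x))\<^sup>2 \<partial>?M) + C) \<le> c / 2 * (\<tau> / b)"
        using c by (intro mult_left_mono) auto
    qed
    also have "c / 2 * (\<tau> / b) + m / 2 = m" using b c by (simp add: \<tau>_def)
    finally show False by simp
  qed
  have "ereal \<delta> \<le> Liminf (at_right 0) (\<lambda>\<epsilon>. isoflux_ratio \<Omega> (\<rho> \<epsilon>) (B0 \<epsilon>))"
    by (rule Liminf_bounded) (use main in \<open>auto simp: eventually_at_filter\<close>)
  then show ?thesis using \<delta>(1) by (simp add: order_less_le_trans[of 0 "ereal \<delta>"])
qed

end
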